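(* Let $\nu\geq1$, $0\leq\alpha<d$ and $1\leq p\leq q<\infty$ with $\frac{1}{q}+\frac{\alpha}{d}=\frac{1}{p}$, and let $\mathcal{S}$ be a sparse collection of dyadic cubes in $\mathbb{R}^d$. Then for every weight $w\in A_{p,q}$ and every nonnegative $f$ with $wf\in L^p(\mathbb{R}^d)$, $$\|\mathcal{A}_{\alpha,\nu}^{\mathcal{S}}(f)\|_{L^{q,\infty}(w^{q})}\lesssim [w]_{A_{p,q}}^{\max(\frac{1}{q},\frac{1}{\nu}-\frac{\alpha}{d})}\,\phi([w^{q}]_{A_{\infty}})\,\|wf\|_{L^{p}},$$ where $$\phi([w^{q}]_{A_{\infty}})=\begin{cases}(\log_{1}[w^{q}]_{A_{\infty}})^{\frac{1}{\nu}}, & \text{if } \nu\leq q\leq\dfrac{\nu}{1-\frac{\nu\alpha}{d}},\\[2mm] 1, & \text{in all other cases,}\end{cases}$$ and $\log_{1}(x)=1+\log_{+}(x)$. Here $\frac{\nu}{1-\nu\alpha/d}$ is read as $+\infty$ when $\nu\alpha\ge d$.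
   Context: A weight on $\mathbb{R}^d$ is a locally integrable function $w:\mathbb{R}^d\to(0,\infty)$; $L^{q,\infty}(w^q)$ is taken with respect to the measure $w^q\,dx$. Dyadic cubes are those of a fixed dyadic grid on $\mathbb{R}^d$. A collection $\mathcal{S}$ of dyadic cubes is sparse (with parameter $0<\gamma<1$) if for each $Q\in\mathcal{S}$ there is $E_Q\subset Q$ with $|E_Q|\geq\gamma|Q|$, the sets $E_Q$, $Q\in\mathcal S$, being pairwise disjoint. For nonnegative $f$ set $$\langle f\rangle_{\alpha,Q}=\frac{1}{|Q|^{1-\alpha/d}}\int_Q f,\qquad \mathcal{A}_{\alpha,\nu}^{\mathcal{S}}(f)=\Big(\sum_{Q\in\mathcal{S}}\langle f\rangle_{\alpha,Q}^{\nu}\mathbf{1}_Q\Big)^{1/\nu}.$$ With $1/p+1/p'=1$, $$[w]_{A_{p,q}}=\sup_Q\Big(\frac{1}{|Q|}\int_Q w^q\Big)\Big(\frac{1}{|Q|}\int_Q w^{-p'}\Big)^{q/p'},$$ where for $p=1$ ($p'=\infty$) the second factor is understood as $\|w^{-1}\|_{L^\infty(Q)}^{q}$; $w\in A_{p,q}$ means $[w]_{A_{p,q}}<\infty$. Also $[u]_{A_\infty}=\sup_Q\frac{1}{u(Q)}\int_Q M(\mathbf{1}_Q u)$, where $u(Q)=\int_Q u$ and $M$ is the Hardy–Littlewood maximal function. By convention all suprema over cubes are over dyadic cubes. The notation $\lesssim$ means inequality up to a constant depending only on $p,q,\nu,\alpha,d$ and the sparsity parameter $\gamma$. $\log_+x=\max(\log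 x,0)$. *)

theory Defs
  imports "HOL-Analysis.Analysis" "HOL-Probability.Essential_Supremum"
begin

section \<open>Powers and logarithms of extended nonnegative reals\<close>

text \<open>Only used with exponents \<open>r > 0\<close>, where \<open>0\<^sup>r = 0\<close> and \<open>\<infinity>\<^sup>r = \<infinity>\<close>.\<close>

definition epowr :: "ennreal \<Rightarrow> real \<Rightarrow> ennreal" where
  "epowr x r = (if x = top then top else ennreal (enn2real x powr r))"

text \<open>\<open>log\<^sub>1 x = 1 + log\<^sub>+ x\<close>; the value \<open>ln 0 = 0\<close> of the library agrees with \<open>log\<^sub>+ 0 = 0\<close>.\<close>

definition log1 :: "ennreal \<Rightarrow> ennreal" where
  "log1 x = (if x = top then top else ennreal (1 + max (ln (enn2real x)) 0))"


section \<open>Dyadic grids and sparse collections\<close>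

definition cube :: "real ^ 'd \<Rightarrow> real \<Rightarrow> (real ^ 'd) set" where
  "cube a l = {x. \<forall>i. a $ i \<le> x $ i \<and> x $ i < a $ i + l}"

text \<open>A dyadic grid: for every integer \<open>k\<close> a partition \<open>G k\<close> of the whole space into cubes of
  side \<open>2\<^sup>-\<^sup>k\<close>, where \<open>G (k + 1)\<close> refines \<open>G k\<close>.  The standard grid is one instance; translated
  ones are others.\<close>

definition dyadic_grid :: "(real ^ 'd) set set \<Rightarrow> bool" where
  "dyadic_grid D \<longleftrightarrow> (\<exists>G :: int \<Rightarrow> (real ^ 'd) set set.
     D = (\<Union>k. G k) \<and>
     (\<forall>k. partition_on UNIV (G k)) \<and>
     (\<forall>k. \<forall>Q\<in>G k. \<exists>a. Q = cube a (2 powi (- k))) \<and>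
     (\<forall>k. \<forall>Q\<in>G (k + 1). \<exists>P\<in>G k. Q \<subseteq> P))"

definition sparse_family :: "real \<Rightarrow> (real ^ 'd) set set \<Rightarrow> bool" where
  "sparse_family \<gamma> S \<longleftrightarrow> (\<exists>E :: (real ^ 'd) set \<Rightarrow> (real ^ 'd) set.
     (\<forall>Q\<in>S. E Q \<in> sets lebesgue \<and> E Q \<subseteq> Q \<and>
        emeasure lebesgue (E Q) \<ge> ennreal \<gamma> * emeasure lebesgue Q) \<and>
     disjoint_family_on E S)"


section \<open>Weights and their characteristics\<close>

definition weight :: "(real ^ 'd \<Rightarrow> real) \<Rightarrow> bool" where
  "weight w \<longleftrightarrow> w \<in> borel_measurable lebesgue \<and> (\<forall>x. w x > 0) \<and>
     (\<forall>K. compact K \<longrightarrow> set_integrable lebesgue K w)"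

definition average :: "(real ^ 'd \<Rightarrow> ennreal) \<Rightarrow> (real ^ 'd) set \<Rightarrow> ennreal" where
  "average u Q = (\<integral>\<^sup>+x\<in>Q. u x \<partial>lebesgue) / emeasure lebesgue Q"

text \<open>All suprema over cubes range over the cubes of the given grid \<open>D\<close>.\<close>

definition Apq_const ::
    "(real ^ 'd) set set \<Rightarrow> real \<Rightarrow> real \<Rightarrow> (real ^ 'd \<Rightarrow> real) \<Rightarrow> ennreal" where
  "Apq_const D p q w = (SUP Q\<in>D.
     average (\<lambda>x. ennreal (w x powr q)) Q *
     (if p = 1 then epowr (esssup (lebesgue_on Q) (\<lambda>x. ennreal (inverse (w x)))) q
      else let p' = p / (p - 1)
           in epowr (average (\<lambda>x. ennreal (w x powr (- p'))) Q) (q / p')))"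

definition maximal_fun ::
    "(real ^ 'd) set set \<Rightarrow> (real ^ 'd \<Rightarrow> ennreal) \<Rightarrow> real ^ 'd \<Rightarrow> ennreal" where
  "maximal_fun D u x = (SUP Q\<in>{Q\<in>D. x \<in> Q}. average u Q)"

definition Ainf_const :: "(real ^ 'd) set set \<Rightarrow> (real ^ 'd \<Rightarrow> ennreal) \<Rightarrow> ennreal" where
  "Ainf_const D u = (SUP Q\<in>D.
     (\<integral>\<^sup>+x\<in>Q. maximal_fun D (\<lambda>y. indicator Q y * u y) x \<partial>lebesgue) /
     (\<integral>\<^sup>+x\<in>Q. u x \<partial>lebesgue))"


section \<open>Norms\<close>

definition Lp_norm :: "real \<Rightarrow> (real ^ 'd \<Rightarrow> real) \<Rightarrow> ennreal" where
  "Lp_norm p g = epowr (\<integral>\<^sup>+x. ennreal (\<bar>g x\<bar> powr p) \<partial>lebesgue) (1 / p)"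

definition weak_Lq_norm :: "'a measure \<Rightarrow> real \<Rightarrow> ('a \<Rightarrow> ennreal) \<Rightarrow> ennreal" where
  "weak_Lq_norm M q g =
     (SUP t\<in>{0::real<..}. ennreal t * epowr (emeasure M {x \<in> space M. g x > ennreal t}) (1 / q))"


section \<open>The sparse operator\<close>

definition frac_average :: "real \<Rightarrow> (real ^ 'd \<Rightarrow> real) \<Rightarrow> (real ^ 'd) set \<Rightarrow> ennreal" where
  "frac_average \<alpha> f Q =
     (\<integral>\<^sup>+x\<in>Q. ennreal (f x) \<partial>lebesgue) /
     epowr (emeasure lebesgue Q) (1 - \<alpha> / real CARD('d))"

definition sparse_op ::
    "real \<Rightarrow> real \<Rightarrow> (real ^ 'd) set set \<Rightarrow> (real ^ 'd \<Rightarrow> real) \<Rightarrow> real ^ 'd \<Rightarrow> ennreal" where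
  "sparse_op \<alpha> \<nu> S f x =
     epowr (\<Sum>\<^sub>\<infinity>Q\<in>S. epowr (frac_average \<alpha> f Q) \<nu> * indicator Q x) (1 / \<nu>)"

text \<open>The upper bound \<open>\<nu> / (1 - \<nu> \<alpha> / d)\<close> on \<open>q\<close> is \<open>+\<infinity>\<close> when \<open>\<nu> \<alpha> \<ge> d\<close>.\<close>

definition phi :: "real \<Rightarrow> real \<Rightarrow> real \<Rightarrow> real \<Rightarrow> ennreal \<Rightarrow> ennreal" where
  "phi d \<alpha> \<nu> q A =
     (if \<nu> \<le> q \<and> (\<nu> * \<alpha> \<ge> d \<or> q \<le> \<nu> / (1 - \<nu> * \<alpha> / d)) then epowr (log1 A) (1 / \<nu>) else 1)"

end

theory Submission
  imports Defs
begin

text \<open>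
  Put \<open>u = w\<^sup>q\<close>, \<open>\<mu> = (w f)\<^sup>p dx\<close>, \<open>r = q / p\<close> and let \<open>a(Q)\<close> be the fractional average of \<open>f\<close>.
  Hoelder's inequality and the \<open>A\<^sub>p\<^sub>,\<^sub>q\<close> condition give \<open>u(Q) a(Q)\<^sup>q \<le> A \<mu>(E)\<^sup>r\<close> up to constants for every
  \<open>E \<subseteq> Q\<close> that carries a fixed part of the mass of \<open>f\<close> in \<open>Q\<close>.
  After rescaling, the cubes with \<open>a(Q) > 1\<close> are discarded by the trivial maximal function bound, and the
  others are split into the levels \<open>a(Q) \<approx> 2\<^sup>-\<^sup>m\<close>.  Inside one level, once the generations are separated,
  a strict subcube carries little of the mass of \<open>f\<close>; hence \<open>E\<close> may be \<open>Q\<close> minus any one subcube, or minus all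
  of them if \<open>\<alpha> = 0\<close>.  An induction over the tree of cubes turns this into
  \<open>\<integral> N\<^sub>m\<^sup>r du \<lesssim> A 2\<^sup>m\<^sup>q \<mu>\<^sup>r\<close> for the counting function \<open>N\<^sub>m\<close> of the level.

  It remains to sum \<open>2\<^sup>-\<^sup>m\<^sup>\<nu> N\<^sub>m\<close> over \<open>m\<close>.  For \<open>p < \<nu>\<close> the \<open>L\<^sup>r\<close> bounds form a decreasing geometric series.
  For \<open>p \<ge> \<nu>\<close> let \<open>\<Lambda>\<close> be a Carleson constant of \<open>u\<close> on the sparse family and \<open>2\<^sup>m\<^sup>\<nu> \<approx> \<Lambda>\<close> define a critical level:
  beyond it the Carleson condition bounds higher moments of \<open>N\<^sub>m\<close> and gives decay; before it the \<open>L\<^sup>r\<close>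
  bounds grow geometrically for \<open>p > \<nu>\<close> (with \<open>\<Lambda> \<approx> A\<close>) and are constant for \<open>p = \<nu>\<close>, where the
  number of levels, with \<open>\<Lambda> \<approx> [u]\<^sub>A\<^sub>\<infinity>\<close>, produces the logarithm.
\<close>

section \<open>Inequalities for real powers\<close>

text \<open>For \<open>\<alpha> > 0\<close> a level bounds the mass of f in a cube only by a power 1
  - \<alpha>/d < 1 of its measure, and such powers do not add up over disjoint subcubes. So just one
  subcube can be removed; what makes up for this is r > 1, since sums of r-th powers of masses
  shrink when a cube is split. For \<open>\<alpha> = 0\<close> one has r = 1 and nothing shrinks,
  but masses and measures are then both additive and all subcubes can go. Weak type enters with the
  cubes where a(Q) > 1: only the measure of their union is bounded. At the critical level both sides
  contribute the power q/\<nu> - q/p of \<Lambda>. With \<Lambda> of size A, taking the q-th root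
  turns 1/q into 1/q + 1/\<nu> - 1/p = 1/\<nu> - \<alpha>/d. For p = \<nu> the number of levels
  raises the threshold for the \<nu>-th power of the operator, not the measure; hence the exponent
  1/\<nu> of the logarithm. The condition in \<phi> amounts to p \<le> \<nu> \<le> q; for p < \<nu>
  the bound is obtained without logarithm, and \<phi> \<ge> 1.\<close>

lemma powr_convex_nonneg:
  fixes b :: real
  assumes "b \<ge> 1"
  shows "convex_on {0..} (\<lambda>x. x powr b)"
proof (rule convex_onI)
  show "convex {0::real..}" by simp
next
  fix t x y :: real
  assume t: "0 < t" "t < 1" and xy: "x \<in> {0..}" "y \<in> {0..}"
  \<comment> \<open>If one of the two points is 0, convexity reduces to this comparison for the
    weight of the other point.\<close>
  have small: "s powr b \<le> s" if "0 < s" "s < 1" for s :: real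
    using powr_mono'[of 1 b s] that assms by simp
  show "((1 - t) *\<^sub>R x + t *\<^sub>R y) powr b \<le> (1 - t) * x powr b + t * y powr b"
  proof (cases "x > 0 \<and> y > 0")
    case True
    then show ?thesis
      using convex_onD[OF powr_convex[OF assms], of t x y] t by simp
  next
    case False
    then consider "x = 0" | "y = 0" using xy by force
    then show ?thesis
    proof cases
      case 1
      then show ?thesis using t xy small[of t]
        by (auto simp: powr_mult intro!: mult_right_mono)
    next
      case 2
      then show ?thesis using t xy small[of "1 - t"]
        by (auto simp: powr_mult intro!: mult_right_mono)
    qed
  qed
qed

text \<open>Jensen's inequality after adding a point with value 0 that takes the missing weight
  \<open>1 - sum \<theta> I\<close>; the option type makes room for it. Convexity is therefore
  needed on the closed half-line.\<close>

lemma powr_sum_le_subconvex: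
  fixes b :: real
  assumes "finite I" "b \<ge> 1" "\<And>i. i \<in> I \<Longrightarrow> \<theta> i \<ge> 0" "sum \<theta> I \<le> 1" "\<And>i. i \<in> I \<Longrightarrow> z i \<ge> 0"
  shows "(\<Sum>i\<in>I. \<theta> i * z i) powr b \<le> (\<Sum>i\<in>I. \<theta> i * z i powr b)"
proof (cases "I = {}")
  case False
  obtain i0 where i0: "i0 \<in> I" using False by blast
  let ?J = "insert None (Some ` I)"
  define th where "th = (\<lambda>j. case j of None \<Rightarrow> 1 - sum \<theta> I | Some i \<Rightarrow> \<theta> i)"
  define zz where "zz = (\<lambda>j. case j of None \<Rightarrow> 0 | Some i \<Rightarrow> z i)"
  have fin: "finite (Some ` I)" using assms(1) by simp
  have s: "(\<Sum>j\<in>?J. g j) = g None + (\<Sum>i\<in>I. g (Some i))" for g :: "_ \<Rightarrow> real"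
    using fin by (simp add: sum.reindex)
  have "(\<Sum>j\<in>?J. th j *\<^sub>R zz j) powr b \<le> (\<Sum>j\<in>?J. th j * zz j powr b)"
    using convex_on_sum[OF _ _ powr_convex_nonneg[OF assms(2)], of ?J th zz] fin assms s[of th]
    by (force simp: th_def zz_def split: option.splits)
  then show ?thesis using assms(2) by (simp add: s th_def zz_def)
qed simp

lemma sum_powr_le_Max:
  fixes r M :: real
  assumes "r \<ge> 1" "\<And>i. i \<in> I \<Longrightarrow> 0 \<le> x i" "\<And>i. i \<in> I \<Longrightarrow> x i \<le> M"
  shows "(\<Sum>i\<in>I. x i powr r) \<le> M powr (r - 1) * (\<Sum>i\<in>I. x i)"
  unfolding sum_distrib_left
proof (rule sum_mono)
  fix i assume i: "i \<in> I"
  have "x i powr r = x i powr (r - 1) * x i"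
    using assms(2)[OF i] powr_add[of "x i" "r - 1" 1] by simp
  also have "\<dots> \<le> M powr (r - 1) * x i"
    using assms i by (intro mult_right_mono powr_mono2) auto
  finally show "x i powr r \<le> M powr (r - 1) * x i" .
qed

lemma sum_powr_le_powr_sum:
  fixes r :: real
  assumes "finite I" "r \<ge> 1" "\<And>i. i \<in> I \<Longrightarrow> 0 \<le> x i"
  shows "(\<Sum>i\<in>I. x i powr r) \<le> (\<Sum>i\<in>I. x i) powr r"
proof -
  have "(\<Sum>i\<in>I. x i powr r) \<le> (\<Sum>i\<in>I. x i) powr (r - 1) * (\<Sum>i\<in>I. x i)"
    by (rule sum_powr_le_Max) (use assms in \<open>auto intro: member_le_sum\<close>)
  also have "\<dots> = (\<Sum>i\<in>I. x i) powr r"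
    using sum_nonneg[of I x] assms(3) powr_add[of "\<Sum>i\<in>I. x i" "r - 1" 1] by simp
  finally show ?thesis .
qed

text \<open>For \<open>e \<le> 1\<close> this is Young's inequality for \<open>1 - y\<close> and 1
  with weights e and 1 - e; for larger e it follows from the case e = 1, as the base is at most
  1.\<close>

lemma one_minus_powr_le:
  fixes e y :: real
  assumes "e > 0" "0 \<le> y" "y \<le> 1"
  shows "(1 - y) powr e \<le> 1 - min 1 e * y"
proof (cases "e \<le> 1")
  case True
  show ?thesis
  proof (cases "y = 1")
    case False
    have "(1 - y) powr e * 1 powr (1 - e) \<le> e * (1 - y) + (1 - e) * 1"
      using Youngs_inequality_0[of e "1 - e" "1 - y" 1] assms True False by simp
    then show ?thesis using True by (simp add: algebra_simps)
  qed (use assms True in auto)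
next
  case False
  have "(1 - y) powr e \<le> (1 - y) powr 1"
    using assms False by (intro powr_mono') auto
  then show ?thesis using assms False by (simp add: min_def)
qed

text \<open>With n / (n + 1) = 1 - y, division by \<open>real (Suc n) powr b\<close> turns the two
  bounds into 1 - b y \<le> (1 - y)^b \<le> 1 - y. They let powers of a counting function be
  exchanged for sums of powers over ranks.\<close>

lemma powr_diff_bounds:
  fixes b :: real
  assumes "b \<ge> 1"
  shows "real (Suc n) powr b - real n powr b \<le> b * real (Suc n) powr (b - 1)"
    and "real (Suc n) powr (b - 1) \<le> real (Suc n) powr b - real n powr b"
proof -
  have e: "real (Suc n) powr b = real (Suc n) * real (Suc n) powr (b - 1)"
    using powr_add[of "real (Suc n)" 1 "b - 1"] by simp
  have q: "real n powr b = real (Suc n) powr b * (real n / real (Suc n)) powr b"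
    by (simp add: powr_divide)
  define y where "y = 1 / real (Suc n)"
  have y: "0 < y" "y \<le> 1" "real n / real (Suc n) = 1 - y" by (auto simp: y_def field_simps)
  have Sy: "real (Suc n) * t * (1 - c * y) = real (Suc n) * t - c * t" for t c
    by (simp add: y_def field_simps)
  have "1 - b * y \<le> (1 - y) powr b"
  proof (cases "y = 1")
    case False
    show ?thesis
    proof (cases "1 - b * y \<le> 0")
      case True then show ?thesis using powr_ge_zero order_trans by blast
    next
      case F: False
      \<comment> \<open>The convex Bernoulli inequality is the concave one with exponent 1 / b at
        the point b y, raised to the power b.\<close>
      have "(1 - b * y) powr (1 / b) \<le> 1 - min 1 (1/b) * (b * y)"
        using one_minus_powr_le[of "1 / b" "b * y"] assms y F by simp
      also have "\<dots> = 1 - y" using assms by (simp add: min_def field_simps)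
      finally have "((1 - b * y) powr (1 / b)) powr b \<le> (1 - y) powr b"
        using assms by (intro powr_mono2) auto
      then show ?thesis using F assms by (simp add: powr_powr)
    qed
  qed (use assms in auto)
  then have "real (Suc n) powr b * (1 - b * y) \<le> real n powr b"
    unfolding q y(3) by (intro mult_left_mono) auto
  then show "real (Suc n) powr b - real n powr b \<le> b * real (Suc n) powr (b - 1)"
    unfolding e using Sy[of _ b] Sy[of _ 1] by simp
  have "(1 - y) powr b \<le> 1 - y"
    using one_minus_powr_le[of b y] assms y by (simp add: min_def split: if_splits)
  then have "real n powr b \<le> real (Suc n) powr b * (1 - y)"
    unfolding q y(3) by (intro mult_left_mono) auto
  then show "real (Suc n) powr (b - 1) \<le> real (Suc n) powr b - real n powr b"
    unfolding e using Sy[of _ b] Sy[of _ 1] by simp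
qed

lemma powr_le_sum_powr:
  fixes b :: real
  assumes "b \<ge> 1"
  shows "real n powr b \<le> b * (\<Sum>i=1..n. real i powr (b - 1))"
proof (induction n)
  case (Suc n)
  then show ?case using powr_diff_bounds(1)[OF assms, of n] by (simp add: distrib_left)
qed simp

lemma sum_powr_le_powr:
  fixes b :: real
  assumes "b \<ge> 1"
  shows "(\<Sum>i=1..n. real i powr (b - 1)) \<le> real n powr b"
proof (induction n)
  case (Suc n)
  then show ?case using powr_diff_bounds(2)[OF assms, of n] by simp
qed simp

lemma geometric_sum_le:
  fixes x :: real
  assumes "0 \<le> x" "x < 1"
  shows "(\<Sum>i<n. x ^ i) \<le> 1 / (1 - x)"
  using sum_le_suminf[OF summable_geometric[of x], of "{..<n}"] assms suminf_geometric[of x] by simp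

section \<open>Laminar families and their overlap functions\<close>

definition laminar :: "'a set set \<Rightarrow> bool" where
  "laminar F \<longleftrightarrow> (\<forall>P\<in>F. \<forall>Q\<in>F. P \<subseteq> Q \<or> Q \<subseteq> P \<or> P \<inter> Q = {})"

definition overlap :: "'a set set \<Rightarrow> 'a \<Rightarrow> nat" where
  "overlap F x = card {Q \<in> F. x \<in> Q}"

definition maxels :: "'a set set \<Rightarrow> 'a set set" where
  "maxels F = {Q \<in> F. \<forall>P\<in>F. Q \<subseteq> P \<longrightarrow> P = Q}"

lemma laminar_subset: "laminar F \<Longrightarrow> G \<subseteq> F \<Longrightarrow> laminar G"
  unfolding laminar_def by blast

lemma laminarD:
  assumes "laminar F" "P \<in> F" "Q \<in> F" "x \<in> P" "x \<in> Q"
  shows "P \<subseteq> Q \<or> Q \<subseteq> P"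
  using assms unfolding laminar_def by (metis disjoint_iff)

lemma maxels_subset: "maxels F \<subseteq> F"
  unfolding maxels_def by blast

lemma finite_maxels: "finite F \<Longrightarrow> finite (maxels F)"
  using maxels_subset finite_subset by blast

lemma maxels_disjoint:
  assumes "laminar F" shows "disjoint (maxels F)"
proof (rule disjointI)
  fix P Q assume "P \<in> maxels F" "Q \<in> maxels F" "P \<noteq> Q"
  then have "P \<in> F" "Q \<in> F" "\<not> P \<subseteq> Q" "\<not> Q \<subseteq> P"
    unfolding maxels_def by auto
  then show "P \<inter> Q = {}" using assms unfolding laminar_def by metis
qed

lemma maxels_above:
  assumes "finite F" "Q \<in> F"
  obtains P where "P \<in> maxels F" "Q \<subseteq> P"
proof -
  have "\<exists>m\<in>F. Q \<subseteq> m \<and> (\<forall>b\<in>F. m \<subseteq> b \<longrightarrow> m = b)"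
    using finite_has_maximal2[OF assms] by auto
  then show ?thesis using that unfolding maxels_def by blast
qed

lemma Union_maxels:
  assumes "finite F" shows "\<Union>(maxels F) = \<Union>F"
proof (intro equalityI subsetI)
  fix x assume "x \<in> \<Union>F"
  then obtain Q where "Q \<in> F" "x \<in> Q" by blast
  then show "x \<in> \<Union>(maxels F)" using maxels_above[OF assms] by blast
qed (use maxels_subset in blast)

lemma overlap_eq_sum:
  assumes "finite F"
  shows "real (overlap F x) = (\<Sum>Q\<in>F. indicator Q x)"
proof -
  have "(\<Sum>Q\<in>F. indicator Q x) = (\<Sum>Q\<in>{Q\<in>F. x \<in> Q}. 1 :: real)"
    using assms by (intro sum.mono_neutral_cong_right) auto
  then show ?thesis by (simp add: overlap_def)
qed

lemma overlap_measurable: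
  assumes "finite F" "F \<subseteq> sets M"
  shows "(\<lambda>x. real (overlap F x)) \<in> borel_measurable M"
  unfolding overlap_eq_sum[OF assms(1)] using assms(2)
  by (intro borel_measurable_sum borel_measurable_indicator) auto

lemma overlap_Un:
  assumes "finite F" "finite G" "F \<inter> G = {}"
  shows "overlap (F \<union> G) x = overlap F x + overlap G x"
proof -
  have "{Q \<in> F \<union> G. x \<in> Q} = {Q \<in> F. x \<in> Q} \<union> {Q \<in> G. x \<in> Q}" by blast
  then show ?thesis unfolding overlap_def using assms by (simp add: card_Un_disjoint disjoint_iff)
qed

lemma overlap_eq_0: "x \<notin> \<Union>F \<Longrightarrow> overlap F x = 0"
proof -
  assume "x \<notin> \<Union>F"
  then have "{Q \<in> F. x \<in> Q} = {}" by blast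
  then show ?thesis unfolding overlap_def by (simp only: card.empty)
qed

section \<open>Moments of the overlap function by induction over the tree\<close>

definition tree_const :: "real \<Rightarrow> real" where
  "tree_const r = (if r = 1 then 1 else 2 powr r / min 1 (r - 1))"

lemma tree_const_pos: "r \<ge> 1 \<Longrightarrow> tree_const r > 0"
  unfolding tree_const_def by auto

text \<open>In the induction behind \<open>nn_integral_overlap_powr_le\<close>, \<open>t\<close> is the share of \<open>\<mu>(P)\<close> lying outside the child of \<open>P\<close> of largest mass:
  for small \<open>t\<close> that child dominates and \<open>c(P)\<close> is negligible, for large \<open>t\<close> the sum of the
  \<open>r\<close>-th powers over the children is smaller than \<open>\<mu>(P)\<^sup>r\<close> by a definite factor.\<close>

lemma tree_step:
  fixes r t :: real
  assumes r: "r > 1" and t: "0 < t" "t \<le> 1"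
  shows "(t / 2) powr (1 - r) * t powr r + (1 - t / 2) powr (1 - r) * (1 - t) powr (r - 1) * tree_const r
    \<le> tree_const r"
proof -
  define K where "K = tree_const r"
  define e where "e = min 1 (r - 1)"
  have e: "e > 0" and K: "K * e = 2 powr r" "K > 0"
    using r by (auto simp: K_def tree_const_def e_def)
  have a: "(t / 2) powr (1 - r) * t powr r = 2 powr (r - 1) * t"
  proof -
    have "(t / 2) powr (1 - r) * t powr r = 2 powr (r - 1) * (t powr (1 - r) * t powr r)"
      using t powr_minus_divide[of 2 "r - 1"] by (simp add: powr_divide)
    also have "t powr (1 - r) * t powr r = t" using t by (simp add: powr_add[symmetric])
    finally show ?thesis .
  qed
  \<comment> \<open>The square of 1 - t / 2 dominates 1 - t; one of its two factors cancels the
    Jensen weight, the other is the gain.\<close>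
  have b: "(1 - t / 2) powr (1 - r) * (1 - t) powr (r - 1) \<le> 1 - e * (t / 2)"
  proof -
    have "1 - t \<le> (1 - t / 2) * (1 - t / 2)" using t by (simp add: algebra_simps)
    then have "(1 - t) powr (r - 1) \<le> ((1 - t / 2) * (1 - t / 2)) powr (r - 1)"
      using r t by (intro powr_mono2) auto
    also have "\<dots> = (1 - t / 2) powr (r - 1) * (1 - t / 2) powr (r - 1)"
      using t by (simp add: powr_mult)
    finally have "(1 - t / 2) powr (1 - r) * (1 - t) powr (r - 1)
      \<le> (1 - t / 2) powr (1 - r) * ((1 - t / 2) powr (r - 1) * (1 - t / 2) powr (r - 1))"
      by (intro mult_left_mono) auto
    also have "\<dots> = (1 - t / 2) powr (r - 1)"
      using t by (simp add: powr_add[symmetric] mult.assoc[symmetric])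
    also have "\<dots> \<le> 1 - e * (t / 2)"
      unfolding e_def using one_minus_powr_le[of "r - 1" "t / 2"] r t by simp
    finally show ?thesis .
  qed
  \<comment> \<open>This is what fixes \<open>tree_const\<close>: the cost
    \<open>2 powr (r - 1) * t\<close> of the top set equals the gain \<open>K * e * (t / 2)\<close>
    on its children.\<close>
  have "2 powr (r - 1) = K * e / 2" using K by (simp add: powr_diff)
  then have "2 powr (r - 1) * t + (1 - e * (t / 2)) * K = K" by (simp add: field_simps)
  moreover have "(1 - t / 2) powr (1 - r) * (1 - t) powr (r - 1) * K \<le> (1 - e * (t / 2)) * K"
    using b K by (intro mult_right_mono) auto
  ultimately show ?thesis unfolding a K_def by linarith
qed

text \<open>A top set adds 1 to the overlap below it. Since r-th powers are not subadditive, 1 and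
  the rest are combined by Jensen with weights t / 2 and 1 - t / 2. The hypothesis, used with the
  heaviest child as \<open>P\<close>, pays for the top set; by induction the rest costs the sum of
  r-th powers of the masses of the children, which is at most the mass of the top set times the (r -
  1)-th power of the largest child mass.\<close>

lemma nn_integral_overlap_powr_le:
  fixes r H :: real
  assumes "finite F" "laminar F" "{} \<notin> F" "F \<subseteq> sets c" "sets \<mu> = sets c" "finite_measure \<mu>"
    and r: "r > 1" and H: "H \<ge> 0"
    and hyp: "\<And>P Q. Q \<in> F \<Longrightarrow> P \<in> insert {} F \<Longrightarrow> P \<subset> Q \<Longrightarrow>
      emeasure c Q \<le> ennreal (H * measure \<mu> (Q - P) powr r)"
  shows "(\<integral>\<^sup>+x. ennreal (real (overlap F x) powr r) \<partial>c)
    \<le> ennreal (tree_const r * H * (\<Sum>Q\<in>maxels F. measure \<mu> Q powr r))"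
  using assms(1-4) hyp
proof (induction "card F" arbitrary: F rule: less_induct)
  case less
  interpret \<mu>: finite_measure \<mu> by fact
  note fin = less.prems(1) and lam = less.prems(2) and ne = less.prems(3) and sts = less.prems(4)
    and hyp = less.prems(5)
  let ?K = "tree_const r"
  have K: "?K > 0" using r by (intro tree_const_pos) auto
  have IH: "(\<integral>\<^sup>+x. ennreal (real (overlap G x) powr r) \<partial>c)
      \<le> ennreal (?K * H * (\<Sum>Q\<in>maxels G. measure \<mu> Q powr r))" if G: "G \<subset> F" for G
  proof (rule less.hyps)
    show "card G < card F" using G fin by (rule psubset_card_mono[rotated])
    show "finite G" "laminar G" using G fin lam by (auto intro: finite_subset laminar_subset)
    show "{} \<notin> G" "G \<subseteq> sets c" using G ne sts by auto
    show "emeasure c Q \<le> ennreal (H * measure \<mu> (Q - P) powr r)"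
      if "Q \<in> G" "P \<in> insert {} G" "P \<subset> Q" for P Q
      using hyp[of Q P] that G by blast
  qed
  show ?case
  proof (cases "F = {}")
    case True
    then show ?thesis by (simp add: overlap_def)
  next
    case False
    then obtain P where P: "P \<in> maxels F" using maxels_above[OF fin] by blast
    then have PF: "P \<in> F" and Pmax: "\<And>Q. Q \<in> F \<Longrightarrow> P \<subseteq> Q \<Longrightarrow> Q = P"
      unfolding maxels_def by auto
    define F1 where "F1 = {Q \<in> F. Q \<subseteq> P}"
    define F2 where "F2 = F - F1"
    show ?thesis
    proof (cases "F2 = {}")
      case False
      have d: "P \<inter> Q = {}" if "Q \<in> F2" for Q
        using that lam PF Pmax unfolding F2_def F1_def laminar_def by blast
      have sub: "F1 \<subset> F" "F2 \<subset> F" using False PF unfolding F1_def F2_def by blast+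
      have un: "F = F1 \<union> F2" "F1 \<inter> F2 = {}" unfolding F1_def F2_def by blast+
      have f12: "finite F1" "finite F2" using fin sub finite_subset by blast+
      have m: "maxels F = maxels F1 \<union> maxels F2" "maxels F1 \<inter> maxels F2 = {}"
      proof -
        have "Q \<inter> R = {}" if "Q \<in> F1" "R \<in> F2" for Q R using d[OF that(2)] that(1) unfolding F1_def by blast
        then have "\<not> Q \<subseteq> R \<and> \<not> R \<subseteq> Q" if "Q \<in> F1" "R \<in> F2" for Q R
          using that ne un by (metis Int_absorb1 Int_absorb2 Un_iff)
        then show "maxels F = maxels F1 \<union> maxels F2" "maxels F1 \<inter> maxels F2 = {}"
          unfolding maxels_def using un by blast+
      qed
      have pw: "real (overlap F x) powr r = real (overlap F1 x) powr r + real (overlap F2 x) powr r" for x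
      proof -
        have "overlap F1 x = 0 \<or> overlap F2 x = 0"
        proof (cases "x \<in> P")
          case True
          then show ?thesis using d by (intro disjI2 overlap_eq_0) blast
        next
          case False
          then show ?thesis unfolding F1_def by (intro disjI1 overlap_eq_0) blast
        qed
        moreover have "overlap F x = overlap F1 x + overlap F2 x"
          using overlap_Un[OF f12 un(2)] un(1) by simp
        ultimately show ?thesis by auto
      qed
      have [measurable]: "(\<lambda>x. real (overlap F1 x)) \<in> borel_measurable c"
        "(\<lambda>x. real (overlap F2 x)) \<in> borel_measurable c"
        using overlap_measurable f12 sub sts by (metis psubsetE subset_trans)+
      have "(\<integral>\<^sup>+x. ennreal (real (overlap F x) powr r) \<partial>c)
        = (\<integral>\<^sup>+x. ennreal (real (overlap F1 x) powr r) \<partial>c) + (\<integral>\<^sup>+x. ennreal (real (overlap F2 x) powr r) \<partial>c)"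
        unfolding pw by (subst nn_integral_add[symmetric]) auto
      also have "\<dots> \<le> ennreal (?K * H * (\<Sum>Q\<in>maxels F1. measure \<mu> Q powr r))
          + ennreal (?K * H * (\<Sum>Q\<in>maxels F2. measure \<mu> Q powr r))"
        by (intro add_mono IH sub)
      also have "\<dots> = ennreal (?K * H * (\<Sum>Q\<in>maxels F. measure \<mu> Q powr r))"
        unfolding m(1) using K H f12 m(2)
        by (subst ennreal_plus[symmetric])
          (auto simp: sum.union_disjoint finite_maxels distrib_left sum_nonneg)
      finally show ?thesis .
    next
      case True
      then have top: "\<And>Q. Q \<in> F \<Longrightarrow> Q \<subseteq> P" unfolding F2_def F1_def by blast
      have maxF: "maxels F = {P}" using PF P top unfolding maxels_def by blast
      define G where "G = F - {P}"
      have GF: "G \<subset> F" "finite G" "F = {P} \<union> G" "{P} \<inter> G = {}" using PF fin unfolding G_def by auto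
      have GP: "Q \<subset> P" if "Q \<in> G" for Q using top that unfolding G_def by blast
      note IH = IH[OF GF(1)]
      have G_sets: "G \<subseteq> sets \<mu>" "P \<in> sets \<mu>" using GF sts PF assms(5) by auto
      have ovP: "real (overlap F x) = indicator P x + real (overlap G x)" for x
        using overlap_Un[of "{P}" G x] GF overlap_eq_sum[of "{P}" x] by simp
      \<comment> \<open>The heaviest child of \<open>P\<close>. A leaf has \<open>C = {}\<close>,
        which is why the hypothesis admits the empty set as \<open>P\<close>.\<close>
      obtain C where C: "C \<in> insert {} G" "\<And>Q. Q \<in> maxels G \<Longrightarrow> measure \<mu> Q \<le> measure \<mu> C"
      proof (cases "maxels G = {}")
        case True then show ?thesis using that[of "{}"] by auto
      next
        case False
        have f: "finite (measure \<mu> ` maxels G)" using finite_maxels[OF GF(2)] by simp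
        obtain C where "C \<in> maxels G" "Max (measure \<mu> ` maxels G) = measure \<mu> C"
          using Max_in[OF f] False by auto
        moreover have "measure \<mu> Q \<le> Max (measure \<mu> ` maxels G)" if "Q \<in> maxels G" for Q
          using Max_ge[OF f] that by blast
        ultimately show ?thesis using that[of C] maxels_subset by auto
      qed
      have CP: "C \<subset> P" "C \<in> sets \<mu>" "C \<in> insert {} F" using C GP G_sets PF ne GF by auto
      define M m where "M = measure \<mu> C" and "m = measure \<mu> P"
      have Mm: "0 \<le> M" "M \<le> m" "measure \<mu> (P - C) = m - M"
        unfolding M_def m_def using CP G_sets by (auto intro: \<mu>.finite_measure_mono simp: \<mu>.finite_measure_Diff)
      have cP: "emeasure c P \<le> ennreal (H * (m - M) powr r)"
        using hyp[OF PF CP(3,1)] Mm by simp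
      show ?thesis
      proof (cases "M = m")
        case True
        \<comment> \<open>One child carries all the mass of \<open>P\<close>, so the hypothesis
          makes \<open>P\<close>, and with it every member of \<open>F\<close>, a null set of
          \<open>c\<close>. Afterwards \<open>t > 0\<close>, as the weights require.\<close>
        then have "P \<in> null_sets c" using cP PF sts by (auto simp: null_sets_def)
        then have "AE x in c. x \<notin> P" by (rule AE_not_in)
        then have "(\<integral>\<^sup>+x. ennreal (real (overlap F x) powr r) \<partial>c) = (\<integral>\<^sup>+x. 0 \<partial>c)"
        proof (intro nn_integral_cong_AE, eventually_elim)
          fix x assume "x \<notin> P"
          then have "overlap F x = 0" using top by (intro overlap_eq_0) auto
          then show "ennreal (real (overlap F x) powr r) = 0" by simp
        qed
        then show ?thesis by simp
      next
        case False
        then have mp: "m > 0" "M < m" using Mm by auto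
        define t where "t = 1 - M / m"
        have t: "0 < t" "t \<le> 1" "m - M = t * m" "M = (1 - t) * m"
          using mp Mm by (auto simp: t_def field_simps)
        define a b where "a = (t / 2) powr (1 - r)" and "b = (1 - t / 2) powr (1 - r)"
        have ab: "a \<ge> 0" "b \<ge> 0" unfolding a_def b_def by auto
        \<comment> \<open>Jensen for the points 1 / (t / 2) and y / (1 - t / 2), whose weighted mean
          is 1 + y.\<close>
        have step: "(1 + y) powr r \<le> a + b * y powr r" if y: "y \<ge> 0" for y
        proof -
          have "(\<Sum>i\<in>{True, False}. (if i then t / 2 else 1 - t / 2) *
               (if i then 1 / (t / 2) else y / (1 - t / 2))) powr r
             \<le> (\<Sum>i\<in>{True, False}. (if i then t / 2 else 1 - t / 2) *
               (if i then 1 / (t / 2) else y / (1 - t / 2)) powr r)"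
            by (rule powr_sum_le_subconvex) (use r t y in auto)
          moreover have "s * (v / s) powr r = s powr (1 - r) * v powr r" if "s > 0" "v \<ge> 0" for s v :: real
            using that by (simp add: powr_divide powr_diff)
          note this[of "t / 2" 1] this[of "1 - t / 2" y]
          ultimately show ?thesis using t y by (simp add: a_def b_def)
        qed
        have [measurable]: "(\<lambda>x. real (overlap G x)) \<in> borel_measurable c" "P \<in> sets c"
          using overlap_measurable GF sts PF by (metis psubsetE subset_trans) (use PF sts in auto)
        have "(\<integral>\<^sup>+x. ennreal (real (overlap F x) powr r) \<partial>c)
          \<le> (\<integral>\<^sup>+x. ennreal a * indicator P x + ennreal b * ennreal (real (overlap G x) powr r) \<partial>c)"
        proof (rule nn_integral_mono)
          fix x
          show "ennreal (real (overlap F x) powr r)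
            \<le> ennreal a * indicator P x + ennreal b * ennreal (real (overlap G x) powr r)"
          proof (cases "x \<in> P")
            case True
            then have "ennreal (real (overlap F x) powr r) \<le> ennreal (a + b * real (overlap G x) powr r)"
              unfolding ovP using step[of "real (overlap G x)"] by (intro ennreal_leI) simp
            then show ?thesis using True ab by (simp add: ennreal_plus ennreal_mult)
          next
            case False
            then have "overlap F x = 0" using top by (intro overlap_eq_0) auto
            then show ?thesis by simp
          qed
        qed
        also have "\<dots> = ennreal a * emeasure c P
            + ennreal b * (\<integral>\<^sup>+x. ennreal (real (overlap G x) powr r) \<partial>c)"
          by (subst nn_integral_add) (auto simp: nn_integral_cmult nn_integral_cmult_indicator)
        also have "\<dots> \<le> ennreal a * ennreal (H * (m - M) powr r)
            + ennreal b * ennreal (?K * H * (\<Sum>Q\<in>maxels G. measure \<mu> Q powr r))"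
          by (intro add_mono mult_left_mono cP IH) auto
        also have "\<dots> = ennreal (a * (H * (m - M) powr r)
            + b * (?K * H * (\<Sum>Q\<in>maxels G. measure \<mu> Q powr r)))"
          using ab H K by (simp add: ennreal_mult ennreal_plus sum_nonneg)
        also have "\<dots> \<le> ennreal (?K * H * m powr r)"
        proof (rule ennreal_leI)
          have "(\<Sum>Q\<in>maxels G. measure \<mu> Q powr r) \<le> M powr (r - 1) * (\<Sum>Q\<in>maxels G. measure \<mu> Q)"
            unfolding M_def by (rule sum_powr_le_Max) (use r C in auto)
          also have "(\<Sum>Q\<in>maxels G. measure \<mu> Q) \<le> m"
          proof -
            have "(\<Sum>Q\<in>maxels G. measure \<mu> Q) = measure \<mu> (\<Union>(maxels G))"
              using maxels_disjoint[OF laminar_subset[OF lam psubset_imp_subset[OF GF(1)]]]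
                finite_maxels[OF GF(2)] G_sets maxels_subset[of G]
              by (intro measure_Union'[symmetric]) (auto simp: pairwise_def disjoint_def disjnt_def fmeasurable_def less_top[symmetric])
            also have "\<dots> \<le> m" unfolding m_def using maxels_subset[of G] GP G_sets(2)
              by (intro \<mu>.finite_measure_mono) auto
            finally show ?thesis .
          qed
          finally have "(\<Sum>Q\<in>maxels G. measure \<mu> Q powr r) \<le> M powr (r - 1) * m"
            by (simp add: mult_left_mono)
          then have "a * (H * (m - M) powr r) + b * (?K * H * (\<Sum>Q\<in>maxels G. measure \<mu> Q powr r))
            \<le> a * (H * (m - M) powr r) + b * (?K * H * (M powr (r - 1) * m))"
            using ab H K by (intro add_left_mono mult_left_mono) auto
          also have "\<dots> = H * m powr r * (a * t powr r + b * (1 - t) powr (r - 1) * ?K)"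
          proof -
            have "(m - M) powr r = t powr r * m powr r"
              unfolding t(3) using t mp by (simp add: powr_mult)
            moreover have "M powr (r - 1) * m = (1 - t) powr (r - 1) * m powr r"
              unfolding t(4) using t mp by (simp add: powr_mult powr_diff)
            ultimately show ?thesis by (simp add: algebra_simps)
          qed
          also have "\<dots> \<le> H * m powr r * ?K"
            using tree_step[OF r t(1,2)] H unfolding a_def b_def by (intro mult_left_mono) auto
          finally show "a * (H * (m - M) powr r) + b * (?K * H * (\<Sum>Q\<in>maxels G. measure \<mu> Q powr r))
            \<le> ?K * H * m powr r" by (simp add: mult_ac)
        qed
        finally show ?thesis by (simp add: maxF m_def)
      qed
    qed
  qed
qed

text \<open>For r = 1 the masses of the children may add up to that of the parent, so removing a
  single child gains nothing. Here all of them are removed, and the remainders are pairwise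
  disjoint.\<close>

lemma nn_integral_overlap_le:
  fixes H :: real
  assumes "finite F" "laminar F" "F \<subseteq> sets c" "sets \<mu> = sets c" "finite_measure \<mu>" "H \<ge> 0"
    and hyp: "\<And>Q. Q \<in> F \<Longrightarrow> emeasure c Q \<le> ennreal (H * measure \<mu> (Q - \<Union>{P \<in> F. P \<subset> Q}))"
  shows "(\<integral>\<^sup>+x. ennreal (real (overlap F x)) \<partial>c) \<le> ennreal (H * measure \<mu> (space \<mu>))"
proof -
  interpret \<mu>: finite_measure \<mu> by fact
  define E where "E Q = Q - \<Union>{P \<in> F. P \<subset> Q}" for Q
  have E_sets: "E Q \<in> sets \<mu>" if "Q \<in> F" for Q
    unfolding E_def using that assms(1,3,4) by (intro sets.Diff sets.finite_Union) auto
  have disj: "disjoint_family_on E F"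
    unfolding disjoint_family_on_def
  proof (intro ballI impI equals0I)
    fix P Q x assume *: "P \<in> F" "Q \<in> F" "P \<noteq> Q" "x \<in> E P \<inter> E Q"
    then have "P \<subset> Q \<or> Q \<subset> P" using laminarD[OF assms(2), of P Q x] unfolding E_def by blast
    then show False using * unfolding E_def by blast
  qed
  have "(\<integral>\<^sup>+x. ennreal (real (overlap F x)) \<partial>c) = (\<integral>\<^sup>+x. (\<Sum>Q\<in>F. indicator Q x) \<partial>c)"
    by (simp add: overlap_eq_sum[OF assms(1)] sum_ennreal[symmetric] ennreal_indicator del: sum_ennreal)
  also have "\<dots> = (\<Sum>Q\<in>F. emeasure c Q)"
    using assms(3) by (subst nn_integral_sum) (auto intro!: sum.cong nn_integral_indicator)
  also have "\<dots> \<le> (\<Sum>Q\<in>F. ennreal (H * measure \<mu> (E Q)))"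
    unfolding E_def by (intro sum_mono hyp)
  also have "\<dots> = ennreal (H * (\<Sum>Q\<in>F. measure \<mu> (E Q)))"
    using assms(6) by (simp add: sum_distrib_left)
  also have "(\<Sum>Q\<in>F. measure \<mu> (E Q)) = measure \<mu> (\<Union>Q\<in>F. E Q)"
    using E_sets disj assms(1) by (intro \<mu>.finite_measure_finite_Union[symmetric]) auto
  also have "ennreal (H * \<dots>) \<le> ennreal (H * measure \<mu> (space \<mu>))"
    using assms(6) \<mu>.bounded_measure by (intro ennreal_leI mult_left_mono) auto
  finally show ?thesis .
qed

lemma sum_maxels_powr_le:
  fixes r :: real
  assumes "finite F" "laminar F" "F \<subseteq> sets \<mu>" "finite_measure \<mu>" "r \<ge> 1"
  shows "(\<Sum>Q\<in>maxels F. measure \<mu> Q powr r) \<le> measure \<mu> (space \<mu>) powr r"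
proof -
  interpret \<mu>: finite_measure \<mu> by fact
  have "(\<Sum>Q\<in>maxels F. measure \<mu> Q powr r) \<le> (\<Sum>Q\<in>maxels F. measure \<mu> Q) powr r"
    by (rule sum_powr_le_powr_sum) (use assms finite_maxels in auto)
  also have "(\<Sum>Q\<in>maxels F. measure \<mu> Q) = measure \<mu> (\<Union>Q\<in>maxels F. Q)"
    using maxels_disjoint[OF assms(2)] finite_maxels[OF assms(1)] assms(3) maxels_subset[of F]
    by (intro \<mu>.finite_measure_finite_Union[symmetric]) (auto simp: disjoint_family_on_disjoint_image disjoint_family_on_def disjoint_def)
  also have "\<dots> powr r \<le> measure \<mu> (space \<mu>) powr r"
    using assms(5) \<mu>.bounded_measure by (intro powr_mono2) auto
  finally show ?thesis .
qed

text \<open>The maximal members are disjoint and cover the union, and r-th powers of masses are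
  superadditive. This is the maximal function bound for the cubes with large average.\<close>

lemma emeasure_Union_laminar_le:
  fixes r H :: real
  assumes "finite F" "laminar F" "F \<subseteq> sets c" "sets \<mu> = sets c" "finite_measure \<mu>" "r \<ge> 1" "H \<ge> 0"
    and hyp: "\<And>Q. Q \<in> F \<Longrightarrow> emeasure c Q \<le> ennreal (H * measure \<mu> Q powr r)"
  shows "emeasure c (\<Union>F) \<le> ennreal (H * measure \<mu> (space \<mu>) powr r)"
proof -
  have "emeasure c (\<Union>F) = emeasure c (\<Union>Q\<in>maxels F. Q)"
    using Union_maxels[OF assms(1)] by simp
  also have "\<dots> \<le> (\<Sum>Q\<in>maxels F. emeasure c Q)"
    using assms(1,3) maxels_subset[of F] finite_maxels by (intro emeasure_subadditive_finite) auto
  also have "\<dots> \<le> (\<Sum>Q\<in>maxels F. ennreal (H * measure \<mu> Q powr r))"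
    using maxels_subset[of F] by (intro sum_mono hyp) auto
  also have "\<dots> = ennreal (H * (\<Sum>Q\<in>maxels F. measure \<mu> Q powr r))"
    using assms(7) by (simp add: sum_distrib_left)
  also have "\<dots> \<le> ennreal (H * measure \<mu> (space \<mu>) powr r)"
    using sum_maxels_powr_le[OF assms(1,2) _ assms(5,6)] assms(3,4,7)
    by (intro ennreal_leI mult_left_mono) auto
  finally show ?thesis .
qed

section \<open>Ranks along chains, and higher moments under a Carleson condition\<close>

lemma sum_chain_card:
  fixes g :: "nat \<Rightarrow> 'b::comm_monoid_add"
  assumes "finite X" "\<And>P Q. P \<in> X \<Longrightarrow> Q \<in> X \<Longrightarrow> P \<subseteq> Q \<or> Q \<subseteq> P"
  shows "(\<Sum>Q\<in>X. g (card {P \<in> X. Q \<subseteq> P})) = (\<Sum>i=1..card X. g i)"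
  using assms
proof (induction "card X" arbitrary: X)
  case (Suc n)
  then have "X \<noteq> {}" by auto
  then obtain m where m: "m \<in> X" "\<And>P. P \<in> X \<Longrightarrow> m \<subseteq> P"
    using finite_has_minimal[OF Suc.prems(1)] Suc.prems(2) by metis
  define Y where "Y = X - {m}"
  have Y: "X = insert m Y" "m \<notin> Y" "finite Y" "card Y = n"
    using m(1) Suc.prems(1) Suc.hyps(2) unfolding Y_def by auto
  have "{P \<in> X. Q \<subseteq> P} = {P \<in> Y. Q \<subseteq> P}" if "Q \<in> Y" for Q
    using that m Y unfolding Y_def by auto
  moreover have "{P \<in> X. m \<subseteq> P} = X" using m by auto
  moreover have "(\<Sum>Q\<in>Y. g (card {P \<in> Y. Q \<subseteq> P})) = (\<Sum>i=1..card Y. g i)"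
    using Y Suc.prems by (intro Suc.hyps(1)) auto
  moreover have "card X = Suc n" using Suc.hyps(2) by simp
  moreover have "(\<Sum>Q\<in>X. g (card {P \<in> X. Q \<subseteq> P}))
      = g (card {P \<in> X. m \<subseteq> P}) + (\<Sum>Q\<in>Y. g (card {P \<in> X. Q \<subseteq> P}))"
    unfolding Y_def using Suc.prems(1) m(1) by (rule sum.remove)
  ultimately show ?case using Y(4) by (simp add: add.commute)
qed simp

definition depth :: "'a set set \<Rightarrow> 'a set \<Rightarrow> nat" where
  "depth F Q = card {P \<in> F. Q \<subseteq> P}"

text \<open>The members through x form a chain, and every member containing one of them also
  contains x. So the depths met at x are 1, ..., \<open>overlap F x\<close>, each exactly
  once.\<close>

lemma sum_depth_overlap:
  fixes g :: "nat \<Rightarrow> real"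
  assumes "finite F" "laminar F"
  shows "(\<Sum>Q\<in>F. g (depth F Q) * indicator Q x) = (\<Sum>i=1..overlap F x. g i)"
proof -
  let ?X = "{Q \<in> F. x \<in> Q}"
  have "(\<Sum>Q\<in>F. g (depth F Q) * indicator Q x) = (\<Sum>Q\<in>?X. g (depth F Q))"
    using assms(1) by (intro sum.mono_neutral_cong_right) auto
  also have "\<dots> = (\<Sum>Q\<in>?X. g (card {P \<in> ?X. Q \<subseteq> P}))"
    unfolding depth_def by (intro sum.cong refl arg_cong[where f = g] arg_cong[where f = card]) auto
  also have "\<dots> = (\<Sum>i=1..overlap F x. g i)"
    unfolding overlap_def using assms(1) laminarD[OF assms(2), of _ _ x] by (intro sum_chain_card) simp_all
  finally show ?thesis .
qed

lemma sum_depth_above: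
  fixes g :: "nat \<Rightarrow> real"
  assumes "finite F" "laminar F" "Q \<noteq> {}"
  shows "(\<Sum>P\<in>{P\<in>F. Q \<subseteq> P}. g (depth F P)) = (\<Sum>i=1..depth F Q. g i)"
proof -
  let ?X = "{P \<in> F. Q \<subseteq> P}"
  obtain x where "x \<in> Q" using assms(3) by blast
  then have ch: "P \<subseteq> P' \<or> P' \<subseteq> P" if "P \<in> ?X" "P' \<in> ?X" for P P'
    using that laminarD[OF assms(2), of P P' x] by blast
  have "(\<Sum>P\<in>?X. g (depth F P)) = (\<Sum>P\<in>?X. g (card {R \<in> ?X. P \<subseteq> R}))"
    unfolding depth_def by (intro sum.cong refl arg_cong[where f = g] arg_cong[where f = card]) auto
  also have "\<dots> = (\<Sum>i=1..depth F Q. g i)"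
    unfolding depth_def using assms ch by (intro sum_chain_card) auto
  finally show ?thesis .
qed

text \<open>The power b + 1 of the overlap is unfolded twice: into a sum of b-th powers of depths
  over the members, and each of those into a sum of (b - 1)-th powers over the ancestors. Exchanging
  the two sums collects all members below a fixed \<open>P\<close>, where the Carleson condition
  applies; the sum that remains folds back into the b-th power. One more power thus costs one factor
  \<open>\<Lambda>\<close>.\<close>

lemma nn_integral_overlap_powr_Suc_le:
  fixes b \<Lambda> :: real
  assumes "finite F" "laminar F" "{} \<notin> F" "F \<subseteq> sets c" "b \<ge> 1" "\<Lambda> \<ge> 0"
    and carl: "\<And>P. P \<in> F \<Longrightarrow> (\<Sum>Q\<in>{Q\<in>F. Q \<subseteq> P}. emeasure c Q) \<le> ennreal \<Lambda> * emeasure c P"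
  shows "(\<integral>\<^sup>+x. ennreal (real (overlap F x) powr (b + 1)) \<partial>c)
    \<le> ennreal (b * (b + 1) * \<Lambda>) * (\<integral>\<^sup>+x. ennreal (real (overlap F x) powr b) \<partial>c)"
proof -
  let ?k = "\<lambda>Q. real (depth F Q)"
  have intsum: "(\<integral>\<^sup>+x. ennreal (\<Sum>Q\<in>F. g Q * indicator Q x) \<partial>c) = (\<Sum>Q\<in>F. ennreal (g Q) * emeasure c Q)"
    if g: "\<And>Q. g Q \<ge> 0" for g :: "_ \<Rightarrow> real"
  proof -
    have "(\<integral>\<^sup>+x. ennreal (\<Sum>Q\<in>F. g Q * indicator Q x) \<partial>c) = (\<integral>\<^sup>+x. (\<Sum>Q\<in>F. ennreal (g Q) * indicator Q x) \<partial>c)"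
      using g by (simp add: sum_ennreal[symmetric] ennreal_mult ennreal_indicator del: sum_ennreal)
    also have "\<dots> = (\<Sum>Q\<in>F. ennreal (g Q) * emeasure c Q)"
      using assms(4) by (subst nn_integral_sum) (auto intro!: sum.cong nn_integral_cmult_indicator)
    finally show ?thesis .
  qed
  have "(\<integral>\<^sup>+x. ennreal (real (overlap F x) powr (b + 1)) \<partial>c)
    \<le> (\<integral>\<^sup>+x. ennreal (\<Sum>Q\<in>F. ((b + 1) * ?k Q powr b) * indicator Q x) \<partial>c)"
  proof (intro nn_integral_mono ennreal_leI)
    fix x
    have "real (overlap F x) powr (b + 1) \<le> (b + 1) * (\<Sum>i=1..overlap F x. real i powr b)"
      using powr_le_sum_powr[of "b + 1" "overlap F x"] assms(5) by simp
    also have "\<dots> = (\<Sum>Q\<in>F. ((b + 1) * ?k Q powr b) * indicator Q x)"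
      using sum_depth_overlap[OF assms(1,2), of "\<lambda>i. (b + 1) * real i powr b" x] by (simp add: sum_distrib_left)
    finally show "real (overlap F x) powr (b + 1) \<le> (\<Sum>Q\<in>F. ((b + 1) * ?k Q powr b) * indicator Q x)" .
  qed
  also have "\<dots> = (\<Sum>Q\<in>F. ennreal ((b + 1) * ?k Q powr b) * emeasure c Q)"
    using assms(5) by (intro intsum) auto
  also have "\<dots> \<le> (\<Sum>Q\<in>F. ennreal (b * (b + 1)) * ((\<Sum>P\<in>{P\<in>F. Q \<subseteq> P}. ennreal (?k P powr (b - 1))) * emeasure c Q))"
  proof (rule sum_mono)
    fix Q assume Q: "Q \<in> F"
    have "Q \<noteq> {}" using Q assms(3) by blast
    note above = sum_depth_above[OF assms(1,2) this, of "\<lambda>i. real i powr (b - 1)"]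
    have "(b + 1) * ?k Q powr b \<le> (b + 1) * (b * (\<Sum>P\<in>{P\<in>F. Q \<subseteq> P}. ?k P powr (b - 1)))"
      unfolding above using powr_le_sum_powr[of b "depth F Q"] assms(5) by (intro mult_left_mono) auto
    then have "ennreal ((b + 1) * ?k Q powr b) \<le> ennreal (b * (b + 1)) * (\<Sum>P\<in>{P\<in>F. Q \<subseteq> P}. ennreal (?k P powr (b - 1)))"
      using assms(5) by (simp add: ennreal_mult[symmetric] sum_nonneg mult.assoc mult.left_commute ennreal_leI)
    then show "ennreal ((b + 1) * ?k Q powr b) * emeasure c Q
      \<le> ennreal (b * (b + 1)) * ((\<Sum>P\<in>{P\<in>F. Q \<subseteq> P}. ennreal (?k P powr (b - 1))) * emeasure c Q)"
      by (simp add: mult.assoc[symmetric] mult_right_mono)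
  qed
  also have "\<dots> = ennreal (b * (b + 1)) * (\<Sum>Q\<in>F. \<Sum>P\<in>{P\<in>F. Q \<subseteq> P}. ennreal (?k P powr (b - 1)) * emeasure c Q)"
    by (simp add: sum_distrib_left sum_distrib_right del: sum_ennreal)
  also have "(\<Sum>Q\<in>F. \<Sum>P\<in>{P\<in>F. Q \<subseteq> P}. ennreal (?k P powr (b - 1)) * emeasure c Q)
     = (\<Sum>P\<in>F. \<Sum>Q\<in>{Q\<in>F. Q \<subseteq> P}. ennreal (?k P powr (b - 1)) * emeasure c Q)"
    by (rule sum.swap_restrict) (use assms(1) in auto)
  also have "\<dots> = (\<Sum>P\<in>F. ennreal (?k P powr (b - 1)) * (\<Sum>Q\<in>{Q\<in>F. Q \<subseteq> P}. emeasure c Q))"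
    by (simp add: sum_distrib_left)
  also have "\<dots> \<le> (\<Sum>P\<in>F. ennreal (?k P powr (b - 1)) * (ennreal \<Lambda> * emeasure c P))"
    by (intro sum_mono mult_left_mono carl) auto
  also have "\<dots> = ennreal \<Lambda> * (\<Sum>P\<in>F. ennreal (?k P powr (b - 1)) * emeasure c P)"
    by (simp add: sum_distrib_left mult.left_commute)
  also have "(\<Sum>P\<in>F. ennreal (?k P powr (b - 1)) * emeasure c P)
     = (\<integral>\<^sup>+x. ennreal (\<Sum>P\<in>F. ?k P powr (b - 1) * indicator P x) \<partial>c)"
    by (intro intsum[symmetric]) auto
  also have "\<dots> \<le> (\<integral>\<^sup>+x. ennreal (real (overlap F x) powr b) \<partial>c)"
    using sum_depth_overlap[OF assms(1,2), of "\<lambda>i. real i powr (b - 1)"] sum_powr_le_powr[OF assms(5)]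
    by (intro nn_integral_mono ennreal_leI) simp
  finally show ?thesis
    using assms(5,6) by (simp add: ennreal_mult mult.assoc mult_left_mono)
qed

definition moment_const :: "real \<Rightarrow> nat \<Rightarrow> real" where
  "moment_const b n = (\<Prod>i<n. (b + real i) * (b + real i + 1))"

lemma moment_const_pos: "b \<ge> 1 \<Longrightarrow> moment_const b n > 0"
  unfolding moment_const_def by (intro prod_pos) auto

lemma nn_integral_overlap_powr_add_le:
  fixes b \<Lambda> :: real
  assumes "finite F" "laminar F" "{} \<notin> F" "F \<subseteq> sets c" "b \<ge> 1" "\<Lambda> \<ge> 0"
    and carl: "\<And>P. P \<in> F \<Longrightarrow> (\<Sum>Q\<in>{Q\<in>F. Q \<subseteq> P}. emeasure c Q) \<le> ennreal \<Lambda> * emeasure c P"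
  shows "(\<integral>\<^sup>+x. ennreal (real (overlap F x) powr (b + real n)) \<partial>c)
    \<le> ennreal (moment_const b n * \<Lambda> ^ n) * (\<integral>\<^sup>+x. ennreal (real (overlap F x) powr b) \<partial>c)"
proof (induction n)
  case 0
  then show ?case by (simp add: moment_const_def)
next
  case (Suc n)
  let ?b = "b + real n"
  have "(\<integral>\<^sup>+x. ennreal (real (overlap F x) powr (b + real (Suc n))) \<partial>c)
      \<le> ennreal (?b * (?b + 1) * \<Lambda>) * (\<integral>\<^sup>+x. ennreal (real (overlap F x) powr ?b) \<partial>c)"
    using nn_integral_overlap_powr_Suc_le[OF assms(1-4), of ?b \<Lambda>] assms(5,6) carl
    by (simp add: add.assoc add.commute[of 1])
  also have "\<dots> \<le> ennreal (?b * (?b + 1) * \<Lambda>) * (ennreal (moment_const b n * \<Lambda> ^ n) * (\<integral>\<^sup>+x. ennreal (real (overlap F x) powr b) \<partial>c))"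
    by (intro mult_left_mono Suc) auto
  also have "\<dots> = ennreal (moment_const b (Suc n) * \<Lambda> ^ Suc n) * (\<integral>\<^sup>+x. ennreal (real (overlap F x) powr b) \<partial>c)"
    unfolding mult.assoc[symmetric] using assms(5,6) moment_const_pos[OF assms(5), of n]
    by (subst ennreal_mult[symmetric]) (auto simp: moment_const_def mult_ac)
  finally show ?case .
qed

text \<open>Chebyshev and Jensen for the mean of \<open>z i x / \<theta> i\<close> with weights
  \<open>\<theta> i\<close>. This does the work of the triangle inequality in the Lebesgue space of
  exponent b: weights proportional to the norm bounds of the summands lose only constants.\<close>

lemma emeasure_sum_ge_1_le:
  fixes b :: real
  assumes "finite I" "b \<ge> 1" "\<And>i. i \<in> I \<Longrightarrow> \<theta> i > 0" "sum \<theta> I \<le> 1"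
    and "\<And>i x. i \<in> I \<Longrightarrow> z i x \<ge> 0" and z: "\<And>i. i \<in> I \<Longrightarrow> z i \<in> borel_measurable c"
  shows "emeasure c {x \<in> space c. (\<Sum>i\<in>I. z i x) \<ge> 1}
    \<le> (\<Sum>i\<in>I. ennreal (\<theta> i powr (1 - b)) * (\<integral>\<^sup>+x. ennreal (z i x powr b) \<partial>c))"
proof -
  have m: "(\<lambda>x. \<Sum>i\<in>I. z i x) \<in> borel_measurable c" using z by simp
  have "{x \<in> space c. (\<Sum>i\<in>I. z i x) \<ge> 1} \<in> sets c" using m by measurable
  then have "emeasure c {x \<in> space c. (\<Sum>i\<in>I. z i x) \<ge> 1}
    = (\<integral>\<^sup>+x. indicator {x \<in> space c. (\<Sum>i\<in>I. z i x) \<ge> 1} x \<partial>c)" by simp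
  also have "\<dots> \<le> (\<integral>\<^sup>+x. (\<Sum>i\<in>I. ennreal (\<theta> i powr (1 - b)) * ennreal (z i x powr b)) \<partial>c)"
  proof (rule nn_integral_mono)
    fix x
    show "indicator {x \<in> space c. (\<Sum>i\<in>I. z i x) \<ge> 1} x
      \<le> (\<Sum>i\<in>I. ennreal (\<theta> i powr (1 - b)) * ennreal (z i x powr b))"
    proof (cases "(\<Sum>i\<in>I. z i x) \<ge> 1")
      case True
      have "1 powr b \<le> (\<Sum>i\<in>I. z i x) powr b" using True assms(2) by (intro powr_mono2) auto
      also have "(\<Sum>i\<in>I. z i x) = (\<Sum>i\<in>I. \<theta> i * (z i x / \<theta> i))"
        using assms(3) by (intro sum.cong) (auto simp: less_imp_neq[symmetric])
      also have "\<dots> powr b \<le> (\<Sum>i\<in>I. \<theta> i * (z i x / \<theta> i) powr b)"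
        by (rule powr_sum_le_subconvex) (use assms in \<open>auto simp: less_imp_le\<close>)
      also have "\<dots> = (\<Sum>i\<in>I. \<theta> i powr (1 - b) * z i x powr b)"
        using assms(3,5) by (intro sum.cong) (auto simp: powr_divide powr_diff less_imp_le)
      finally have "1 \<le> ennreal (\<Sum>i\<in>I. \<theta> i powr (1 - b) * z i x powr b)" by simp
      also have "\<dots> = (\<Sum>i\<in>I. ennreal (\<theta> i powr (1 - b)) * ennreal (z i x powr b))"
        by (subst sum_ennreal[symmetric]) (auto simp: ennreal_mult)
      finally show ?thesis by (auto simp: indicator_def)
    qed simp
  qed
  also have "\<dots> = (\<Sum>i\<in>I. \<integral>\<^sup>+x. ennreal (\<theta> i powr (1 - b)) * ennreal (z i x powr b) \<partial>c)"
    using z by (intro nn_integral_sum) measurable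
  also have "\<dots> = (\<Sum>i\<in>I. ennreal (\<theta> i powr (1 - b)) * (\<integral>\<^sup>+x. ennreal (z i x powr b) \<partial>c))"
    using z by (intro sum.cong refl nn_integral_cmult) measurable
  finally show ?thesis .
qed

section \<open>Summation over levels\<close>

text \<open>With k = 1 - 2^(-e) normalising geometric weights of ratio 2^(-e), this is k^(-b): the
  Jensen weights give k^(1 - b), and summing the series gives 1 / k.\<close>

definition geom_const :: "real \<Rightarrow> real \<Rightarrow> real" where
  "geom_const e b = (1 - 2 powr (- e)) powr (- b)"

text \<open>The norm of exponent b of the m-th summand is bounded by a multiple of 2^(-m e) with e =
  \<nu> - q / b > 0. The weights \<open>th\<close> decay at the same rate from \<open>m0\<close>
  on.\<close>

lemma emeasure_geometric_tail_le:
  fixes b q \<nu> B :: real and N :: "nat \<Rightarrow> 'a \<Rightarrow> real"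
  assumes b: "b \<ge> 1" and B: "B \<ge> 0" and qb: "q < \<nu> * b"
    and N0: "\<And>m x. N m x \<ge> 0" and [measurable]: "\<And>m. N m \<in> borel_measurable c"
    and int: "\<And>m. (\<integral>\<^sup>+x. ennreal (N m x powr b) \<partial>c) \<le> ennreal (B * 2 powr (real m * q))"
  shows "emeasure c {x \<in> space c. (\<Sum>m=m0..<M. 2 powr (- (real m * \<nu>)) * N m x) \<ge> 1}
    \<le> ennreal (geom_const ((\<nu> * b - q) / b) b * B * 2 powr (real m0 * (q - \<nu> * b)))"
proof -
  define e where "e = (\<nu> * b - q) / b"
  define k where "k = 1 - 2 powr (- e)"
  have e: "e > 0" "e * b = \<nu> * b - q" using b qb by (auto simp: e_def)
  have k: "0 < k" "2 powr (- e) < 1" using e powr_less_one[of 2 "- e"] by (auto simp: k_def)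
  define th where "th m = k * 2 powr (- (real (m - m0) * e))" for m
  have geo: "(\<Sum>m=m0..<M. 2 powr (- (real (m - m0) * e))) \<le> 1 / k"
  proof -
    have "(\<Sum>m=m0..<M. 2 powr (- (real (m - m0) * e))) = (\<Sum>i<M - m0. (2 powr (- e)) ^ i)"
      by (rule sum.reindex_bij_witness[of _ "\<lambda>i. i + m0" "\<lambda>m. m - m0"])
         (auto simp: powr_realpow[symmetric] powr_powr mult_ac)
    also have "\<dots> \<le> 1 / k" unfolding k_def using k by (intro geometric_sum_le) auto
    finally show ?thesis .
  qed
  have "emeasure c {x \<in> space c. (\<Sum>m=m0..<M. 2 powr (- (real m * \<nu>)) * N m x) \<ge> 1}
    \<le> (\<Sum>m=m0..<M. ennreal (th m powr (1 - b)) * (\<integral>\<^sup>+x. ennreal ((2 powr (- (real m * \<nu>)) * N m x) powr b) \<partial>c))"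
  proof (rule emeasure_sum_ge_1_le)
    show "sum th {m0..<M} \<le> 1"
      using geo k by (simp add: th_def sum_distrib_left[symmetric] field_simps)
  qed (use b k N0 in \<open>auto simp: th_def\<close>)
  also have "\<dots> \<le> (\<Sum>m=m0..<M. ennreal (k powr (1 - b) * B * 2 powr (real m0 * (q - \<nu> * b)) * 2 powr (- (real (m - m0) * e))))"
  proof (rule sum_mono)
    fix m assume m: "m \<in> {m0..<M}"
    have "(\<integral>\<^sup>+x. ennreal ((2 powr (- (real m * \<nu>)) * N m x) powr b) \<partial>c)
      = ennreal (2 powr (- (real m * \<nu> * b))) * (\<integral>\<^sup>+x. ennreal (N m x powr b) \<partial>c)"
      using N0 by (simp add: powr_mult powr_powr ennreal_mult nn_integral_cmult)
    also have "\<dots> \<le> ennreal (2 powr (- (real m * \<nu> * b))) * ennreal (B * 2 powr (real m * q))"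
      by (intro mult_left_mono int) auto
    finally have "ennreal (th m powr (1 - b)) * (\<integral>\<^sup>+x. ennreal ((2 powr (- (real m * \<nu>)) * N m x) powr b) \<partial>c)
      \<le> ennreal (th m powr (1 - b)) * (ennreal (2 powr (- (real m * \<nu> * b))) * ennreal (B * 2 powr (real m * q)))"
      by (intro mult_left_mono) auto
    also have "\<dots> = ennreal (th m powr (1 - b) * (2 powr (- (real m * \<nu> * b)) * (B * 2 powr (real m * q))))"
      using B by (simp add: ennreal_mult)
    also have "th m powr (1 - b) * (2 powr (- (real m * \<nu> * b)) * (B * 2 powr (real m * q)))
      = k powr (1 - b) * B * 2 powr (- (real (m - m0) * e) * (1 - b) - real m * \<nu> * b + real m * q)"
    proof -
      have "th m powr (1 - b) = k powr (1 - b) * 2 powr (- (real (m - m0) * e) * (1 - b))"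
        unfolding th_def using k by (simp add: powr_mult powr_powr)
      then show ?thesis by (simp add: powr_add powr_diff powr_minus divide_inverse mult_ac)
    qed
    also have "- (real (m - m0) * e) * (1 - b) - real m * \<nu> * b + real m * q
      = real m0 * (q - \<nu> * b) - real (m - m0) * e"
    proof -
      obtain d where d: "m = m0 + d" using m by (auto simp: le_iff_add)
      have "real d * (e * b) = real d * (\<nu> * b - q)" using e by simp
      then show ?thesis unfolding d by (simp add: algebra_simps)
    qed
    finally show "ennreal (th m powr (1 - b)) * (\<integral>\<^sup>+x. ennreal ((2 powr (- (real m * \<nu>)) * N m x) powr b) \<partial>c)
      \<le> ennreal (k powr (1 - b) * B * 2 powr (real m0 * (q - \<nu> * b)) * 2 powr (- (real (m - m0) * e)))"
      by (simp only: powr_diff powr_minus divide_inverse mult.assoc)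
  qed
  also have "\<dots> = ennreal (k powr (1 - b) * B * 2 powr (real m0 * (q - \<nu> * b)) * (\<Sum>m=m0..<M. 2 powr (- (real (m - m0) * e))))"
    using B by (simp add: sum_distrib_left)
  also have "\<dots> \<le> ennreal (k powr (1 - b) * B * 2 powr (real m0 * (q - \<nu> * b)) * (1 / k))"
    using geo B by (intro ennreal_leI mult_left_mono) auto
  also have "k powr (1 - b) * B * 2 powr (real m0 * (q - \<nu> * b)) * (1 / k)
     = k powr (- b) * B * 2 powr (real m0 * (q - \<nu> * b))"
    using k by (simp add: powr_diff powr_minus field_simps)
  finally show ?thesis unfolding geom_const_def e_def k_def .
qed

text \<open>The mirror image of the tail: the norm bounds now grow with m, so the weights decay
  downwards from the last index \<open>m0 - 1\<close>.\<close>

lemma emeasure_geometric_head_le: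
  fixes b q \<nu> B :: real and N :: "nat \<Rightarrow> 'a \<Rightarrow> real"
  assumes b: "b \<ge> 1" and B: "B \<ge> 0" and qb: "\<nu> * b < q"
    and N0: "\<And>m x. N m x \<ge> 0" and [measurable]: "\<And>m. N m \<in> borel_measurable c"
    and int: "\<And>m. (\<integral>\<^sup>+x. ennreal (N m x powr b) \<partial>c) \<le> ennreal (B * 2 powr (real m * q))"
  shows "emeasure c {x \<in> space c. (\<Sum>m<m0. 2 powr (- (real m * \<nu>)) * N m x) \<ge> 1}
    \<le> ennreal (geom_const ((q - \<nu> * b) / b) b * B * 2 powr (real m0 * (q - \<nu> * b)))"
proof -
  define e where "e = (q - \<nu> * b) / b"
  define k where "k = 1 - 2 powr (- e)"
  have e: "e > 0" "e * b = q - \<nu> * b" using b qb by (auto simp: e_def)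
  have k: "0 < k" "2 powr (- e) < 1" using e powr_less_one[of 2 "- e"] by (auto simp: k_def)
  define th where "th m = k * 2 powr (- (real (m0 - Suc m) * e))" for m
  have geo: "(\<Sum>m<m0. 2 powr (- (real (m0 - Suc m) * e))) \<le> 1 / k"
  proof -
    have "(\<Sum>m<m0. 2 powr (- (real (m0 - Suc m) * e))) = (\<Sum>i<m0. (2 powr (- e)) ^ i)"
      by (subst sum.nat_diff_reindex) (auto simp: powr_realpow[symmetric] powr_powr mult_ac)
    also have "\<dots> \<le> 1 / k" unfolding k_def using k by (intro geometric_sum_le) auto
    finally show ?thesis .
  qed
  have "emeasure c {x \<in> space c. (\<Sum>m<m0. 2 powr (- (real m * \<nu>)) * N m x) \<ge> 1}
    \<le> (\<Sum>m<m0. ennreal (th m powr (1 - b)) * (\<integral>\<^sup>+x. ennreal ((2 powr (- (real m * \<nu>)) * N m x) powr b) \<partial>c))"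
  proof (rule emeasure_sum_ge_1_le)
    show "sum th {..<m0} \<le> 1"
      using geo k by (simp add: th_def sum_distrib_left[symmetric] field_simps)
  qed (use b k N0 in \<open>auto simp: th_def\<close>)
  also have "\<dots> \<le> (\<Sum>m<m0. ennreal (k powr (1 - b) * B * 2 powr (real m0 * (q - \<nu> * b)) * 2 powr (- (real (m0 - Suc m) * e))))"
  proof (rule sum_mono)
    fix m assume m: "m \<in> {..<m0}"
    have "(\<integral>\<^sup>+x. ennreal ((2 powr (- (real m * \<nu>)) * N m x) powr b) \<partial>c)
      = ennreal (2 powr (- (real m * \<nu> * b))) * (\<integral>\<^sup>+x. ennreal (N m x powr b) \<partial>c)"
      using N0 by (simp add: powr_mult powr_powr ennreal_mult nn_integral_cmult)
    also have "\<dots> \<le> ennreal (2 powr (- (real m * \<nu> * b))) * ennreal (B * 2 powr (real m * q))"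
      by (intro mult_left_mono int) auto
    finally have "ennreal (th m powr (1 - b)) * (\<integral>\<^sup>+x. ennreal ((2 powr (- (real m * \<nu>)) * N m x) powr b) \<partial>c)
      \<le> ennreal (th m powr (1 - b)) * (ennreal (2 powr (- (real m * \<nu> * b))) * ennreal (B * 2 powr (real m * q)))"
      by (intro mult_left_mono) auto
    also have "\<dots> = ennreal (th m powr (1 - b) * (2 powr (- (real m * \<nu> * b)) * (B * 2 powr (real m * q))))"
      using B by (simp add: ennreal_mult)
    also have "th m powr (1 - b) * (2 powr (- (real m * \<nu> * b)) * (B * 2 powr (real m * q)))
      = k powr (1 - b) * B * 2 powr (- (real (m0 - Suc m) * e) * (1 - b) - real m * \<nu> * b + real m * q)"
    proof -
      have "th m powr (1 - b) = k powr (1 - b) * 2 powr (- (real (m0 - Suc m) * e) * (1 - b))"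
        unfolding th_def using k by (simp add: powr_mult powr_powr)
      then show ?thesis by (simp add: powr_add powr_diff powr_minus divide_inverse mult_ac)
    qed
    \<comment> \<open>The largest term sits at \<open>m0 - 1\<close>; stating the bound at
      \<open>m0\<close> gives away a factor \<open>2 powr (e * b)\<close>.\<close>
    also have "ennreal \<dots> \<le> ennreal (k powr (1 - b) * B * 2 powr (real m0 * (q - \<nu> * b) - real (m0 - Suc m) * e))"
    proof (intro ennreal_leI mult_left_mono powr_mono)
      obtain d where d: "m0 = Suc m + d" using m by (auto simp: Suc_le_eq[symmetric] le_iff_add)
      have "real d * (e * b) = real d * (q - \<nu> * b)" using e by simp
      then have "- (real (m0 - Suc m) * e) * (1 - b) - real m * \<nu> * b + real m * q + e * b
        = real m0 * (q - \<nu> * b) - real (m0 - Suc m) * e"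
        unfolding d using e by (simp add: algebra_simps)
      then show "- (real (m0 - Suc m) * e) * (1 - b) - real m * \<nu> * b + real m * q
        \<le> real m0 * (q - \<nu> * b) - real (m0 - Suc m) * e"
        using mult_pos_pos[of e b] e b by linarith
    qed (use B in auto)
    finally show "ennreal (th m powr (1 - b)) * (\<integral>\<^sup>+x. ennreal ((2 powr (- (real m * \<nu>)) * N m x) powr b) \<partial>c)
      \<le> ennreal (k powr (1 - b) * B * 2 powr (real m0 * (q - \<nu> * b)) * 2 powr (- (real (m0 - Suc m) * e)))"
      by (simp only: powr_diff powr_minus divide_inverse mult.assoc)
  qed
  also have "\<dots> = ennreal (k powr (1 - b) * B * 2 powr (real m0 * (q - \<nu> * b)) * (\<Sum>m<m0. 2 powr (- (real (m0 - Suc m) * e))))"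
    using B by (simp add: sum_distrib_left)
  also have "\<dots> \<le> ennreal (k powr (1 - b) * B * 2 powr (real m0 * (q - \<nu> * b)) * (1 / k))"
    using geo B by (intro ennreal_leI mult_left_mono) auto
  also have "k powr (1 - b) * B * 2 powr (real m0 * (q - \<nu> * b)) * (1 / k)
     = k powr (- b) * B * 2 powr (real m0 * (q - \<nu> * b))"
    using k by (simp add: powr_diff powr_minus field_simps)
  finally show ?thesis unfolding geom_const_def e_def k_def .
qed

text \<open>All summands have the same norm bound, so all weights are \<open>1 / m0\<close>. The
  threshold is raised to \<open>m0\<close>, which keeps the bound free of \<open>m0\<close>; the
  number of levels thereby ends up under the \<nu>-th root.\<close>

lemma emeasure_uniform_head_le:
  fixes b q \<nu> B :: real and N :: "nat \<Rightarrow> 'a \<Rightarrow> real"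
  assumes b: "b \<ge> 1" and B: "B \<ge> 0" and qb: "\<nu> * b = q" and m0: "m0 > 0"
    and N0: "\<And>m x. N m x \<ge> 0" and [measurable]: "\<And>m. N m \<in> borel_measurable c"
    and int: "\<And>m. (\<integral>\<^sup>+x. ennreal (N m x powr b) \<partial>c) \<le> ennreal (B * 2 powr (real m * q))"
  shows "emeasure c {x \<in> space c. (\<Sum>m<m0. 2 powr (- (real m * \<nu>)) * N m x) \<ge> real m0} \<le> ennreal B"
proof -
  have "{x \<in> space c. (\<Sum>m<m0. 2 powr (- (real m * \<nu>)) * N m x) \<ge> real m0}
     = {x \<in> space c. (\<Sum>m<m0. 2 powr (- (real m * \<nu>)) * N m x / real m0) \<ge> 1}"
    using m0 by (simp add: sum_divide_distrib[symmetric] field_simps)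
  also have "emeasure c \<dots>
    \<le> (\<Sum>m<m0. ennreal ((1 / real m0) powr (1 - b)) * (\<integral>\<^sup>+x. ennreal ((2 powr (- (real m * \<nu>)) * N m x / real m0) powr b) \<partial>c))"
    by (rule emeasure_sum_ge_1_le) (use b m0 N0 in auto)
  also have "\<dots> \<le> (\<Sum>m<m0. ennreal (B / real m0))"
  proof (rule sum_mono)
    fix m
    have "(\<integral>\<^sup>+x. ennreal ((2 powr (- (real m * \<nu>)) * N m x / real m0) powr b) \<partial>c)
      = (\<integral>\<^sup>+x. ennreal (2 powr (- (real m * q)) * (1 / real m0) powr b) * ennreal (N m x powr b) \<partial>c)"
      using N0 qb[symmetric] m0 by (intro nn_integral_cong)
        (simp add: powr_mult powr_divide powr_powr ennreal_mult[symmetric] mult_ac)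
    also have "\<dots> \<le> ennreal (2 powr (- (real m * q)) * (1 / real m0) powr b) * ennreal (B * 2 powr (real m * q))"
      by (subst nn_integral_cmult) (auto intro: mult_left_mono int)
    finally have "ennreal ((1 / real m0) powr (1 - b)) * (\<integral>\<^sup>+x. ennreal ((2 powr (- (real m * \<nu>)) * N m x / real m0) powr b) \<partial>c)
      \<le> ennreal ((1 / real m0) powr (1 - b)) * (ennreal (2 powr (- (real m * q)) * (1 / real m0) powr b) * ennreal (B * 2 powr (real m * q)))"
      by (intro mult_left_mono) auto
    also have "\<dots> = ennreal ((1 / real m0) powr (1 - b) * ((2 powr (- (real m * q)) * (1 / real m0) powr b) * (B * 2 powr (real m * q))))"
      using B by (simp add: ennreal_mult)
    also have "(1 / real m0) powr (1 - b) * ((2 powr (- (real m * q)) * (1 / real m0) powr b) * (B * 2 powr (real m * q)))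
       = B * ((1 / real m0) powr (1 - b) * (1 / real m0) powr b) * (2 powr (- (real m * q)) * 2 powr (real m * q))"
      by (simp add: mult_ac)
    also have "\<dots> = B / real m0" using m0 by (simp add: powr_add[symmetric])
    finally show "ennreal ((1 / real m0) powr (1 - b)) * (\<integral>\<^sup>+x. ennreal ((2 powr (- (real m * \<nu>)) * N m x / real m0) powr b) \<partial>c)
      \<le> ennreal (B / real m0)" .
  qed
  also have "\<dots> = ennreal B" using B m0 by (simp add: ennreal_of_nat_eq_real_of_nat ennreal_mult[symmetric])
  finally show ?thesis .
qed

text \<open>As m is a natural number, the levels exhaust only the sets with \<open>0 < a Q\<close>
  and \<open>a Q \<le> 1\<close>.\<close>

definition level :: "('a set \<Rightarrow> real) \<Rightarrow> 'a set set \<Rightarrow> nat \<Rightarrow> 'a set set" where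
  "level a S m = {Q \<in> S. 2 powr (- (real m + 1)) < a Q \<and> a Q \<le> 2 powr (- real m)}"

lemma level_subset: "level a S m \<subseteq> S"
  unfolding level_def by blast

text \<open>On a finite family only finitely many levels are occupied. Admitting every
  \<open>M' \<ge> M\<close> allows the cut to be placed beyond any prescribed critical
  level.\<close>

lemma sum_le_sum_levels:
  fixes a :: "'a set \<Rightarrow> real" and \<nu> :: real
  assumes "finite S" "\<nu> \<ge> 0" "\<And>Q. Q \<in> S \<Longrightarrow> 0 \<le> a Q"
  shows "\<exists>M. \<forall>M'\<ge>M. \<forall>x. x \<notin> \<Union>{Q \<in> S. a Q > 1} \<longrightarrow>
    (\<Sum>Q\<in>S. a Q powr \<nu> * indicator Q x) \<le> (\<Sum>m<M'. 2 powr (- (real m * \<nu>)) * real (overlap (level a S m) x))"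
proof -
  define l where "l Q = nat \<lfloor>- log 2 (a Q)\<rfloor>" for Q
  \<comment> \<open>Any common strict bound for the finitely many level indices serves; the sum
    avoids a maximum over a possibly empty set.\<close>
  define M where "M = Suc (\<Sum>Q\<in>S. l Q)"
  have l: "Q \<in> level a S (l Q)" "a Q \<le> 2 powr (- real (l Q))" "l Q < M"
    if Q: "Q \<in> S" "0 < a Q" "a Q \<le> 1" for Q
  proof -
    have "log 2 (a Q) \<le> 0" using Q by simp
    then have "real (l Q) \<le> - log 2 (a Q)" "- log 2 (a Q) < real (l Q) + 1"
      unfolding l_def by linarith+
    then have "log 2 (a Q) \<le> - real (l Q)" "- (real (l Q) + 1) < log 2 (a Q)" by auto
    then have 1: "a Q \<le> 2 powr (- real (l Q))" "2 powr (- (real (l Q) + 1)) < a Q"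
      using Q by (auto simp: log_le_iff less_log_iff)
    then show "Q \<in> level a S (l Q)" "a Q \<le> 2 powr (- real (l Q))"
      using Q by (auto simp: level_def)
    show "l Q < M" unfolding M_def using member_le_sum[of Q S l] Q assms(1) by simp
  qed
  have "(\<Sum>Q\<in>S. a Q powr \<nu> * indicator Q x) \<le> (\<Sum>m<M'. 2 powr (- (real m * \<nu>)) * real (overlap (level a S m) x))"
    if M': "M' \<ge> M" and x: "x \<notin> \<Union>{Q \<in> S. a Q > 1}" for M' x
  proof -
    let ?h = "\<lambda>m Q. if Q \<in> level a S m then 2 powr (- (real m * \<nu>)) * indicator Q x else 0 :: real"
    have "(\<Sum>Q\<in>S. a Q powr \<nu> * indicator Q x) \<le> (\<Sum>Q\<in>S. \<Sum>m<M'. ?h m Q)"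
    proof (rule sum_mono)
      fix Q assume Q: "Q \<in> S"
      show "a Q powr \<nu> * indicator Q x \<le> (\<Sum>m<M'. ?h m Q)"
      proof (cases "x \<in> Q \<and> a Q > 0")
        case True
        then have a: "0 < a Q" "a Q \<le> 1" using x Q by force+
        have "a Q powr \<nu> * indicator Q x \<le> (2 powr (- real (l Q))) powr \<nu> * indicator Q x"
          using l(2)[OF Q a] a assms(2) by (intro mult_right_mono powr_mono2) auto
        also have "\<dots> = ?h (l Q) Q" using l(1)[OF Q a] by (simp add: powr_powr)
        also have "\<dots> \<le> (\<Sum>m<M'. ?h m Q)"
          using l(3)[OF Q a] M' by (intro member_le_sum) auto
        finally show ?thesis .
      next
        case False
        \<comment> \<open>Sets with \<open>a Q = 0\<close> lie in no level; they drop out because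
          \<open>0 powr \<nu> = 0\<close>, even for \<nu> = 0.\<close>
        then have "a Q powr \<nu> * indicator Q x = 0" using assms(3)[OF Q] by (auto simp: indicator_def)
        also have "\<dots> \<le> (\<Sum>m<M'. ?h m Q)" by (intro sum_nonneg) auto
        finally show ?thesis .
      qed
    qed
    also have "\<dots> = (\<Sum>m<M'. \<Sum>Q\<in>S. ?h m Q)" by (rule sum.swap)
    also have "\<dots> = (\<Sum>m<M'. 2 powr (- (real m * \<nu>)) * real (overlap (level a S m) x))"
    proof (intro sum.cong refl)
      fix m
      have f: "finite (level a S m)" using assms(1) level_subset finite_subset by metis
      have "(\<Sum>Q\<in>S. ?h m Q) = (\<Sum>Q\<in>level a S m. 2 powr (- (real m * \<nu>)) * indicator Q x)"
        using assms(1) level_subset[of a S m] by (intro sum.mono_neutral_cong_right) auto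
      then show "(\<Sum>Q\<in>S. ?h m Q) = 2 powr (- (real m * \<nu>)) * real (overlap (level a S m) x)"
        by (simp add: overlap_eq_sum[OF f] sum_distrib_left)
    qed
    finally show ?thesis .
  qed
  then show ?thesis by blast
qed

section \<open>Sparse families with a testing condition\<close>

text \<open>\<open>L\<close>, \<open>c\<close>, \<open>\<mu>\<close>, \<open>lam\<close> stand for
  Lebesgue measure, w^q dx, (w f)^p dx and f dx. The number \<open>N\<close> of generations to be
  separated is such that the share 1 / (N \<gamma>) of a cube that deep descendants can cover has
  \<tau>-th power at most 1/4. Sparseness is present only through \<open>packing\<close>, the weight
  condition only through \<open>testing\<close>.\<close>

locale sparse_setting =
  fixes L c \<mu> lam :: "'a measure" and S :: "'a set set" and A r q \<tau> \<gamma> :: real and N :: nat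
  assumes sets_eq: "sets c = sets L" "sets \<mu> = sets L" "sets lam = sets L"
    and finS: "finite S" and lamS: "laminar S" and neS: "{} \<notin> S" and S_sets: "S \<subseteq> sets L"
    and L_pos: "\<And>Q. Q \<in> S \<Longrightarrow> 0 < measure L Q"
    and L_fin: "\<And>Q. Q \<in> S \<Longrightarrow> emeasure L Q < top"
    and lam_fin: "\<And>Q. Q \<in> S \<Longrightarrow> emeasure lam Q < top"
    and c_fin: "\<And>Q. Q \<in> S \<Longrightarrow> emeasure c Q < top"
    and fin_mu: "finite_measure \<mu>"
    and A_nonneg: "A \<ge> 0" and r_ge: "r \<ge> 1" and q_pos: "q > 0" and tau: "0 < \<tau>" "r = 1 \<Longrightarrow> \<tau> = 1"
    and gamma: "\<gamma> > 0" and N: "N \<ge> 1" "(1 / (real N * \<gamma>)) powr \<tau> \<le> 1 / 4"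
    and packing: "\<And>Q. Q \<in> S \<Longrightarrow> (\<Sum>P\<in>{P\<in>S. P \<subseteq> Q}. measure L P) \<le> measure L Q / \<gamma>"
    and testing: "\<And>Q E. Q \<in> S \<Longrightarrow> E \<in> sets L \<Longrightarrow> E \<subseteq> Q \<Longrightarrow>
      measure c Q * (measure lam E / measure L Q powr \<tau>) powr q \<le> A * measure \<mu> E powr r"
begin

definition a :: "'a set \<Rightarrow> real" where
  "a Q = measure lam Q / measure L Q powr \<tau>"

abbreviation "W \<equiv> measure \<mu> (space \<mu>) powr r"

lemma in_sets: "Q \<in> S \<Longrightarrow> Q \<in> sets L \<and> Q \<in> sets c \<and> Q \<in> sets \<mu> \<and> Q \<in> sets lam"
  using S_sets sets_eq by auto

lemma fin_emeasure:
  assumes "Q \<in> S"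
  shows "emeasure L Q \<noteq> \<infinity>" "emeasure lam Q \<noteq> \<infinity>" "emeasure c Q \<noteq> \<infinity>"
    "emeasure L Q = ennreal (measure L Q)" "emeasure c Q = ennreal (measure c Q)"
  using L_fin[OF assms] lam_fin[OF assms] c_fin[OF assms] by (auto intro: emeasure_eq_ennreal_measure)

text \<open>By \<open>packing\<close> the cubes inside \<open>Q\<close> cover it on average at most
  1 / \<gamma> times. A point x of a deep descendant \<open>P\<close> lies in at least
  \<open>N\<close> of them, because a cube containing \<open>P\<close> either is one of those
  through x or contains \<open>Q\<close>. Chebyshev's inequality concludes.\<close>

lemma measure_deep_descendants_le:
  assumes Q: "Q \<in> S"
  shows "measure L (\<Union>{P \<in> S. P \<subset> Q \<and> depth S Q + N \<le> depth S P}) \<le> measure L Q / (real N * \<gamma>)"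
    (is "measure L ?X \<le> _")
proof -
  let ?D = "{P \<in> S. P \<subseteq> Q}"
  have finD: "finite ?D" using finS by simp
  have X_sets: "?X \<in> sets L" using finS S_sets by (intro sets.finite_Union) auto
  have X_sub: "?X \<subseteq> Q" by blast
  have pw: "real N * indicator ?X x \<le> real (overlap ?D x)" for x
  proof (cases "x \<in> ?X")
    case True
    then obtain P where P: "P \<in> S" "P \<subset> Q" "depth S Q + N \<le> depth S P" "x \<in> P" by blast
    have "{R \<in> S. P \<subseteq> R} \<subseteq> {R \<in> ?D. x \<in> R} \<union> {R \<in> S. Q \<subseteq> R}"
    proof
      fix R assume "R \<in> {R \<in> S. P \<subseteq> R}"
      then have "R \<in> S" "x \<in> R" using P by auto
      moreover have "x \<in> Q" using P by auto
      ultimately have "R \<subseteq> Q \<or> Q \<subseteq> R" using laminarD[OF lamS _ Q] by blast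
      then show "R \<in> {R \<in> ?D. x \<in> R} \<union> {R \<in> S. Q \<subseteq> R}" using \<open>R \<in> S\<close> \<open>x \<in> R\<close> by blast
    qed
    then have "depth S P \<le> card ({R \<in> ?D. x \<in> R} \<union> {R \<in> S. Q \<subseteq> R})"
      unfolding depth_def using finS by (intro card_mono) auto
    also have "\<dots> \<le> overlap ?D x + depth S Q"
      unfolding overlap_def depth_def by (rule card_Un_le)
    finally show ?thesis using P(3) True by simp
  qed simp
  have "ennreal (real N) * emeasure L ?X = (\<integral>\<^sup>+x. ennreal (real N) * indicator ?X x \<partial>L)"
    using X_sets by (simp add: nn_integral_cmult_indicator)
  also have "\<dots> \<le> (\<integral>\<^sup>+x. (\<Sum>P\<in>?D. indicator P x) \<partial>L)"
  proof (rule nn_integral_mono)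
    fix x
    have "ennreal (real N * indicator ?X x) \<le> ennreal (\<Sum>P\<in>?D. indicator P x)"
      using pw[of x] overlap_eq_sum[OF finD, of x] by (intro ennreal_leI) simp
    then show "ennreal (real N) * indicator ?X x \<le> (\<Sum>P\<in>?D. indicator P x)"
      by (simp add: ennreal_mult ennreal_indicator sum_ennreal[symmetric] del: sum_ennreal)
  qed
  also have "\<dots> = (\<Sum>P\<in>?D. emeasure L P)"
    using in_sets by (subst nn_integral_sum) (auto intro!: sum.cong nn_integral_indicator borel_measurable_indicator)
  also have "\<dots> = ennreal (\<Sum>P\<in>?D. measure L P)"
    by (simp add: fin_emeasure(4))
  also have "\<dots> \<le> ennreal (measure L Q / \<gamma>)" using packing[OF Q] by (rule ennreal_leI)
  finally have *: "ennreal (real N) * emeasure L ?X \<le> ennreal (measure L Q / \<gamma>)" .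
  have "emeasure L ?X \<le> emeasure L Q" using X_sub in_sets[OF Q] by (intro emeasure_mono) auto
  then have "emeasure L ?X = ennreal (measure L ?X)"
    using L_fin[OF Q] by (intro emeasure_eq_ennreal_measure) (auto simp: top_unique)
  then have "ennreal (real N * measure L ?X) \<le> ennreal (measure L Q / \<gamma>)"
    using * by (simp add: ennreal_mult)
  then have "real N * measure L ?X \<le> measure L Q / \<gamma>"
    using gamma by (subst (asm) ennreal_le_iff) auto
  then show ?thesis using N gamma by (simp add: field_simps)
qed

text \<open>In units of 2^(-m) times the \<tau>-th power of the measure of \<open>Q\<close>, the
  mass of \<open>Q\<close> exceeds 1/2 and that of \<open>E\<close> is at most 1/4. So 1/4 remains
  on \<open>Q - E\<close>, where \<open>testing\<close> is applied; this quarter is the origin of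
  \<open>4 powr q\<close>.\<close>

lemma emeasure_le_of_small_part:
  assumes Q: "Q \<in> S" and aQ: "2 powr (- (real m + 1)) < a Q" and E: "E \<in> sets L" "E \<subseteq> Q"
    and small: "measure lam E \<le> 2 powr (- real m) * measure L Q powr \<tau> / 4"
  shows "emeasure c Q \<le> ennreal (4 powr q * 2 powr (real m * q) * A * measure \<mu> (Q - E) powr r)"
proof -
  let ?l = "measure L Q powr \<tau>"
  have l: "?l > 0" using L_pos[OF Q] by simp
  have diff: "measure lam (Q - E) = measure lam Q - measure lam E"
    using in_sets[OF Q] lam_fin[OF Q] E sets_eq by (intro measure_Diff) auto
  have large: "2 powr (- (real m + 1)) * ?l < measure lam Q"
    using aQ l unfolding a_def by (simp add: field_simps)
  have e: "2 powr (- (real m + 1)) = 2 powr (- real m) / (2::real)" "2 powr (- (real m + 2)) = 2 powr (- real m) / (4::real)"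
    by (simp_all add: powr_diff powr_minus field_simps powr_add)
  have "2 powr (- real m) * ?l / 2 < measure lam Q" using large unfolding e by simp
  then have "2 powr (- real m) * ?l / 4 \<le> measure lam (Q - E)"
    unfolding diff using small by simp
  then have "2 powr (- (real m + 2)) * ?l \<le> measure lam (Q - E)" unfolding e by simp
  then have "2 powr (- (real m + 2)) \<le> measure lam (Q - E) / ?l" using l by (simp add: field_simps)
  then have "(2 powr (- (real m + 2))) powr q \<le> (measure lam (Q - E) / ?l) powr q"
    using q_pos by (intro powr_mono2) auto
  moreover have "(2 powr (- (real m + 2))) powr q = 1 / 2 powr ((real m + 2) * q)"
    by (simp add: powr_powr powr_minus_divide[symmetric] algebra_simps)
  ultimately have "1 / 2 powr ((real m + 2) * q) \<le> (measure lam (Q - E) / ?l) powr q" by metis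
  then have "measure c Q * (1 / 2 powr ((real m + 2) * q)) \<le> measure c Q * (measure lam (Q - E) / ?l) powr q"
    by (intro mult_left_mono) auto
  also have "\<dots> \<le> A * measure \<mu> (Q - E) powr r"
    using in_sets[OF Q] E by (intro testing Q) auto
  finally have "measure c Q \<le> 2 powr ((real m + 2) * q) * (A * measure \<mu> (Q - E) powr r)"
    by (simp add: field_simps)
  also have "2 powr ((real m + 2) * q) = 4 powr q * 2 powr (real m * q)"
  proof -
    have "4 powr q = (2 powr 2) powr q" by simp
    also have "\<dots> = 2 powr (2 * q)" by (rule powr_powr)
    finally show ?thesis by (simp add: powr_add[symmetric] algebra_simps)
  qed
  finally have "measure c Q \<le> 4 powr q * 2 powr (real m * q) * A * measure \<mu> (Q - E) powr r"
    by (simp add: mult_ac)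
  then show ?thesis
    using c_fin[OF Q] by (subst emeasure_eq_ennreal_measure) (auto intro: ennreal_leI)
qed

text \<open>Separation makes whatever the strict subcubes cover small in measure. For r > 1 this
  smallness is passed on to the mass of one subcube at a time, which is what the tree induction asks
  for. For r = 1 one has \<open>\<tau> = 1\<close>, and summing over the disjoint maximal subcubes
  passes it on to the mass of their union.\<close>

lemma nn_integral_separated_level_le:
  assumes G: "G \<subseteq> level a S m"
    and sep: "\<And>P Q. P \<in> G \<Longrightarrow> Q \<in> G \<Longrightarrow> P \<subset> Q \<Longrightarrow> depth S Q + N \<le> depth S P"
  shows "(\<integral>\<^sup>+x. ennreal (real (overlap G x) powr r) \<partial>c)
    \<le> ennreal (tree_const r * (4 powr q * 2 powr (real m * q) * A) * W)"
proof -
  interpret \<mu>: finite_measure \<mu> by (rule fin_mu)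
  let ?H = "4 powr q * 2 powr (real m * q) * A"
  have H: "?H \<ge> 0" using A_nonneg by simp
  have GS: "G \<subseteq> S" using G level_subset by blast
  have fG: "finite G" "laminar G" "{} \<notin> G" "G \<subseteq> sets c"
    using GS finS neS in_sets lamS by (auto intro: finite_subset laminar_subset)
  have aQ: "2 powr (- (real m + 1)) < a Q" "a Q \<le> 2 powr (- real m)" if "Q \<in> G" for Q
    using that G unfolding level_def by auto
  have lamP: "measure lam P \<le> 2 powr (- real m) * measure L P powr \<tau>" if "P \<in> G" for P
    using aQ(2)[OF that] L_pos[of P] that GS unfolding a_def by (auto simp: field_simps)
  have meas_X: "measure L X \<le> measure L Q / (real N * \<gamma>)"
    if Q: "Q \<in> G" and X: "X \<in> sets L" "X \<subseteq> \<Union>{P \<in> G. P \<subset> Q}" for X Q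
  proof -
    let ?Y = "\<Union>{P \<in> S. P \<subset> Q \<and> depth S Q + N \<le> depth S P}"
    have "X \<subseteq> ?Y" using X sep[OF _ Q] GS by blast
    moreover have "?Y \<in> sets L" using finS S_sets by (intro sets.finite_Union) auto
    moreover have "emeasure L ?Y \<le> emeasure L Q" using Q GS in_sets by (intro emeasure_mono) auto
    ultimately have "measure L X \<le> measure L ?Y"
      using L_fin[of Q] Q GS X by (intro measure_mono_fmeasurable) (auto simp: fmeasurable_def)
    then show ?thesis using measure_deep_descendants_le[of Q] Q GS by auto
  qed
  have quarter: "2 powr (- real m) * measure L X powr \<tau> \<le> 2 powr (- real m) * measure L Q powr \<tau> / 4"
    if Q: "Q \<in> G" and X: "X \<in> sets L" "X \<subseteq> \<Union>{P \<in> G. P \<subset> Q}" for X Q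
  proof -
    have "measure L X powr \<tau> \<le> (measure L Q * (1 / (real N * \<gamma>))) powr \<tau>"
      using meas_X[OF that] tau by (intro powr_mono2) auto
    also have "\<dots> = measure L Q powr \<tau> * (1 / (real N * \<gamma>)) powr \<tau>"
      using gamma by (subst powr_mult) auto
    also have "\<dots> \<le> measure L Q powr \<tau> * (1 / 4)" using N(2) by (intro mult_left_mono) auto
    finally show ?thesis by simp
  qed
  show ?thesis
  proof (cases "r = 1")
    case True
    have "emeasure c Q \<le> ennreal (?H * measure \<mu> (Q - \<Union>{P \<in> G. P \<subset> Q}))" if Q: "Q \<in> G" for Q
    proof -
      let ?C = "{P \<in> G. P \<subset> Q}"
      have C: "finite ?C" "laminar ?C" "?C \<subseteq> S" using fG GS by (auto intro: laminar_subset)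
      have Cm: "finite (maxels ?C)" "maxels ?C \<subseteq> ?C"
        using finite_maxels[OF C(1)] maxels_subset by auto
      have MS: "P \<in> S" if "P \<in> maxels ?C" for P using that Cm(2) C(3) by blast
      have Mi: "(\<lambda>P. P) ` maxels ?C \<subseteq> sets lam" "(\<lambda>P. P) ` maxels ?C \<subseteq> sets L" using MS in_sets by auto
      have df: "disjoint_family_on (\<lambda>P. P) (maxels ?C)"
        using maxels_disjoint[OF C(2)] unfolding disjoint_family_on_def disjoint_def by auto
      have X: "\<Union>?C \<in> sets L" using C S_sets by (intro sets.finite_Union) auto
      have "measure lam (\<Union>?C) = measure lam (\<Union>P\<in>maxels ?C. P)"
        using Union_maxels[OF C(1)] by simp
      also have "\<dots> \<le> (\<Sum>P\<in>maxels ?C. measure lam P)"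
        using Cm(1) Mi(1) MS fin_emeasure(2) by (intro measure_subadditive_finite) auto
      also have "\<dots> \<le> (\<Sum>P\<in>maxels ?C. 2 powr (- real m) * measure L P)"
      proof (rule sum_mono)
        fix P assume "P \<in> maxels ?C"
        then have "P \<in> G" using Cm by auto
        then show "measure lam P \<le> 2 powr (- real m) * measure L P"
          using lamP[of P] tau(2)[OF True] by simp
      qed
      also have "\<dots> = 2 powr (- real m) * measure L (\<Union>P\<in>maxels ?C. P)"
      proof -
        have "measure L (\<Union>P\<in>maxels ?C. P) = (\<Sum>P\<in>maxels ?C. measure L P)"
          using Cm(1) Mi(2) df MS fin_emeasure(1) by (intro measure_finite_Union) auto
        then show ?thesis by (simp add: sum_distrib_left)
      qed
      also have "\<dots> = 2 powr (- real m) * measure L (\<Union>?C) powr \<tau>"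
        using Union_maxels[OF C(1)] tau(2)[OF True] by simp
      also have "\<dots> \<le> 2 powr (- real m) * measure L Q powr \<tau> / 4" using quarter[OF Q X] by simp
      finally have "emeasure c Q \<le> ennreal (?H * measure \<mu> (Q - \<Union>?C) powr r)"
        using emeasure_le_of_small_part[of Q m "\<Union>?C"] Q GS aQ(1)[OF Q] X by blast
      then show ?thesis using True by simp
    qed
    from nn_integral_overlap_le[OF fG(1,2,4) _ fin_mu H this]
    have "(\<integral>\<^sup>+x. ennreal (real (overlap G x)) \<partial>c) \<le> ennreal (?H * measure \<mu> (space \<mu>))"
      using sets_eq by simp
    then show ?thesis using True by (simp add: tree_const_def)
  next
    case False
    then have r: "r > 1" using r_ge by simp
    have hyp: "emeasure c Q \<le> ennreal (?H * measure \<mu> (Q - P) powr r)"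
      if Q: "Q \<in> G" and P: "P \<in> insert {} G" "P \<subset> Q" for P Q
    proof -
      have Pm: "P \<in> sets L" using P GS in_sets by auto
      have "measure lam P \<le> 2 powr (- real m) * measure L Q powr \<tau> / 4"
      proof (cases "P = {}")
        case False
        then have PG: "P \<in> G" using P by simp
        have "2 powr (- real m) * measure L P powr \<tau> \<le> 2 powr (- real m) * measure L Q powr \<tau> / 4"
          by (rule quarter[OF Q Pm]) (use PG P in blast)
        then show ?thesis using lamP[OF PG] by linarith
      qed simp
      then show ?thesis
        using emeasure_le_of_small_part[of Q m P] Q GS aQ(1)[OF Q] Pm P by blast
    qed
    have "(\<integral>\<^sup>+x. ennreal (real (overlap G x) powr r) \<partial>c)
      \<le> ennreal (tree_const r * ?H * (\<Sum>Q\<in>maxels G. measure \<mu> Q powr r))"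
      using sets_eq by (intro nn_integral_overlap_powr_le[OF fG _ fin_mu r H hyp]) auto
    also have "\<dots> \<le> ennreal (tree_const r * ?H * W)"
      using sum_maxels_powr_le[OF fG(1,2) _ fin_mu r_ge] fG(4) sets_eq tree_const_pos[OF r_ge] H
      by (intro ennreal_leI mult_left_mono) (auto intro: mult_nonneg_nonneg)
    finally show ?thesis .
  qed
qed

definition B :: real where
  "B = real N powr r * tree_const r * 4 powr q * A * W"

lemma B_nonneg: "B \<ge> 0"
  unfolding B_def using A_nonneg tree_const_pos[OF r_ge] by simp

lemma level_props:
  "finite (level a S m)" "laminar (level a S m)" "{} \<notin> level a S m" "level a S m \<subseteq> sets c"
  using level_subset[of a S m] finS neS in_sets lamS by (auto intro: finite_subset laminar_subset)

text \<open>The level is split by depth modulo \<open>N\<close>. Depth is taken in all of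
  \<open>S\<close>, so nested cubes of one class differ in depth by a positive multiple of
  \<open>N\<close>. Jensen over the classes costs \<open>real N powr (r - 1)\<close> and their
  number another \<open>N\<close>, which gives the factor \<open>real N powr r\<close> in
  \<open>B\<close>.\<close>

lemma nn_integral_level_le:
  "(\<integral>\<^sup>+x. ennreal (real (overlap (level a S m) x) powr r) \<partial>c) \<le> ennreal (B * 2 powr (real m * q))"
proof -
  let ?G = "\<lambda>i. {Q \<in> level a S m. depth S Q mod N = i}"
  let ?K = "tree_const r * (4 powr q * 2 powr (real m * q) * A) * W"
  have K: "?K \<ge> 0" using A_nonneg tree_const_pos[OF r_ge] by simp
  have fin: "finite (level a S m)" "finite (?G i)" for i using level_props(1)[of m] by auto
  have meas: "(\<lambda>x. real (overlap (?G i) x)) \<in> borel_measurable c" for i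
    using level_props(4)[of m] by (intro overlap_measurable fin) auto
  have split: "real (overlap (level a S m) x) = (\<Sum>i<N. real (overlap (?G i) x))" for x
  proof -
    have "(\<Sum>i<N. real (overlap (?G i) x)) = (\<Sum>i<N. \<Sum>Q\<in>?G i. indicator Q x)"
      by (simp add: overlap_eq_sum[OF fin(2)])
    also have "\<dots> = (\<Sum>Q\<in>level a S m. indicator Q x)"
      using N(1) fin(1) by (intro sum.group) auto
    finally show ?thesis by (simp add: overlap_eq_sum[OF fin(1)])
  qed
  have pw: "real (overlap (level a S m) x) powr r \<le> real N powr (r - 1) * (\<Sum>i<N. real (overlap (?G i) x) powr r)" for x
  proof -
    have "(\<Sum>i<N. 1 / real N * (real N * real (overlap (?G i) x))) powr r
       \<le> (\<Sum>i<N. 1 / real N * (real N * real (overlap (?G i) x)) powr r)"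
      by (rule powr_sum_le_subconvex) (use N r_ge in auto)
    then show ?thesis
      unfolding split using N by (simp add: powr_mult powr_diff sum_distrib_left)
  qed
  have "(\<integral>\<^sup>+x. ennreal (real (overlap (level a S m) x) powr r) \<partial>c)
    \<le> (\<integral>\<^sup>+x. ennreal (real N powr (r - 1)) * (\<Sum>i<N. ennreal (real (overlap (?G i) x) powr r)) \<partial>c)"
    by (rule nn_integral_mono) (use pw in \<open>simp add: ennreal_mult[symmetric] sum_nonneg ennreal_leI\<close>)
  also have "\<dots> = ennreal (real N powr (r - 1)) * (\<Sum>i<N. \<integral>\<^sup>+x. ennreal (real (overlap (?G i) x) powr r) \<partial>c)"
    using meas by (simp add: nn_integral_cmult nn_integral_sum del: sum_ennreal)
  also have "\<dots> \<le> ennreal (real N powr (r - 1)) * (\<Sum>i<N. ennreal ?K)"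
  proof (intro mult_left_mono sum_mono nn_integral_separated_level_le)
    fix i P Q assume PQ: "P \<in> ?G i" "Q \<in> ?G i" "P \<subset> Q"
    then have "P \<in> S" "Q \<in> S" using level_subset by blast+
    then have "depth S Q < depth S P"
      unfolding depth_def using PQ(3) finS by (intro psubset_card_mono) auto
    moreover have "depth S Q mod N = depth S P mod N" using PQ by simp
    ultimately have "N dvd depth S P - depth S Q"
      by (metis less_imp_le mod_eq_dvd_iff_nat)
    then show "depth S Q + N \<le> depth S P"
      using \<open>depth S Q < depth S P\<close> dvd_imp_le[of N "depth S P - depth S Q"] by linarith
  qed auto
  also have "\<dots> = ennreal (real N powr (r - 1) * (real N * ?K))"
  proof -
    have "ennreal s * (\<Sum>i<N. ennreal t) = ennreal (s * (real N * t))" if "s \<ge> 0" "t \<ge> 0" for s t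
      using that by (simp add: ennreal_of_nat_eq_real_of_nat ennreal_mult[symmetric])
    from this[OF _ K] show ?thesis by simp
  qed
  also have "real N powr (r - 1) * (real N * ?K) = B * 2 powr (real m * q)"
    using N by (simp add: B_def powr_diff mult_ac)
  finally show ?thesis .
qed

text \<open>The \<nu>-th power of the sparse operator on the finite family; the root is taken only
  in the final norm estimate.\<close>

definition g :: "real \<Rightarrow> 'a \<Rightarrow> real" where
  "g \<nu> x = (\<Sum>Q\<in>S. a Q powr \<nu> * indicator Q x)"

lemma g_measurable: "g \<nu> \<in> borel_measurable c"
  unfolding g_def using in_sets
  by (intro borel_measurable_sum borel_measurable_times borel_measurable_indicator) auto

lemma a_nonneg: "a Q \<ge> 0"
  unfolding a_def by simp

lemma emeasure_large_le: "emeasure c (\<Union>{Q \<in> S. a Q > 1}) \<le> ennreal (A * W)"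
proof (rule emeasure_Union_laminar_le)
  fix Q assume Q: "Q \<in> {Q \<in> S. a Q > 1}"
  have "measure c Q * 1 \<le> measure c Q * a Q powr q"
    using Q q_pos by (intro mult_left_mono ge_one_powr_ge_zero) auto
  also have "\<dots> \<le> A * measure \<mu> Q powr r"
    unfolding a_def using Q in_sets by (intro testing) auto
  finally show "emeasure c Q \<le> ennreal (A * measure \<mu> Q powr r)"
    using c_fin[of Q] Q by (subst emeasure_eq_ennreal_measure) (auto intro: ennreal_leI)
qed (use finS lamS in_sets sets_eq fin_mu r_ge A_nonneg in \<open>auto intro: laminar_subset\<close>)

abbreviation lsum :: "real \<Rightarrow> nat set \<Rightarrow> 'a \<Rightarrow> real" where
  "lsum \<nu> I x \<equiv> (\<Sum>m\<in>I. 2 powr (- (real m * \<nu>)) * real (overlap (level a S m) x))"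

lemma lsum_measurable [measurable]: "lsum \<nu> I \<in> borel_measurable c"
  using overlap_measurable[OF level_props(1,4)] by (intro borel_measurable_sum borel_measurable_times) auto

text \<open>Off the cubes with \<open>a Q > 1\<close>, a value of at least \<open>T + 1\<close>
  forces the levels before \<open>m0\<close> to contribute \<open>T\<close> or the levels from
  \<open>m0\<close> on to contribute 1.\<close>

lemma emeasure_g_ge_le:
  assumes \<nu>: "\<nu> \<ge> 0"
    and tail: "\<And>M. emeasure c {x \<in> space c. lsum \<nu> {m0..<M} x \<ge> 1} \<le> ennreal X"
    and head: "emeasure c {x \<in> space c. lsum \<nu> {..<m0} x \<ge> T} \<le> ennreal Y" and XY: "X \<ge> 0" "Y \<ge> 0"
  shows "emeasure c {x \<in> space c. g \<nu> x \<ge> T + 1} \<le> ennreal (A * W + X + Y)"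
proof -
  let ?U = "\<Union>{Q \<in> S. a Q > 1}"
  obtain M where M: "\<forall>M'\<ge>M. \<forall>x. x \<notin> ?U \<longrightarrow> g \<nu> x \<le> lsum \<nu> {..<M'} x"
    using sum_le_sum_levels[OF finS \<nu>, of a, OF a_nonneg] unfolding g_def by (rule exE)
  \<comment> \<open>The cut must clear the occupied levels as well as \<open>m0\<close>, so that the
    range splits at \<open>m0\<close>.\<close>
  define M' where "M' = max M m0"
  let ?T1 = "{x \<in> space c. lsum \<nu> {m0..<M'} x \<ge> 1}" and ?T2 = "{x \<in> space c. lsum \<nu> {..<m0} x \<ge> T}"
  have sub: "{x \<in> space c. g \<nu> x \<ge> T + 1} \<subseteq> (?U \<union> ?T1) \<union> ?T2"
  proof
    fix x assume x: "x \<in> {x \<in> space c. g \<nu> x \<ge> T + 1}"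
    have "lsum \<nu> {..<M'} x = lsum \<nu> {..<m0} x + lsum \<nu> {m0..<M'} x"
    proof -
      have "{..<M'} = {..<m0} \<union> {m0..<M'}" unfolding M'_def by auto
      then show ?thesis by (simp add: sum.union_disjoint disjoint_iff)
    qed
    moreover have "g \<nu> x \<le> lsum \<nu> {..<M'} x" if "x \<notin> ?U" using M that unfolding M'_def by simp
    ultimately show "x \<in> (?U \<union> ?T1) \<union> ?T2" using x by force
  qed
  have U: "?U \<in> sets c" using finS in_sets by (intro sets.finite_Union) auto
  have T: "?T1 \<in> sets c" "?T2 \<in> sets c"
    by (intro borel_measurable_le lsum_measurable borel_measurable_const)+
  have "emeasure c {x \<in> space c. g \<nu> x \<ge> T + 1} \<le> emeasure c ((?U \<union> ?T1) \<union> ?T2)"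
    by (rule emeasure_mono[OF sub]) (intro sets.Un U T)
  also have "\<dots> \<le> emeasure c (?U \<union> ?T1) + emeasure c ?T2"
    by (rule emeasure_subadditive) (intro sets.Un U T)+
  also have "\<dots> \<le> (emeasure c ?U + emeasure c ?T1) + emeasure c ?T2"
    by (rule add_right_mono, rule emeasure_subadditive) (intro U T)+
  also have "\<dots> \<le> (ennreal (A * W) + ennreal X) + ennreal Y"
    by (intro add_mono emeasure_large_le tail head)
  also have "\<dots> = ennreal (A * W + X + Y)" using XY A_nonneg by simp
  finally show ?thesis .
qed

text \<open>The exponent \<open>p\<close> of the theorem is \<open>q / r\<close>, so the three cases compare \<open>p\<close> with \<open>\<nu>\<close>.\<close>

lemma emeasure_g_subcritical_le:
  assumes \<nu>: "\<nu> \<ge> 0" "q < \<nu> * r"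
  shows "emeasure c {x \<in> space c. g \<nu> x \<ge> 2} \<le> ennreal (A * W + geom_const ((\<nu> * r - q) / r) r * B)"
proof -
  \<comment> \<open>With the critical level at 0 the head is an empty sum that never reaches its
    threshold 1, so it contributes 0.\<close>
  have "emeasure c {x \<in> space c. g \<nu> x \<ge> 1 + 1} \<le> ennreal (A * W + geom_const ((\<nu> * r - q) / r) r * B + 0)"
  proof (rule emeasure_g_ge_le[where ?m0.0 = 0])
    show "emeasure c {x \<in> space c. lsum \<nu> {0..<M} x \<ge> 1} \<le> ennreal (geom_const ((\<nu> * r - q) / r) r * B)" for M
      using emeasure_geometric_tail_le[OF r_ge B_nonneg \<nu>(2) _ _ nn_integral_level_le, of 0 M]
        overlap_measurable[OF level_props(1,4)] by simp
  qed (use \<nu> B_nonneg in \<open>auto simp: geom_const_def\<close>)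
  then show ?thesis by simp
qed

text \<open>Passing from the moment r to r + n makes the series over the levels converge, at the
  price of the n-th power of \<Lambda> = 2^(m0 \<nu>). Starting the series at \<open>m0\<close> wins
  exactly this power back, so the final factor is the one that exponent r alone would
  suggest.\<close>

lemma tail_carleson_le:
  assumes carl: "\<And>P. P \<in> S \<Longrightarrow> (\<Sum>Q\<in>{Q\<in>S. Q \<subseteq> P}. emeasure c Q) \<le> ennreal (2 powr (real m0 * \<nu>)) * emeasure c P"
    and n: "q < \<nu> * (r + real n)"
  shows "emeasure c {x \<in> space c. lsum \<nu> {m0..<M} x \<ge> 1}
    \<le> ennreal (geom_const ((\<nu> * (r + real n) - q) / (r + real n)) (r + real n) * moment_const r n * B
        * 2 powr (real m0 * (q - \<nu> * r)))"
proof -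
  let ?\<Lambda> = "2 powr (real m0 * \<nu>) :: real"
  have "(\<integral>\<^sup>+x. ennreal (real (overlap (level a S m) x) powr (r + real n)) \<partial>c)
    \<le> ennreal (moment_const r n * ?\<Lambda> ^ n * B * 2 powr (real m * q))" for m
  proof -
    have "(\<integral>\<^sup>+x. ennreal (real (overlap (level a S m) x) powr (r + real n)) \<partial>c)
      \<le> ennreal (moment_const r n * ?\<Lambda> ^ n) * (\<integral>\<^sup>+x. ennreal (real (overlap (level a S m) x) powr r) \<partial>c)"
    proof (rule nn_integral_overlap_powr_add_le[OF level_props r_ge])
      fix P assume P: "P \<in> level a S m"
      have "(\<Sum>Q\<in>{Q\<in>level a S m. Q \<subseteq> P}. emeasure c Q) \<le> (\<Sum>Q\<in>{Q\<in>S. Q \<subseteq> P}. emeasure c Q)"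
      proof (rule sum_mono2)
        show "{Q \<in> level a S m. Q \<subseteq> P} \<subseteq> {Q \<in> S. Q \<subseteq> P}" using level_subset[of a S m] by blast
      qed (use finS in auto)
      also have "\<dots> \<le> ennreal ?\<Lambda> * emeasure c P" using P level_subset[of a S m] by (intro carl) blast
      finally show "(\<Sum>Q\<in>{Q\<in>level a S m. Q \<subseteq> P}. emeasure c Q) \<le> ennreal ?\<Lambda> * emeasure c P" .
    qed auto
    also have "\<dots> \<le> ennreal (moment_const r n * ?\<Lambda> ^ n) * ennreal (B * 2 powr (real m * q))"
      by (intro mult_left_mono nn_integral_level_le) auto
    also have "\<dots> = ennreal (moment_const r n * ?\<Lambda> ^ n * B * 2 powr (real m * q))"
      using B_nonneg moment_const_pos[OF r_ge, of n] by (simp add: ennreal_mult[symmetric] mult.assoc)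
    finally show ?thesis .
  qed
  then have "emeasure c {x \<in> space c. lsum \<nu> {m0..<M} x \<ge> 1}
    \<le> ennreal (geom_const ((\<nu> * (r + real n) - q) / (r + real n)) (r + real n) * (moment_const r n * ?\<Lambda> ^ n * B)
        * 2 powr (real m0 * (q - \<nu> * (r + real n))))"
    using B_nonneg moment_const_pos[OF r_ge, of n] r_ge overlap_measurable[OF level_props(1,4)]
    by (intro emeasure_geometric_tail_le[OF _ _ n]) auto
  also have "geom_const ((\<nu> * (r + real n) - q) / (r + real n)) (r + real n) * (moment_const r n * ?\<Lambda> ^ n * B)
        * 2 powr (real m0 * (q - \<nu> * (r + real n)))
    = geom_const ((\<nu> * (r + real n) - q) / (r + real n)) (r + real n) * moment_const r n * B
        * (?\<Lambda> ^ n * 2 powr (real m0 * (q - \<nu> * (r + real n))))" by (simp add: mult_ac)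
  also have "?\<Lambda> ^ n * 2 powr (real m0 * (q - \<nu> * (r + real n))) = 2 powr (real m0 * (q - \<nu> * r))"
    by (simp add: powr_realpow[symmetric] powr_powr powr_add[symmetric] algebra_simps)
  finally show ?thesis .
qed

text \<open>For \<open>\<nu> * r = q\<close> the tail factor
  \<open>2 powr (real m0 * (q - \<nu> * r))\<close> is 1, so \<open>m0\<close> survives only in the
  threshold.\<close>

lemma emeasure_g_critical_le:
  assumes carl: "\<And>P. P \<in> S \<Longrightarrow> (\<Sum>Q\<in>{Q\<in>S. Q \<subseteq> P}. emeasure c Q) \<le> ennreal (2 powr (real m0 * \<nu>)) * emeasure c P"
    and n: "q < \<nu> * (r + real n)" and crit: "\<nu> * r = q" and m0: "m0 > 0"
  shows "emeasure c {x \<in> space c. g \<nu> x \<ge> real m0 + 1}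
    \<le> ennreal (A * W + geom_const ((\<nu> * (r + real n) - q) / (r + real n)) (r + real n) * moment_const r n * B + B)"
proof (rule emeasure_g_ge_le[where ?m0.0 = m0])
  show "\<nu> \<ge> 0" using crit q_pos r_ge by (smt (verit) mult_neg_pos)
  show "emeasure c {x \<in> space c. lsum \<nu> {m0..<M} x \<ge> 1}
    \<le> ennreal (geom_const ((\<nu> * (r + real n) - q) / (r + real n)) (r + real n) * moment_const r n * B)" for M
    using tail_carleson_le[OF carl n, of M] crit by simp
  show "emeasure c {x \<in> space c. lsum \<nu> {..<m0} x \<ge> real m0} \<le> ennreal B"
    using emeasure_uniform_head_le[OF r_ge B_nonneg crit m0 _ _ nn_integral_level_le]
      overlap_measurable[OF level_props(1,4)] by simp
qed (use B_nonneg moment_const_pos[OF r_ge, of n] in \<open>auto simp: geom_const_def\<close>)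

text \<open>The bounds for the levels increase up to \<open>m0\<close> and decrease from there, so
  head and tail pay the same power of 2 and the threshold stays constant.\<close>

lemma emeasure_g_supercritical_le:
  assumes carl: "\<And>P. P \<in> S \<Longrightarrow> (\<Sum>Q\<in>{Q\<in>S. Q \<subseteq> P}. emeasure c Q) \<le> ennreal (2 powr (real m0 * \<nu>)) * emeasure c P"
    and n: "q < \<nu> * (r + real n)" and sup: "\<nu> * r < q" and \<nu>: "\<nu> \<ge> 0"
  shows "emeasure c {x \<in> space c. g \<nu> x \<ge> 2}
    \<le> ennreal (A * W + geom_const ((\<nu> * (r + real n) - q) / (r + real n)) (r + real n) * moment_const r n * B
        * 2 powr (real m0 * (q - \<nu> * r)) + geom_const ((q - \<nu> * r) / r) r * B * 2 powr (real m0 * (q - \<nu> * r)))"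
proof -
  have "emeasure c {x \<in> space c. g \<nu> x \<ge> 1 + 1}
    \<le> ennreal (A * W + geom_const ((\<nu> * (r + real n) - q) / (r + real n)) (r + real n) * moment_const r n * B
        * 2 powr (real m0 * (q - \<nu> * r)) + geom_const ((q - \<nu> * r) / r) r * B * 2 powr (real m0 * (q - \<nu> * r)))"
  proof (rule emeasure_g_ge_le[OF \<nu> tail_carleson_le[OF carl n]])
    show "emeasure c {x \<in> space c. lsum \<nu> {..<m0} x \<ge> 1}
      \<le> ennreal (geom_const ((q - \<nu> * r) / r) r * B * 2 powr (real m0 * (q - \<nu> * r)))"
      using emeasure_geometric_head_le[OF r_ge B_nonneg sup _ _ nn_integral_level_le]
        overlap_measurable[OF level_props(1,4)] by simp
  qed (use B_nonneg moment_const_pos[OF r_ge, of n] in \<open>auto simp: geom_const_def\<close>)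
  then show ?thesis by simp
qed

end

section \<open>Weights on dyadic cubes\<close>

lemma epowr_ennreal: "x \<ge> 0 \<Longrightarrow> epowr (ennreal x) r = ennreal (x powr r)"
  by (simp add: epowr_def)

lemma epowr_top [simp]: "epowr top r = top"
  by (simp add: epowr_def)

lemma epowr_eq_top_iff: "epowr x r = top \<longleftrightarrow> x = top"
  by (simp add: epowr_def)

lemma epowr_pos:
  assumes "x > 0" shows "epowr x r > 0"
  using assms by (cases x) (auto simp: epowr_def)

lemma epowr_mono:
  assumes "x \<le> y" "r \<ge> 0" shows "epowr x r \<le> epowr y r"
  using assms by (cases x; cases y) (auto simp: epowr_def powr_mono2 top_unique)

text \<open>Stating it with real bounds \<open>F\<close> and \<open>G\<close> for the two integrals
  gives a real bound that later estimates can divide by. If one of the bounds is 0, normalisation is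
  impossible, but then the product vanishes almost everywhere.\<close>

lemma nn_integral_Holder:
  fixes f g :: "'a \<Rightarrow> real"
  assumes p: "p > 1" "p' > 1" "1 / p + 1 / p' = 1"
    and [measurable]: "f \<in> borel_measurable M" "g \<in> borel_measurable M"
    and nn: "\<And>x. f x \<ge> 0" "\<And>x. g x \<ge> 0"
    and F: "(\<integral>\<^sup>+x. ennreal (f x powr p) \<partial>M) \<le> ennreal F" "F \<ge> 0"
    and G: "(\<integral>\<^sup>+x. ennreal (g x powr p') \<partial>M) \<le> ennreal G" "G \<ge> 0"
  shows "(\<integral>\<^sup>+x. ennreal (f x * g x) \<partial>M) \<le> ennreal (F powr (1 / p) * G powr (1 / p'))"
proof (cases "F > 0 \<and> G > 0")
  case True
  define c where "c = F powr (1 / p) * G powr (1 / p')"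
  have c: "c > 0" using True by (simp add: c_def)
  have young: "f x * g x \<le> c / (p * F) * f x powr p + c / (p' * G) * g x powr p'" for x
  proof -
    have "f x / F powr (1 / p) * (g x / G powr (1 / p'))
      \<le> (f x / F powr (1 / p)) powr p / p + (g x / G powr (1 / p')) powr p' / p'"
      by (rule Youngs_inequality) (use p nn True in auto)
    also have "\<dots> = f x powr p / (p * F) + g x powr p' / (p' * G)"
      using p nn True by (simp add: powr_divide powr_powr mult.commute)
    finally have "c * (f x / F powr (1 / p) * (g x / G powr (1 / p')))
      \<le> c * (f x powr p / (p * F) + g x powr p' / (p' * G))"
      using c by (intro mult_left_mono) auto
    moreover have "c * (f x / F powr (1 / p) * (g x / G powr (1 / p'))) = f x * g x"
      using True by (simp add: c_def)
    ultimately show ?thesis by (simp add: distrib_left)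
  qed
  have pos: "c / (p * F) \<ge> 0" "c / (p' * G) \<ge> 0" using c p True by auto
  have lin: "ennreal (\<alpha> * y + \<beta> * z) = ennreal \<alpha> * ennreal y + ennreal \<beta> * ennreal z"
    if "\<alpha> \<ge> 0" "\<beta> \<ge> 0" "y \<ge> 0" "z \<ge> 0" for \<alpha> \<beta> y z :: real
    using that by (simp add: ennreal_mult)
  have "(\<integral>\<^sup>+x. ennreal (f x * g x) \<partial>M)
    \<le> (\<integral>\<^sup>+x. ennreal (c / (p * F)) * ennreal (f x powr p) + ennreal (c / (p' * G)) * ennreal (g x powr p') \<partial>M)"
  proof (rule nn_integral_mono)
    fix x
    from lin[OF pos] show "ennreal (f x * g x)
      \<le> ennreal (c / (p * F)) * ennreal (f x powr p) + ennreal (c / (p' * G)) * ennreal (g x powr p')"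
      using ennreal_leI[OF young[of x]] by simp
  qed
  also have "\<dots> = ennreal (c / (p * F)) * (\<integral>\<^sup>+x. ennreal (f x powr p) \<partial>M)
      + ennreal (c / (p' * G)) * (\<integral>\<^sup>+x. ennreal (g x powr p') \<partial>M)"
    by (simp add: nn_integral_add nn_integral_cmult)
  also have "\<dots> \<le> ennreal (c / (p * F)) * ennreal F + ennreal (c / (p' * G)) * ennreal G"
    by (intro add_mono mult_left_mono F G) auto
  also have "\<dots> = ennreal (c / (p * F) * F + c / (p' * G) * G)"
    using lin[OF pos, of F G] True by simp
  also have "c / (p * F) * F + c / (p' * G) * G = c * (1 / p + 1 / p')"
    using True by (simp add: field_simps)
  finally show ?thesis using p by (simp add: c_def)
next
  case False
  then have "F = 0 \<or> G = 0" using F G by auto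
  then have "AE x in M. f x * g x = 0"
  proof
    assume "F = 0"
    then have "(\<integral>\<^sup>+x. ennreal (f x powr p) \<partial>M) = 0" using F by simp
    then have "AE x in M. ennreal (f x powr p) = 0" by (subst (asm) nn_integral_0_iff_AE) auto
    then show ?thesis by eventually_elim simp
  next
    assume "G = 0"
    then have "(\<integral>\<^sup>+x. ennreal (g x powr p') \<partial>M) = 0" using G by simp
    then have "AE x in M. ennreal (g x powr p') = 0" by (subst (asm) nn_integral_0_iff_AE) auto
    then show ?thesis by eventually_elim simp
  qed
  then have "(\<integral>\<^sup>+x. ennreal (f x * g x) \<partial>M) = (\<integral>\<^sup>+x. 0 \<partial>M)"
    by (intro nn_integral_cong_AE) auto
  then show ?thesis by simp
qed

section \<open>Cubes and dyadic grids\<close>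

lemma cube_between_boxes:
  fixes a :: "real ^ 'd::finite"
  shows "box a (a + (\<chi> i. l)) \<subseteq> cube a l" "cube a l \<subseteq> cbox a (a + (\<chi> i. l))"
  unfolding cube_def by (auto simp: mem_box_cart less_imp_le)

lemma cube_borel: "cube (a :: real ^ 'd::finite) l \<in> sets borel"
proof -
  have "cube a l = (\<Inter>i. {x. a $ i \<le> x $ i} \<inter> {x. x $ i < a $ i + l})"
    unfolding cube_def by auto
  moreover have "{x. a $ i \<le> x $ i} \<in> sets borel" "{x. x $ i < a $ i + l} \<in> sets borel" for i
    by (intro borel_closed borel_open closed_Collect_le open_Collect_less continuous_intros)+
  ultimately show ?thesis by auto
qed

lemma cube_lebesgue:
  fixes a :: "real ^ 'd::finite"
  assumes "l > 0"
  shows "cube a l \<in> sets lebesgue" "0 < emeasure lebesgue (cube a l)" "emeasure lebesgue (cube a l) < top"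
    "interior (cube a l) \<noteq> {}"
proof -
  let ?b = "a + (\<chi> i. l)"
  have inn: "(\<chi> i. l) \<bullet> b = l" if "b \<in> Basis" for b :: "real ^ 'd"
    using that by (auto simp: Basis_vec_def inner_axis)
  have "a + (\<chi> i. l / 2) \<in> box a ?b" using assms by (simp add: mem_box_cart)
  then have ne: "box a ?b \<noteq> {}" by blast
  show m: "cube a l \<in> sets lebesgue" using cube_borel[of a l] by auto
  show "interior (cube a l) \<noteq> {}"
    using interior_maximal[OF cube_between_boxes(1)[of a l] open_box] ne by blast
  have "0 < emeasure lborel (box a ?b)"
    using assms by (simp add: emeasure_lborel_box_eq inn inner_add_left)
  also have "\<dots> \<le> emeasure lebesgue (cube a l)"
    using emeasure_mono[OF cube_between_boxes(1)[of a l] m] by simp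
  finally show "0 < emeasure lebesgue (cube a l)" .
  have "emeasure lebesgue (cube a l) \<le> emeasure lebesgue (cbox a ?b)"
    by (rule emeasure_mono[OF cube_between_boxes(2)]) auto
  also have "\<dots> < top" using emeasure_lborel_cbox_finite[of a ?b] by (simp add: less_top)
  finally show "emeasure lebesgue (cube a l) < top" .
qed

lemma dyadic_gridE:
  fixes D :: "(real ^ 'd::finite) set set"
  assumes "dyadic_grid D"
  obtains G :: "int \<Rightarrow> (real ^ 'd) set set" where "D = (\<Union>k. G k)"
    "\<And>k. partition_on UNIV (G k)" "\<And>k Q. Q \<in> G k \<Longrightarrow> \<exists>a. Q = cube a (2 powi (- k))"
    "\<And>k Q. Q \<in> G (k + 1) \<Longrightarrow> \<exists>P\<in>G k. Q \<subseteq> P"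
proof -
  obtain G :: "int \<Rightarrow> (real ^ 'd) set set" where
    "D = (\<Union>k. G k) \<and> (\<forall>k. partition_on UNIV (G k)) \<and>
     (\<forall>k. \<forall>Q\<in>G k. \<exists>a. Q = cube a (2 powi (- k))) \<and>
     (\<forall>k. \<forall>Q\<in>G (k + 1). \<exists>P\<in>G k. Q \<subseteq> P)"
    using assms unfolding dyadic_grid_def by (rule exE)
  then show thesis by (intro that[of G]) simp_all
qed

lemma dyadic_grid_cube:
  fixes D :: "(real ^ 'd::finite) set set"
  assumes "dyadic_grid D" "Q \<in> D"
  shows "Q \<in> sets lebesgue" "0 < emeasure lebesgue Q" "emeasure lebesgue Q < top" "Q \<noteq> {}"
proof -
  obtain G :: "int \<Rightarrow> (real ^ 'd) set set" where "D = (\<Union>k. G k)"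
    "\<And>k Q. Q \<in> G k \<Longrightarrow> \<exists>a. Q = cube a (2 powi (- k))"
    using dyadic_gridE[OF assms(1)] by metis
  moreover from this obtain k where "Q \<in> G k" using assms(2) by auto
  ultimately obtain a where "Q = cube a (2 powi (- k))" by blast
  then show "Q \<in> sets lebesgue" "0 < emeasure lebesgue Q" "emeasure lebesgue Q < top"
    using cube_lebesgue[of "2 powi (- k)" a] by simp_all
  then show "Q \<noteq> {}" by auto
qed

text \<open>The finer of two cubes is replaced by its ancestor in the generation of the coarser one,
  where cubes coincide or are disjoint.\<close>

lemma dyadic_grid_laminar:
  fixes D :: "(real ^ 'd::finite) set set"
  assumes "dyadic_grid D"
  shows "laminar D"
proof -
  obtain G :: "int \<Rightarrow> (real ^ 'd) set set" where D: "D = (\<Union>k. G k)"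
    and part: "\<And>k. partition_on UNIV (G k)" and ref: "\<And>k Q. Q \<in> G (k + 1) \<Longrightarrow> \<exists>P\<in>G k. Q \<subseteq> P"
    using dyadic_gridE[OF assms] by metis
  have anc: "\<exists>P\<in>G k. Q \<subseteq> P" if "Q \<in> G (k + int n)" for k n Q
    using that
  proof (induction n arbitrary: Q)
    case (Suc n)
    then have "Q \<in> G (k + int n + 1)" by (simp add: algebra_simps)
    from ref[OF this] obtain P where P: "P \<in> G (k + int n)" "Q \<subseteq> P" by (rule bexE)
    from Suc.IH[OF P(1)] obtain R where "R \<in> G k" "P \<subseteq> R" by (rule bexE)
    then show ?case using P(2) by (intro bexI[of _ R]) auto
  next
    case 0
    then show ?case by (intro bexI[of _ Q]) auto
  qed
  have *: "Q \<subseteq> P \<or> P \<inter> Q = {}" if "P \<in> G k" "Q \<in> G j" "k \<le> j" for P Q k j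
  proof -
    have "Q \<in> G (k + int (nat (j - k)))" using that by simp
    from anc[OF this] obtain R where R: "R \<in> G k" "Q \<subseteq> R" by (rule bexE)
    have "P = R \<or> P \<inter> R = {}"
      using part[of k] that(1) R(1) unfolding partition_on_def disjoint_def by metis
    then show ?thesis using R(2) by auto
  qed
  show ?thesis
    unfolding laminar_def
  proof (intro ballI)
    fix P Q assume "P \<in> D" "Q \<in> D"
    then obtain k j where "P \<in> G k" "Q \<in> G j" unfolding D by auto
    then show "P \<subseteq> Q \<or> Q \<subseteq> P \<or> P \<inter> Q = {}"
      using *[of P k Q j] *[of Q j P k] by (cases "k \<le> j") auto
  qed
qed

text \<open>Each generation consists of disjoint sets with nonempty interior. Countability later
  permits the exhaustion of a sparse family by an increasing sequence of finite ones.\<close>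

lemma dyadic_grid_countable:
  fixes D :: "(real ^ 'd::finite) set set"
  assumes "dyadic_grid D"
  shows "countable D"
proof -
  obtain G :: "int \<Rightarrow> (real ^ 'd) set set" where D: "D = (\<Union>k. G k)"
    and part: "\<And>k. partition_on UNIV (G k)" and cub: "\<And>k Q. Q \<in> G k \<Longrightarrow> \<exists>a. Q = cube a (2 powi (- k))"
    using dyadic_gridE[OF assms] by metis
  have "countable (G k)" for k
  proof (rule countable_disjoint_nonempty_interior_subsets)
    show "pairwise disjnt (G k)" using part[of k] unfolding partition_on_def disjoint_def pairwise_def disjnt_def by auto
    fix Q assume "Q \<in> G k" "interior Q = {}"
    then show "Q = {}" using cub[of Q k] cube_lebesgue(4)[of "2 powi (- k)"] by auto
  qed
  then show ?thesis unfolding D by auto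
qed

lemma set_nn_integral_pos:
  assumes "Q \<in> sets M" "emeasure M Q > 0" "h \<in> borel_measurable M" "\<And>x. h x > (0::ennreal)"
  shows "(\<integral>\<^sup>+x\<in>Q. h x \<partial>M) > 0"
proof (rule ccontr)
  assume "\<not> ?thesis"
  then have "(\<integral>\<^sup>+x\<in>Q. h x \<partial>M) = 0" by simp
  then have "AE x in M. h x * indicator Q x = 0"
    using assms by (subst (asm) nn_integral_0_iff_AE) auto
  then have "AE x in M. x \<notin> Q"
  proof eventually_elim
    fix x assume "h x * indicator Q x = 0"
    then show "x \<notin> Q" using assms(4)[of x] by (auto simp: indicator_def split: if_splits)
  qed
  moreover have "{x \<in> space M. x \<in> Q} = Q" using sets.sets_into_space[OF assms(1)] by blast
  ultimately have "emeasure M Q = 0" using assms(1) by (simp add: AE_iff_measurable[OF _ refl])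
  then show False using assms(2) by simp
qed

section \<open>A weight on a single cube\<close>

definition dual_factor :: "real \<Rightarrow> real \<Rightarrow> (real ^ 'd \<Rightarrow> real) \<Rightarrow> (real ^ 'd) set \<Rightarrow> ennreal" where
  "dual_factor p q w Q =
    (if p = 1 then epowr (esssup (lebesgue_on Q) (\<lambda>x. ennreal (inverse (w x)))) q
     else epowr (average (\<lambda>x. ennreal (w x powr (- (p / (p - 1))))) Q) (q / (p / (p - 1))))"

lemma Apq_const_ge:
  "Q \<in> D \<Longrightarrow> average (\<lambda>x. ennreal (w x powr q)) Q * dual_factor p q w Q \<le> Apq_const D p q w"
  unfolding Apq_const_def dual_factor_def Let_def by (rule SUP_upper2) auto

lemma average_eq_ennreal:
  assumes "emeasure lebesgue Q = ennreal l" "l > 0" "(\<integral>\<^sup>+x\<in>Q. u x \<partial>lebesgue) = ennreal U" "U \<ge> 0"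
  shows "average u Q = ennreal (U / l)"
  unfolding average_def using assms by (simp add: divide_ennreal)

lemma average_less_top:
  assumes "emeasure lebesgue Q = ennreal l" "l > 0" "average u Q < top"
  shows "(\<integral>\<^sup>+x\<in>Q. u x \<partial>lebesgue) < top"
proof (rule ccontr)
  assume "\<not> ?thesis"
  then have "(\<integral>\<^sup>+x\<in>Q. u x \<partial>lebesgue) = top" by (simp add: less_top[symmetric])
  then show False using assms unfolding average_def by (simp add: ennreal_top_divide)
qed

locale weight_on_cube =
  fixes w :: "real ^ 'd::finite \<Rightarrow> real" and Q :: "(real ^ 'd) set" and p q A l :: real
  assumes w_meas [measurable]: "w \<in> borel_measurable lebesgue" and w_pos: "\<And>x. w x > 0"
    and Q_meas [measurable]: "Q \<in> sets lebesgue" and Q_l: "emeasure lebesgue Q = ennreal l" "l > 0"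
    and p: "p \<ge> 1" and q: "q > 0"
    and A: "average (\<lambda>x. ennreal (w x powr q)) Q * dual_factor p q w Q \<le> ennreal A" "A \<ge> 0"
begin

abbreviation "u \<equiv> density lebesgue (\<lambda>x. ennreal (w x powr q))"

definition "U = measure u Q"

lemma emeasure_u: "emeasure u E = (\<integral>\<^sup>+x\<in>E. ennreal (w x powr q) \<partial>lebesgue)" if "E \<in> sets lebesgue"
  using that by (simp add: emeasure_density)

lemma average_u_pos: "average (\<lambda>x. ennreal (w x powr q)) Q > 0"
proof -
  have "(\<integral>\<^sup>+x\<in>Q. ennreal (w x powr q) \<partial>lebesgue) > 0"
    using w_pos Q_l by (intro set_nn_integral_pos) (auto simp: less_imp_neq[symmetric])
  then show ?thesis unfolding average_def using Q_l
    by (simp add: ennreal_zero_less_divide)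
qed

lemma dual_factor_pos: "dual_factor p q w Q > 0"
proof (cases "p = 1")
  case True
  let ?s = "esssup (lebesgue_on Q) (\<lambda>x. ennreal (inverse (w x)))"
  have "?s \<noteq> 0"
  proof
    assume s: "?s = 0"
    have "AE x in lebesgue_on Q. ennreal (inverse (w x)) \<le> ?s" by (rule esssup_AE)
    then have "AE x in lebesgue_on Q. False"
    proof eventually_elim
      case (elim x)
      then show ?case using w_pos[of x] unfolding s by (simp add: ennreal_eq_0_iff)
    qed
    then have "emeasure (lebesgue_on Q) (space (lebesgue_on Q)) = 0"
      by (simp add: AE_iff_measurable[OF _ refl])
    then show False using Q_l by (simp add: emeasure_restrict_space)
  qed
  then show ?thesis
    unfolding dual_factor_def using True epowr_pos[of ?s q] by (simp add: zero_less_iff_neq_zero)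
next
  case False
  have "(\<integral>\<^sup>+x\<in>Q. ennreal (w x powr (- (p / (p - 1)))) \<partial>lebesgue) > 0"
    using w_pos Q_l by (intro set_nn_integral_pos) (auto simp: less_imp_neq[symmetric])
  then have "average (\<lambda>x. ennreal (w x powr (- (p / (p - 1))))) Q > 0"
    unfolding average_def using Q_l by (simp add: ennreal_zero_less_divide)
  then show ?thesis unfolding dual_factor_def using False by (auto intro: epowr_pos)
qed

text \<open>As \<open>0 * top = 0\<close> in \<open>ennreal\<close>, a finite product has finite
  factors only if neither factor vanishes; this is what the two positivity lemmas above are
  for.\<close>

lemma factors_less_top:
  "average (\<lambda>x. ennreal (w x powr q)) Q < top" "dual_factor p q w Q < top"
proof -
  have "average (\<lambda>x. ennreal (w x powr q)) Q * dual_factor p q w Q < top"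
    using A(1) by (rule order_le_less_trans) simp
  then show "average (\<lambda>x. ennreal (w x powr q)) Q < top" "dual_factor p q w Q < top"
    using average_u_pos dual_factor_pos by (auto simp: ennreal_mult_less_top)
qed

lemma u_fin: "emeasure u Q < top"
  unfolding emeasure_u[OF Q_meas] by (rule average_less_top[OF Q_l factors_less_top(1)])

lemma emeasure_u_eq: "emeasure u Q = ennreal U"
  unfolding U_def using u_fin by (intro emeasure_eq_ennreal_measure) auto

lemma U_pos: "U > 0"
proof -
  have "(\<integral>\<^sup>+x\<in>Q. ennreal (w x powr q) \<partial>lebesgue) > 0"
    using w_pos Q_l by (intro set_nn_integral_pos) (auto simp: less_imp_neq[symmetric])
  then show ?thesis using emeasure_u_eq emeasure_u[OF Q_meas] by simp
qed

lemma average_u: "average (\<lambda>x. ennreal (w x powr q)) Q = ennreal (U / l)"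
  using emeasure_u_eq emeasure_u[OF Q_meas] U_pos by (intro average_eq_ennreal Q_l) auto

lemma dual_integral:
  assumes p1: "p > 1"
  defines "p' \<equiv> p / (p - 1)"
  obtains \<Sigma> where "\<Sigma> > 0" "(\<integral>\<^sup>+x\<in>Q. ennreal (w x powr (- p')) \<partial>lebesgue) = ennreal \<Sigma>"
    "U * \<Sigma> powr (q / p') \<le> A * l powr (1 + q / p')"
proof -
  let ?s = "\<lambda>x. ennreal (w x powr (- p'))"
  have df: "dual_factor p q w Q = epowr (average ?s Q) (q / p')"
    using p1 by (simp add: dual_factor_def p'_def)
  then have "average ?s Q < top"
    using factors_less_top(2) by (metis epowr_top less_top)
  then have "(\<integral>\<^sup>+x\<in>Q. ?s x \<partial>lebesgue) < top" by (rule average_less_top[OF Q_l])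
  then obtain \<Sigma> where S: "(\<integral>\<^sup>+x\<in>Q. ?s x \<partial>lebesgue) = ennreal \<Sigma>" "\<Sigma> \<ge> 0"
    by (cases "\<integral>\<^sup>+x\<in>Q. ?s x \<partial>lebesgue") auto
  have "(\<integral>\<^sup>+x\<in>Q. ?s x \<partial>lebesgue) > 0"
    using w_pos Q_l by (intro set_nn_integral_pos) (auto simp: less_imp_neq[symmetric])
  then have S0: "\<Sigma> > 0" using S by simp
  have "ennreal (U / l) * epowr (ennreal (\<Sigma> / l)) (q / p') \<le> ennreal A"
    using A(1) unfolding average_u df average_eq_ennreal[OF Q_l S] .
  then have "ennreal (U / l * (\<Sigma> / l) powr (q / p')) \<le> ennreal A"
    using S0 Q_l(2) U_pos by (simp add: epowr_ennreal ennreal_mult[symmetric])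
  then have "U / l * (\<Sigma> / l) powr (q / p') \<le> A" using A(2) by simp
  then have "U * \<Sigma> powr (q / p') \<le> A * l powr (1 + q / p')"
    using S0 Q_l by (simp add: powr_divide powr_add field_simps)
  then show ?thesis using that S0 S by blast
qed

text \<open>The number \<open>R\<close> is the norm of \<open>w\<^sup>-\<^sup>1\<close> in the dual Lebesgue space over \<open>Q\<close>.\<close>

lemma dual_norm:
  assumes f [measurable]: "f \<in> borel_measurable lebesgue" and f0: "\<And>x. f x \<ge> 0"
    and fin: "(\<integral>\<^sup>+x. ennreal (\<bar>w x * f x\<bar> powr p) \<partial>lebesgue) < top"
  obtains R where "R \<ge> 0"
    "U * R powr q \<le> A * l powr (1 + q - q / p)"
    "\<And>E. E \<in> sets lebesgue \<Longrightarrow> E \<subseteq> Q \<Longrightarrow> emeasure (density lebesgue (\<lambda>x. ennreal (f x))) E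
       \<le> ennreal (R * measure (density lebesgue (\<lambda>x. ennreal (\<bar>w x * f x\<bar> powr p))) E powr (1 / p))"
proof -
  let ?mu = "density lebesgue (\<lambda>x. ennreal (\<bar>w x * f x\<bar> powr p))"
  have mu: "emeasure ?mu E = (\<integral>\<^sup>+x\<in>E. ennreal (\<bar>w x * f x\<bar> powr p) \<partial>lebesgue)"
    "emeasure ?mu E = ennreal (measure ?mu E)" if E: "E \<in> sets lebesgue" for E
  proof -
    show e: "emeasure ?mu E = (\<integral>\<^sup>+x\<in>E. ennreal (\<bar>w x * f x\<bar> powr p) \<partial>lebesgue)"
      using E by (simp add: emeasure_density)
    have "\<dots> \<le> (\<integral>\<^sup>+x. ennreal (\<bar>w x * f x\<bar> powr p) \<partial>lebesgue)"
      by (intro nn_integral_mono) (auto simp: indicator_def)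
    then show "emeasure ?mu E = ennreal (measure ?mu E)"
      using fin e by (intro emeasure_eq_ennreal_measure) (auto simp: top_unique)
  qed
  have lamE: "emeasure (density lebesgue (\<lambda>x. ennreal (f x))) E = (\<integral>\<^sup>+x\<in>E. ennreal (f x) \<partial>lebesgue)"
    if "E \<in> sets lebesgue" for E
    using that by (simp add: emeasure_density)
  show ?thesis
  proof (cases "p = 1")
    case True
    let ?s = "esssup (lebesgue_on Q) (\<lambda>x. ennreal (inverse (w x)))"
    have df: "dual_factor p q w Q = epowr ?s q" using True by (simp add: dual_factor_def)
    then have "?s < top" using factors_less_top(2) by (metis epowr_top less_top)
    then obtain R where R: "?s = ennreal R" "R \<ge> 0" by (cases ?s) auto
    have "ennreal (U / l) * ennreal (R powr q) \<le> ennreal A"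
      using A(1) R unfolding average_u df by (simp add: epowr_ennreal)
    then have "U / l * R powr q \<le> A"
      using A(2) U_pos Q_l by (simp add: ennreal_mult[symmetric])
    then have 1: "U * R powr q \<le> A * l powr (1 + q - q / p)" using True Q_l by (simp add: field_simps)
    have ae: "AE x in lebesgue. x \<in> Q \<longrightarrow> inverse (w x) \<le> R"
    proof -
      have "AE x in lebesgue_on Q. ennreal (inverse (w x)) \<le> ?s" by (rule esssup_AE)
      then have "AE x in lebesgue. x \<in> Q \<longrightarrow> ennreal (inverse (w x)) \<le> ?s"
        by (subst (asm) AE_restrict_space_iff) auto
      then show ?thesis by eventually_elim (use R in auto)
    qed
    have 2: "emeasure (density lebesgue (\<lambda>x. ennreal (f x))) E \<le> ennreal (R * measure ?mu E powr (1 / p))"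
      if E: "E \<in> sets lebesgue" "E \<subseteq> Q" for E
    proof -
      have "(\<integral>\<^sup>+x\<in>E. ennreal (f x) \<partial>lebesgue)
        \<le> (\<integral>\<^sup>+x. ennreal R * (ennreal (\<bar>w x * f x\<bar> powr p) * indicator E x) \<partial>lebesgue)"
      proof (rule nn_integral_mono_AE, use ae in eventually_elim)
        fix x assume x: "x \<in> Q \<longrightarrow> inverse (w x) \<le> R"
        show "ennreal (f x) * indicator E x \<le> ennreal R * (ennreal (\<bar>w x * f x\<bar> powr p) * indicator E x)"
        proof (cases "x \<in> E")
          case xE: True
          then have "inverse (w x) * (w x * f x) \<le> R * (w x * f x)"
            using x E f0[of x] w_pos[of x] by (intro mult_right_mono) auto
          then have "f x \<le> R * \<bar>w x * f x\<bar> powr p"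
            using True w_pos[of x] f0[of x] by (simp add: mult.assoc[symmetric] less_imp_neq[symmetric])
          then show ?thesis using xE R by (simp add: ennreal_mult[symmetric] ennreal_leI)
        qed simp
      qed
      also have "\<dots> = ennreal R * ennreal (measure ?mu E)"
        using E by (subst nn_integral_cmult) (auto simp: mu[symmetric])
      finally show ?thesis using lamE[OF E(1)] True R by (simp add: ennreal_mult)
    qed
    show ?thesis by (rule that[OF R(2) 1 2])
  next
    case False
    then have p1: "p > 1" using p by simp
    define p' where "p' = p / (p - 1)"
    have p': "p' > 1" "1 / p + 1 / p' = 1" using p1 by (auto simp: p'_def field_simps)
    obtain \<Sigma> where S: "\<Sigma> > 0" "(\<integral>\<^sup>+x\<in>Q. ennreal (w x powr (- p')) \<partial>lebesgue) = ennreal \<Sigma>"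
      "U * \<Sigma> powr (q / p') \<le> A * l powr (1 + q / p')"
      using dual_integral[OF p1] unfolding p'_def by blast
    define R where "R = \<Sigma> powr (1 / p')"
    have "q / p' = q - q / p"
    proof -
      have "1 / p' = 1 - 1 / p" using p' by simp
      then have "q * (1 / p') = q * (1 - 1 / p)" by simp
      then show ?thesis by (simp add: algebra_simps)
    qed
    then have e: "1 + q - q / p = 1 + q / p'" by simp
    have 1: "U * R powr q \<le> A * l powr (1 + q - q / p)"
      using S(3) unfolding R_def e by (simp add: powr_powr)
    have 2: "emeasure (density lebesgue (\<lambda>x. ennreal (f x))) E \<le> ennreal (R * measure ?mu E powr (1 / p))"
      if E: "E \<in> sets lebesgue" "E \<subseteq> Q" for E
    proof -
      have [measurable]: "E \<in> sets lebesgue" by fact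
      \<comment> \<open>The set \<open>E\<close> is kept only in the factor with \<open>f\<close>;
        the dual factor lives on all of \<open>Q\<close>, so that \<open>R\<close> does not depend
        on \<open>E\<close>.\<close>
      let ?F = "\<lambda>x. w x * f x * indicator E x" and ?G = "\<lambda>x. inverse (w x) * indicator Q x :: real"
      have "(\<integral>\<^sup>+x. ennreal (f x) * indicator E x \<partial>lebesgue) = (\<integral>\<^sup>+x. ennreal (?F x * ?G x) \<partial>lebesgue)"
      proof (rule nn_integral_cong)
        fix x
        have e: "w x * f x * inverse (w x) = f x" using w_pos[of x] by (simp add: field_simps)
        show "ennreal (f x) * indicator E x = ennreal (?F x * ?G x)"
          using E(2) by (auto simp: indicator_def e)
      qed
      also have "\<dots> \<le> ennreal (measure ?mu E powr (1 / p) * \<Sigma> powr (1 / p'))"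
      proof (rule nn_integral_Holder[OF p1 p'])
        have "(\<integral>\<^sup>+x. ennreal (?F x powr p) \<partial>lebesgue) = (\<integral>\<^sup>+x\<in>E. ennreal (\<bar>w x * f x\<bar> powr p) \<partial>lebesgue)"
          using w_pos f0 p by (intro nn_integral_cong) (auto simp: indicator_def less_imp_le)
        then show "(\<integral>\<^sup>+x. ennreal (?F x powr p) \<partial>lebesgue) \<le> ennreal (measure ?mu E)"
          using mu[OF E(1)] by simp
        have "(\<integral>\<^sup>+x. ennreal (?G x powr p') \<partial>lebesgue) = (\<integral>\<^sup>+x\<in>Q. ennreal (w x powr (- p')) \<partial>lebesgue)"
          using w_pos p' by (intro nn_integral_cong)
            (auto simp: indicator_def powr_minus inverse_powr less_imp_le)
        then show "(\<integral>\<^sup>+x. ennreal (?G x powr p') \<partial>lebesgue) \<le> ennreal \<Sigma>" using S by simp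
      qed (use S f0 w_pos in \<open>auto simp: less_imp_le\<close>)
      finally show ?thesis using lamE[OF E(1)] by (simp add: R_def mult.commute)
    qed
    show ?thesis by (rule that[OF _ 1 2]) (auto simp: R_def)
  qed
qed

text \<open>Hoelder's inequality with exponents \<open>1 + q / p'\<close> and its conjugate, applied to
  \<open>1 = w\<^sup>q\<^sup>/\<^sup>s w\<^sup>-\<^sup>q\<^sup>/\<^sup>s\<close> on \<open>E\<close>.\<close>

lemma Apq_subset_measure:
  assumes p1: "p > 1" and E: "E \<in> sets lebesgue" "E \<subseteq> Q" and g: "\<gamma> > 0"
    and ge: "emeasure lebesgue E \<ge> ennreal \<gamma> * emeasure lebesgue Q"
  shows "\<gamma> powr (1 + q * (1 - 1 / p)) * U \<le> A * measure u E"
proof -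
  define p' where "p' = p / (p - 1)"
  have p': "p' > 1" "1 / p' = 1 - 1 / p" using p1 by (auto simp: p'_def field_simps)
  define s where "s = 1 + q / p'"
  define s' where "s' = s / (s - 1)"
  have s: "s > 1" using q p' by (simp add: s_def)
  have s': "s' > 1" "1 / s + 1 / s' = 1" "s / s' = s - 1" using s by (auto simp: s'_def field_simps)
  \<comment> \<open>The exponent s is chosen for this identity: the second Hoelder factor, raised to
    its exponent, becomes w^(-p'), which \<open>dual_integral\<close> controls.\<close>
  have "q / s * s' = q / (s - 1)" using s by (simp add: s'_def)
  then have qs: "q / s * s' = p'" using q p' by (simp add: s_def)
  obtain \<Sigma> where S: "\<Sigma> > 0" "(\<integral>\<^sup>+x\<in>Q. ennreal (w x powr (- p')) \<partial>lebesgue) = ennreal \<Sigma>"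
    "U * \<Sigma> powr (q / p') \<le> A * l powr (1 + q / p')"
    using dual_integral[OF p1] unfolding p'_def by blast
  have [measurable]: "E \<in> sets lebesgue" by fact
  have "emeasure u E \<le> emeasure u Q" using E by (intro emeasure_mono) auto
  then have uE: "emeasure u E = ennreal (measure u E)"
    using u_fin by (intro emeasure_eq_ennreal_measure) (auto simp: top_unique)
  let ?F = "\<lambda>x. w x powr (q / s) * indicator E x" and ?G = "\<lambda>x. w x powr (- (q / s)) * indicator Q x :: real"
  have "emeasure lebesgue E = (\<integral>\<^sup>+x. ennreal (?F x * ?G x) \<partial>lebesgue)"
  proof -
    have "ennreal (?F x * ?G x) = indicator E x" for x
      using E(2) w_pos[of x] by (auto simp: indicator_def powr_add[symmetric])
    then show ?thesis by simp
  qed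
  also have "\<dots> \<le> ennreal (measure u E powr (1 / s) * \<Sigma> powr (1 / s'))"
  proof (rule nn_integral_Holder[OF s s'(1,2)])
    have "(\<integral>\<^sup>+x. ennreal (?F x powr s) \<partial>lebesgue) = (\<integral>\<^sup>+x\<in>E. ennreal (w x powr q) \<partial>lebesgue)"
      using s by (intro nn_integral_cong) (auto simp: indicator_def powr_powr)
    then show "(\<integral>\<^sup>+x. ennreal (?F x powr s) \<partial>lebesgue) \<le> ennreal (measure u E)"
      using uE emeasure_u[OF E(1)] by simp
    have "(\<integral>\<^sup>+x. ennreal (?G x powr s') \<partial>lebesgue) = (\<integral>\<^sup>+x\<in>Q. ennreal (w x powr (- p')) \<partial>lebesgue)"
      using s' qs by (intro nn_integral_cong) (auto simp: indicator_def powr_powr)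
    then show "(\<integral>\<^sup>+x. ennreal (?G x powr s') \<partial>lebesgue) \<le> ennreal \<Sigma>" using S by simp
  qed (use S in auto)
  finally have "ennreal (\<gamma> * l) \<le> ennreal (measure u E powr (1 / s) * \<Sigma> powr (1 / s'))"
    using ge g Q_l by (simp add: ennreal_mult order_trans)
  then have "\<gamma> * l \<le> measure u E powr (1 / s) * \<Sigma> powr (1 / s')" by (simp add: ennreal_le_iff)
  then have "(\<gamma> * l) powr s \<le> (measure u E powr (1 / s) * \<Sigma> powr (1 / s')) powr s"
    using g Q_l s by (intro powr_mono2) auto
  also have "\<dots> = measure u E * \<Sigma> powr (q / p')"
    using s s' by (simp add: powr_mult powr_powr s_def)
  finally have "(\<gamma> * l) powr s * U \<le> measure u E * (U * \<Sigma> powr (q / p'))"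
    using U_pos by (simp add: mult_ac mult_right_mono)
  also have "\<dots> \<le> measure u E * (A * l powr s)"
    using S(3) unfolding s_def by (intro mult_left_mono) auto
  finally have "l powr s * (\<gamma> powr s * U) \<le> l powr s * (A * measure u E)"
    using g Q_l by (simp add: powr_mult mult_ac)
  then have "\<gamma> powr s * U \<le> A * measure u E" using Q_l by simp
  moreover have "s = 1 + q * (1 - 1 / p)" unfolding s_def p'(2)[symmetric] by simp
  ultimately show ?thesis by simp
qed

end

section \<open>Carleson packing for sparse families\<close>

lemma ennreal_divide_mult_cancel:
  fixes x y :: ennreal
  assumes "y \<noteq> 0" "y \<noteq> top"
  shows "x / y * y = x"
  using assms by (subst ennreal_divide_times) (simp add: ennreal_divide_self less_top)

text \<open>The sets \<open>E Q\<close> with \<open>Q \<subseteq> P\<close> are disjoint subsets of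
  \<open>P\<close>. The measure is left general because this is applied both to Lebesgue measure and
  to the weight.\<close>

lemma sparse_packing:
  assumes "finite S" "E ` S \<subseteq> sets M" "\<And>Q. Q \<in> S \<Longrightarrow> E Q \<subseteq> Q" "disjoint_family_on E S" "P \<in> sets M"
    and dE: "\<And>Q. Q \<in> S \<Longrightarrow> ennreal \<delta> * emeasure M Q \<le> emeasure M (E Q)"
  shows "ennreal \<delta> * (\<Sum>Q\<in>{Q\<in>S. Q \<subseteq> P}. emeasure M Q) \<le> emeasure M P"
proof -
  have "ennreal \<delta> * (\<Sum>Q\<in>{Q\<in>S. Q \<subseteq> P}. emeasure M Q) \<le> (\<Sum>Q\<in>{Q\<in>S. Q \<subseteq> P}. emeasure M (E Q))"
    unfolding sum_distrib_left using dE by (intro sum_mono) auto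
  also have "\<dots> = emeasure M (\<Union>Q\<in>{Q\<in>S. Q \<subseteq> P}. E Q)"
    using assms by (intro sum_emeasure) (auto simp: disjoint_family_on_def)
  also have "\<dots> \<le> emeasure M P"
    using assms by (intro emeasure_mono) blast+
  finally show ?thesis .
qed

text \<open>Up to \<gamma>, the weight of \<open>Q\<close> is at most its average over
  \<open>Q\<close> times the measure of \<open>E Q\<close>. On \<open>E Q\<close> this average is
  bounded by the maximal function localised to \<open>P\<close>, and the sets \<open>E Q\<close> are
  disjoint in \<open>P\<close>, so the definition of the constant applies to
  \<open>P\<close>.\<close>

lemma Ainf_packing:
  fixes D :: "(real ^ 'd::finite) set set" and v :: "real ^ 'd \<Rightarrow> ennreal"
  assumes D: "dyadic_grid D" "S \<subseteq> D" "finite S" and v [measurable]: "v \<in> borel_measurable lebesgue"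
    and E: "\<And>Q. Q \<in> S \<Longrightarrow> E Q \<in> sets lebesgue \<and> E Q \<subseteq> Q \<and> ennreal \<gamma> * emeasure lebesgue Q \<le> emeasure lebesgue (E Q)"
    and disj: "disjoint_family_on E S"
    and P: "P \<in> S" "(\<integral>\<^sup>+x\<in>P. v x \<partial>lebesgue) \<noteq> 0" "(\<integral>\<^sup>+x\<in>P. v x \<partial>lebesgue) \<noteq> top"
  shows "ennreal \<gamma> * (\<Sum>Q\<in>{Q\<in>S. Q \<subseteq> P}. \<integral>\<^sup>+x\<in>Q. v x \<partial>lebesgue) \<le> Ainf_const D v * (\<integral>\<^sup>+x\<in>P. v x \<partial>lebesgue)"
proof -
  let ?M = "maximal_fun D (\<lambda>y. indicator P y * v y)"
  let ?S = "{Q \<in> S. Q \<subseteq> P}"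
  have fin: "finite ?S" using D by simp
  have cubeQ: "Q \<in> sets lebesgue" "0 < emeasure lebesgue Q" "emeasure lebesgue Q < top" if "Q \<in> S" for Q
    using dyadic_grid_cube[OF D(1)] that D(2) by auto
  have "ennreal \<gamma> * (\<Sum>Q\<in>?S. \<integral>\<^sup>+x\<in>Q. v x \<partial>lebesgue) \<le> (\<Sum>Q\<in>?S. average v Q * emeasure lebesgue (E Q))"
    unfolding sum_distrib_left
  proof (rule sum_mono)
    fix Q assume Q: "Q \<in> ?S"
    then have "(\<integral>\<^sup>+x\<in>Q. v x \<partial>lebesgue) = average v Q * emeasure lebesgue Q"
      unfolding average_def using cubeQ[of Q]
      by (subst ennreal_divide_mult_cancel) (auto simp: less_top)
    then have "ennreal \<gamma> * (\<integral>\<^sup>+x\<in>Q. v x \<partial>lebesgue) = average v Q * (ennreal \<gamma> * emeasure lebesgue Q)"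
      by (simp add: mult_ac)
    also have "\<dots> \<le> average v Q * emeasure lebesgue (E Q)"
      using E[of Q] Q by (intro mult_left_mono) auto
    finally show "ennreal \<gamma> * (\<integral>\<^sup>+x\<in>Q. v x \<partial>lebesgue) \<le> average v Q * emeasure lebesgue (E Q)" .
  qed
  also have "\<dots> = (\<integral>\<^sup>+x. (\<Sum>Q\<in>?S. average v Q * indicator (E Q) x) \<partial>lebesgue)"
  proof -
    have "(\<lambda>x. average v Q * indicator (E Q) x) \<in> borel_measurable lebesgue" if "Q \<in> ?S" for Q
    proof -
      have [measurable]: "E Q \<in> sets lebesgue" using E that by auto
      show ?thesis by measurable
    qed
    then show ?thesis using E by (subst nn_integral_sum) (auto simp: nn_integral_cmult_indicator)
  qed
  also have "\<dots> \<le> (\<integral>\<^sup>+x\<in>P. ?M x \<partial>lebesgue)"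
  proof (rule nn_integral_mono)
    fix x
    show "(\<Sum>Q\<in>?S. average v Q * indicator (E Q) x) \<le> ?M x * indicator P x"
    proof (cases "\<exists>Q\<in>?S. x \<in> E Q")
      case True
      then obtain Q where Q: "Q \<in> ?S" "x \<in> E Q" by blast
      have "(\<Sum>R\<in>?S. average v R * indicator (E R) x) = average v Q * indicator (E Q) x"
      proof (rule sum.remove[OF fin Q(1), THEN trans])
        have "(\<Sum>R\<in>?S - {Q}. average v R * indicator (E R) x) = 0"
          using disj Q by (intro sum.neutral) (auto simp: disjoint_family_on_def indicator_def)
        then show "average v Q * indicator (E Q) x + (\<Sum>R\<in>?S - {Q}. average v R * indicator (E R) x) = average v Q * indicator (E Q) x" by simp
      qed
      also have "\<dots> = average (\<lambda>y. indicator P y * v y) Q"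
      proof -
        have "indicator P y * v y * indicator Q y = v y * indicator Q y" for y
          using Q by (auto simp: indicator_def)
        then show ?thesis unfolding average_def using Q by simp
      qed
      also have "\<dots> \<le> ?M x"
        unfolding maximal_fun_def using Q D(2) E[of Q] by (intro SUP_upper) auto
      finally show ?thesis using Q E[of Q] by (auto simp: indicator_def)
    next
      case False
      then have "(\<Sum>Q\<in>?S. average v Q * indicator (E Q) x) = 0" by (intro sum.neutral) auto
      then show ?thesis by simp
    qed
  qed
  also have "\<dots> \<le> Ainf_const D v * (\<integral>\<^sup>+x\<in>P. v x \<partial>lebesgue)"
  proof -
    let ?I = "\<integral>\<^sup>+x\<in>P. v x \<partial>lebesgue"
    have "(\<integral>\<^sup>+x\<in>P. ?M x \<partial>lebesgue) / ?I \<le> Ainf_const D v"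
      unfolding Ainf_const_def using P(1) D(2) by (intro SUP_upper2[of P]) auto
    then have "(\<integral>\<^sup>+x\<in>P. ?M x \<partial>lebesgue) / ?I * ?I \<le> Ainf_const D v * ?I" by (rule mult_right_mono) simp
    moreover have "(\<integral>\<^sup>+x\<in>P. ?M x \<partial>lebesgue) / ?I * ?I = (\<integral>\<^sup>+x\<in>P. ?M x \<partial>lebesgue)"
      using P(2,3) by (rule ennreal_divide_mult_cancel)
    ultimately show ?thesis by simp
  qed
  finally show ?thesis .
qed

section \<open>The weak-type bound\<close>

text \<open>Equality (1 / (N \<gamma>))^\<tau> = 1/4 holds at N = 4^(1/\<tau>) / \<gamma>; this is
  an integer above it and at least 1.\<close>

definition sep_count :: "real \<Rightarrow> real \<Rightarrow> nat" where
  "sep_count \<tau> \<gamma> = nat \<lceil>4 powr (1 / \<tau>) / \<gamma>\<rceil> + 1"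

lemma sep_count:
  assumes "\<tau> > 0" "\<gamma> > 0"
  shows "sep_count \<tau> \<gamma> \<ge> 1" "(1 / (real (sep_count \<tau> \<gamma>) * \<gamma>)) powr \<tau> \<le> 1 / 4"
proof -
  have "4 powr (1 / \<tau>) / \<gamma> \<le> real (sep_count \<tau> \<gamma>)" unfolding sep_count_def by linarith
  then have "4 powr (1 / \<tau>) \<le> real (sep_count \<tau> \<gamma>) * \<gamma>" using assms by (simp add: field_simps)
  moreover have "real (sep_count \<tau> \<gamma>) > 0" unfolding sep_count_def by linarith
  ultimately have "1 / (real (sep_count \<tau> \<gamma>) * \<gamma>) \<le> 1 / 4 powr (1 / \<tau>)"
    using assms by (intro divide_left_mono mult_pos_pos) auto
  then have "(1 / (real (sep_count \<tau> \<gamma>) * \<gamma>)) powr \<tau> \<le> (1 / 4 powr (1 / \<tau>)) powr \<tau>"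
    using assms by (intro powr_mono2) auto
  also have "\<dots> = 1 / 4" using assms by (simp add: powr_divide powr_powr)
  finally show "(1 / (real (sep_count \<tau> \<gamma>) * \<gamma>)) powr \<tau> \<le> 1 / 4" .
qed (simp add: sep_count_def)

definition lev_const :: "real \<Rightarrow> real \<Rightarrow> real \<Rightarrow> real \<Rightarrow> real" where
  "lev_const \<tau> \<gamma> r q = real (sep_count \<tau> \<gamma>) powr r * tree_const r * 4 powr q"

definition tail_const :: "real \<Rightarrow> real \<Rightarrow> real \<Rightarrow> nat \<Rightarrow> real" where
  "tail_const \<nu> r q n = geom_const ((\<nu> * (r + real n) - q) / (r + real n)) (r + real n) * moment_const r n"

text \<open>The summand 1 stems from the cubes with average above 1. The number
  \<open>nat \<lceil>q\<rceil> + 1\<close> of extra moments exceeds q, which suffices since \<nu>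
  \<ge> 1. The last factor of the third branch turns 2^(m0 \<nu>) \<le> 2^\<nu> \<Lambda>, with
  \<open>\<Lambda> = A / \<gamma> powr (1 + q * (1 - 1 / p))\<close>, into a bound by a power of
  A.\<close>

definition weak_const :: "real \<Rightarrow> real \<Rightarrow> real \<Rightarrow> real \<Rightarrow> real \<Rightarrow> real" where
  "weak_const \<nu> \<tau> \<gamma> p q =
     (if p < \<nu> then 1 + geom_const ((\<nu> * (q / p) - q) / (q / p)) (q / p) * lev_const \<tau> \<gamma> (q / p) q
      else if p = \<nu> then 1 + tail_const \<nu> (q / p) q (nat \<lceil>q\<rceil> + 1) * lev_const \<tau> \<gamma> (q / p) q + lev_const \<tau> \<gamma> (q / p) q
      else (1 + tail_const \<nu> (q / p) q (nat \<lceil>q\<rceil> + 1) * lev_const \<tau> \<gamma> (q / p) q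
        + geom_const ((q - \<nu> * (q / p)) / (q / p)) (q / p) * lev_const \<tau> \<gamma> (q / p) q)
        * (2 powr \<nu> / \<gamma> powr (1 + q * (1 - 1 / p))) powr (q / \<nu> - q / p))"

text \<open>A bound for (m0 + 1) / \<open>L\<close> at p = \<nu>. The 3 covers rounding, the shift
  that keeps m0 positive, and the added 1; the other terms convert log 2 (Ai / \<gamma>) to natural
  logarithms.\<close>

definition threshold_const :: "real \<Rightarrow> real" where
  "threshold_const \<gamma> = 3 + 1 / ln 2 + ln (1 / \<gamma>) / ln 2"

lemma lev_const_nonneg: "r \<ge> 1 \<Longrightarrow> lev_const \<tau> \<gamma> r q \<ge> 0"
  unfolding lev_const_def using tree_const_pos[of r] by auto

lemma tail_const_nonneg: "r \<ge> 1 \<Longrightarrow> tail_const \<nu> r q n \<ge> 0"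
  unfolding tail_const_def geom_const_def using moment_const_pos[of r n] by auto

lemma weak_const_pos:
  assumes "1 \<le> p" "p \<le> q" "\<gamma> > 0" shows "weak_const \<nu> \<tau> \<gamma> p q > 0"
proof -
  have r: "q / p \<ge> 1" using assms by auto
  have "geom_const e b \<ge> 0" for e b by (simp add: geom_const_def)
  with lev_const_nonneg[OF r, of \<tau> \<gamma> q] tail_const_nonneg[OF r, of \<nu> q] show ?thesis
    unfolding weak_const_def using assms(3)
    by (auto intro!: mult_pos_pos add_pos_nonneg mult_nonneg_nonneg)
qed

lemma dyadic_exponent_bounds:
  fixes \<Lambda> \<nu> :: real
  assumes "\<Lambda> \<ge> 1" "\<nu> \<ge> 1"
  defines "m \<equiv> nat \<lceil>log 2 \<Lambda> / \<nu>\<rceil>"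
  shows "\<Lambda> \<le> 2 powr (real m * \<nu>)" "2 powr (real m * \<nu>) \<le> 2 powr \<nu> * \<Lambda>" "real m \<le> log 2 \<Lambda> + 1"
proof -
  have l: "log 2 \<Lambda> \<ge> 0" using assms by simp
  have "real m = real_of_int \<lceil>log 2 \<Lambda> / \<nu>\<rceil>" using l assms unfolding m_def by simp
  then have m: "log 2 \<Lambda> / \<nu> \<le> real m" "real m < log 2 \<Lambda> / \<nu> + 1" by linarith+
  then have "log 2 \<Lambda> \<le> real m * \<nu>" "real m * \<nu> \<le> log 2 \<Lambda> + \<nu>"
    using assms(2) by (auto simp: field_simps)
  then have "2 powr log 2 \<Lambda> \<le> 2 powr (real m * \<nu>)" "2 powr (real m * \<nu>) \<le> 2 powr (log 2 \<Lambda> + \<nu>)"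
    by (auto intro: powr_mono)
  then show "\<Lambda> \<le> 2 powr (real m * \<nu>)" "2 powr (real m * \<nu>) \<le> 2 powr \<nu> * \<Lambda>"
    using assms(1) by (auto simp: powr_add mult.commute)
  have "log 2 \<Lambda> / \<nu> \<le> log 2 \<Lambda> / 1" using l assms(2) by (intro divide_left_mono) auto
  then show "real m \<le> log 2 \<Lambda> + 1" using m by linarith
qed

lemma ennreal_cancel_le:
  assumes "ennreal \<delta> * X \<le> ennreal k * Y" "\<delta> > 0" "k \<ge> 0"
  shows "X \<le> ennreal (k / \<delta>) * Y"
proof -
  have "ennreal (1 / \<delta>) * (ennreal \<delta> * X) \<le> ennreal (1 / \<delta>) * (ennreal k * Y)"
    using assms(1) by (rule mult_left_mono) simp
  then show ?thesis using assms(2,3) by (simp add: mult.assoc[symmetric] ennreal_mult[symmetric])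
qed

locale weighted_sparse =
  fixes \<nu> \<alpha> p q \<gamma> :: real and D S :: "(real ^ 'd::finite) set set" and w f :: "real ^ 'd \<Rightarrow> real"
  assumes nu: "\<nu> \<ge> 1" and alpha: "0 \<le> \<alpha>" "\<alpha> < real CARD('d)" and p: "1 \<le> p" "p \<le> q"
    and exps: "1 / q + \<alpha> / real CARD('d) = 1 / p" and gamma: "0 < \<gamma>" "\<gamma> < 1"
    and grid: "dyadic_grid D" and SD: "S \<subseteq> D" and sparse: "sparse_family \<gamma> S"
    and w: "weight w" and Afin: "Apq_const D p q w < top"
    and f_meas [measurable]: "f \<in> borel_measurable lebesgue" and f_nonneg: "\<And>x. f x \<ge> 0"
    and wf_fin: "(\<integral>\<^sup>+x. ennreal (\<bar>w x * f x\<bar> powr p) \<partial>lebesgue) < top"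
begin

definition "A = enn2real (Apq_const D p q w)"
definition "\<tau> = 1 - \<alpha> / real CARD('d)"
definition "r = q / p"
definition "F = enn2real (\<integral>\<^sup>+x. ennreal (\<bar>w x * f x\<bar> powr p) \<partial>lebesgue)"
definition "\<beta> = max (1 / q) (1 / \<nu> - \<alpha> / real CARD('d))"
definition "a Q = measure (density lebesgue (\<lambda>x. ennreal (f x))) Q / measure lebesgue Q powr \<tau>"

abbreviation "u \<equiv> density lebesgue (\<lambda>x. ennreal (w x powr q))"
abbreviation "mu \<equiv> density lebesgue (\<lambda>x. ennreal (\<bar>w x * f x\<bar> powr p))"
abbreviation "lam \<equiv> density lebesgue (\<lambda>x. ennreal (f x))"

lemma w_meas [measurable]: "w \<in> borel_measurable lebesgue" and w_pos: "w x > 0"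
  using w unfolding weight_def by auto

lemma basics: "q > 0" "r \<ge> 1" "0 < \<tau>" "\<tau> * q = 1 + q - q / p" "r = 1 \<Longrightarrow> \<tau> = 1"
proof -
  show q0: "q > 0" using p by linarith
  show "r \<ge> 1" unfolding r_def using p by simp
  show "0 < \<tau>" unfolding \<tau>_def using alpha by simp
  have ad: "\<alpha> / real CARD('d) = 1 / p - 1 / q" using exps by simp
  then show "\<tau> * q = 1 + q - q / p" unfolding \<tau>_def using q0 by (simp add: field_simps)
  show "\<tau> = 1" if "r = 1" using that ad q0 p unfolding \<tau>_def r_def by simp
qed

lemma A_eq: "Apq_const D p q w = ennreal A" and A_nonneg: "A \<ge> 0"
  using Afin unfolding A_def by auto

lemma F_eq: "emeasure mu (space mu) = ennreal F" "measure mu (space mu) = F" "F \<ge> 0"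
  and fin_mu: "finite_measure mu"
proof -
  have "emeasure mu (space mu) = (\<integral>\<^sup>+x. ennreal (\<bar>w x * f x\<bar> powr p) \<partial>lebesgue)"
    by (simp add: emeasure_density)
  then show 1: "emeasure mu (space mu) = ennreal F" unfolding F_def using wf_fin by simp
  show F: "F \<ge> 0" unfolding F_def by simp
  show "measure mu (space mu) = F" using 1 F by (simp add: measure_def)
  show "finite_measure mu" using 1 by (intro finite_measureI) simp
qed

lemma cube_props:
  assumes "Q \<in> D"
  shows "weight_on_cube w Q p q A (measure lebesgue Q)" "Q \<in> sets lebesgue" "Q \<noteq> {}"
    "emeasure lebesgue Q = ennreal (measure lebesgue Q)" "measure lebesgue Q > 0"
proof -
  note c = dyadic_grid_cube[OF grid assms]
  show "Q \<in> sets lebesgue" "Q \<noteq> {}" using c by auto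
  show l: "emeasure lebesgue Q = ennreal (measure lebesgue Q)"
    using c(3) by (intro emeasure_eq_ennreal_measure) auto
  then show l0: "measure lebesgue Q > 0" using c(2) by (metis ennreal_less_zero_iff)
  show "weight_on_cube w Q p q A (measure lebesgue Q)"
  proof
    show "average (\<lambda>x. ennreal (w x powr q)) Q * dual_factor p q w Q \<le> ennreal A"
      using Apq_const_ge[OF assms, where q = q and w = w and p = p] unfolding A_eq .
  qed (fact w_meas w_pos c(1) l l0 p(1) basics(1) A_nonneg)+
qed

text \<open>Hoelder's inequality on \<open>E\<close> and the weight condition on \<open>Q\<close>
  are multiplied. The relation between p, q and \<alpha>, in the form
  \<open>\<tau> * q = 1 + q - q / p\<close>, makes the powers of the measure of \<open>Q\<close>
  cancel.\<close>

lemma testing: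
  assumes Q: "Q \<in> D"
  shows "emeasure u Q < top" "emeasure lam Q < top"
    and "E \<in> sets lebesgue \<Longrightarrow> E \<subseteq> Q \<Longrightarrow>
      measure u Q * (measure lam E / measure lebesgue Q powr \<tau>) powr q \<le> A * measure mu E powr r"
proof -
  interpret C: weight_on_cube w Q p q A "measure lebesgue Q" by (rule cube_props[OF Q])
  let ?l = "measure lebesgue Q"
  have "\<exists>R. R \<ge> 0 \<and> C.U * R powr q \<le> A * ?l powr (1 + q - q / p) \<and>
    (\<forall>E. E \<in> sets lebesgue \<longrightarrow> E \<subseteq> Q \<longrightarrow> emeasure lam E \<le> ennreal (R * measure mu E powr (1 / p)))"
  proof (rule C.dual_norm[OF f_meas f_nonneg wf_fin])
    fix R assume "0 \<le> R" "C.U * R powr q \<le> A * ?l powr (1 + q - q / p)"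
      "\<And>E. E \<in> sets lebesgue \<Longrightarrow> E \<subseteq> Q \<Longrightarrow> emeasure lam E \<le> ennreal (R * measure mu E powr (1 / p))"
    then show ?thesis by (intro exI[of _ R] conjI allI impI)
  qed
  then obtain R where R': "R \<ge> 0 \<and> C.U * R powr q \<le> A * ?l powr (1 + q - q / p) \<and>
    (\<forall>E. E \<in> sets lebesgue \<longrightarrow> E \<subseteq> Q \<longrightarrow> emeasure lam E \<le> ennreal (R * measure mu E powr (1 / p)))"
    by (rule exE)
  then have R: "R \<ge> 0" "C.U * R powr q \<le> A * ?l powr (1 + q - q / p)" by simp_all
  have lamE: "emeasure lam E \<le> ennreal (R * measure mu E powr (1 / p))"
    if "E \<in> sets lebesgue" "E \<subseteq> Q" for E using R' that by simp
  show "emeasure u Q < top" by (rule C.u_fin)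
  show "emeasure lam Q < top"
    using lamE[OF cube_props(2)[OF Q]] by (rule order_le_less_trans) simp_all
  assume E: "E \<in> sets lebesgue" "E \<subseteq> Q"
  have "measure lam E \<le> R * measure mu E powr (1 / p)"
    unfolding measure_def[of lam] using lamE[OF E] R(1) by (intro enn2real_leI) auto
  then have "(measure lam E / ?l powr \<tau>) powr q \<le> (R * measure mu E powr (1 / p) / ?l powr \<tau>) powr q"
    using basics(1) by (intro powr_mono2 divide_right_mono) auto
  also have "\<dots> = R powr q * measure mu E powr r / ?l powr (\<tau> * q)"
    using R(1) by (simp add: powr_mult powr_divide powr_powr r_def)
  finally have "C.U * (measure lam E / ?l powr \<tau>) powr q \<le> C.U * (R powr q * measure mu E powr r / ?l powr (\<tau> * q))"
    using C.U_pos by (intro mult_left_mono) auto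
  also have "\<dots> = (C.U * R powr q) * (measure mu E powr r / ?l powr (\<tau> * q))" by simp
  also have "\<dots> \<le> (A * ?l powr (\<tau> * q)) * (measure mu E powr r / ?l powr (\<tau> * q))"
    using R(2) unfolding basics(4) by (intro mult_right_mono) auto
  also have "\<dots> = A * measure mu E powr r" using cube_props(5)[OF Q] by simp
  finally show "measure u Q * (measure lam E / ?l powr \<tau>) powr q \<le> A * measure mu E powr r"
    unfolding C.U_def .
qed

lemma sparse_sets:
  "\<exists>E. (\<forall>Q\<in>S. E Q \<in> sets lebesgue \<and> E Q \<subseteq> Q \<and>
      ennreal \<gamma> * emeasure lebesgue Q \<le> emeasure lebesgue (E Q)) \<and> disjoint_family_on E S"
  using sparse unfolding sparse_family_def .

lemma sparse_setting_finite:
  assumes S0: "finite S0" "S0 \<subseteq> S"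
  shows "sparse_setting lebesgue u mu lam S0 A r q \<tau> \<gamma> (sep_count \<tau> \<gamma>)"
proof (rule sparse_setting.intro)
  have S0D: "S0 \<subseteq> D" using S0 SD by blast
  show "laminar S0" using dyadic_grid_laminar[OF grid] S0D by (rule laminar_subset)
  show "{} \<notin> S0" "S0 \<subseteq> sets lebesgue" using cube_props(2,3) S0D by blast+
  show "0 < measure lebesgue Q" "emeasure lebesgue Q < top" "emeasure lam Q < top" "emeasure u Q < top"
    if "Q \<in> S0" for Q
    using cube_props(5)[of Q] testing(1,2)[of Q] dyadic_grid_cube(3)[OF grid, of Q] that S0D by auto
  show "measure u Q * (measure lam E / measure lebesgue Q powr \<tau>) powr q \<le> A * measure mu E powr r"
    if "Q \<in> S0" "E \<in> sets lebesgue" "E \<subseteq> Q" for Q E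
    using testing(3)[of Q E] that S0D by auto
  show "(\<Sum>P\<in>{P\<in>S0. P \<subseteq> Q}. measure lebesgue P) \<le> measure lebesgue Q / \<gamma>" if Q: "Q \<in> S0" for Q
  proof -
    from sparse_sets obtain E where E': "(\<forall>Q\<in>S. E Q \<in> sets lebesgue \<and> E Q \<subseteq> Q \<and>
      ennreal \<gamma> * emeasure lebesgue Q \<le> emeasure lebesgue (E Q)) \<and> disjoint_family_on E S"
      by (rule exE)
      have E: "Q \<in> S \<Longrightarrow> E Q \<in> sets lebesgue \<and> E Q \<subseteq> Q \<and>
      ennreal \<gamma> * emeasure lebesgue Q \<le> emeasure lebesgue (E Q)" "disjoint_family_on E S" for Q
      using E' by auto
    have "ennreal \<gamma> * (\<Sum>P\<in>{P\<in>S0. P \<subseteq> Q}. emeasure lebesgue P) \<le> emeasure lebesgue Q"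
      using E S0 Q cube_props(2)[of Q] S0D
      by (intro sparse_packing[of _ E]) (auto intro: disjoint_family_on_mono)
    also have "(\<Sum>P\<in>{P\<in>S0. P \<subseteq> Q}. emeasure lebesgue P) = (\<Sum>P\<in>{P\<in>S0. P \<subseteq> Q}. ennreal (measure lebesgue P))"
      using cube_props(4) S0D by (intro sum.cong) auto
    also have "\<dots> = ennreal (\<Sum>P\<in>{P\<in>S0. P \<subseteq> Q}. measure lebesgue P)" by simp
    also have "emeasure lebesgue Q = ennreal (measure lebesgue Q)" using cube_props(4) Q S0D by blast
    finally have "ennreal (\<gamma> * (\<Sum>P\<in>{P\<in>S0. P \<subseteq> Q}. measure lebesgue P)) \<le> ennreal (measure lebesgue Q)"
      using gamma by (simp add: ennreal_mult sum_nonneg)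
    then have "\<gamma> * (\<Sum>P\<in>{P\<in>S0. P \<subseteq> Q}. measure lebesgue P) \<le> measure lebesgue Q"
      by (subst (asm) ennreal_le_iff) auto
    then show ?thesis using gamma by (simp add: field_simps)
  qed
  show "finite_measure mu" by (rule fin_mu)
  show "1 \<le> sep_count \<tau> \<gamma>" "(1 / (real (sep_count \<tau> \<gamma>) * \<gamma>)) powr \<tau> \<le> 1 / 4"
    using sep_count basics(3) gamma(1) by blast+
qed (simp_all add: S0 A_nonneg basics gamma)

text \<open>The weight of \<open>E Q\<close> is at least a multiple 1 / A of that of
  \<open>Q\<close>, so the family is sparse for the weight too, with Carleson constant of order A.
  The same inequality for the full cube \<open>P\<close>, with \<gamma> = 1, yields
  \<open>A \<ge> 1\<close>.\<close>

lemma carleson_Apq: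
  assumes p1: "p > 1" and S0: "finite S0" "S0 \<subseteq> S" and P: "P \<in> S0"
  shows "A \<ge> 1"
    and "(\<Sum>Q\<in>{Q\<in>S0. Q \<subseteq> P}. emeasure u Q) \<le> ennreal (A / \<gamma> powr (1 + q * (1 - 1 / p))) * emeasure u P"
proof -
  let ?s = "1 + q * (1 - 1 / p)"
  have S0D: "S0 \<subseteq> D" using S0 SD by blast
  show A1: "A \<ge> 1"
  proof -
    interpret C: weight_on_cube w P p q A "measure lebesgue P" 
      by (rule cube_props(1)) (use P S0D in auto)
    have "1 powr ?s * C.U \<le> A * measure u P"
      using C.Q_meas by (intro C.Apq_subset_measure p1) auto
    then show ?thesis using C.U_pos by (simp add: C.U_def)
  qed
  from sparse_sets obtain E where E': "(\<forall>Q\<in>S. E Q \<in> sets lebesgue \<and> E Q \<subseteq> Q \<and>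
    ennreal \<gamma> * emeasure lebesgue Q \<le> emeasure lebesgue (E Q)) \<and> disjoint_family_on E S"
    by (rule exE)
    have E: "Q \<in> S \<Longrightarrow> E Q \<in> sets lebesgue \<and> E Q \<subseteq> Q \<and>
    ennreal \<gamma> * emeasure lebesgue Q \<le> emeasure lebesgue (E Q)" "disjoint_family_on E S" for Q
    using E' by auto
  have "ennreal (\<gamma> powr ?s / A) * (\<Sum>Q\<in>{Q\<in>S0. Q \<subseteq> P}. emeasure u Q) \<le> emeasure u P"
  proof (rule sparse_packing[of _ E])
    fix Q assume Q: "Q \<in> S0"
    interpret C: weight_on_cube w Q p q A "measure lebesgue Q" 
      by (rule cube_props(1)) (use Q S0D in auto)
    have EQ: "E Q \<in> sets lebesgue" "E Q \<subseteq> Q" "ennreal \<gamma> * emeasure lebesgue Q \<le> emeasure lebesgue (E Q)"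
      using E(1)[OF subsetD[OF S0(2) Q]] by blast+
    have "emeasure u (E Q) \<le> emeasure u Q" using EQ C.Q_meas by (intro emeasure_mono) auto
    then have uE: "emeasure u (E Q) = ennreal (measure u (E Q))"
      using C.u_fin by (intro emeasure_eq_ennreal_measure) (auto simp: top_unique)
    have "\<gamma> powr ?s / A * C.U \<le> measure u (E Q)"
      using C.Apq_subset_measure[OF p1 EQ(1,2) gamma(1) EQ(3)] A1 by (simp add: field_simps)
    then show "ennreal (\<gamma> powr ?s / A) * emeasure u Q \<le> emeasure u (E Q)"
      unfolding C.emeasure_u_eq uE using A1 C.U_pos by (simp add: ennreal_mult[symmetric] ennreal_leI)
  qed (use E S0 P S0D cube_props(2)[of P] in \<open>auto intro: disjoint_family_on_mono\<close>)
  then have "ennreal (\<gamma> powr ?s / A) * (\<Sum>Q\<in>{Q\<in>S0. Q \<subseteq> P}. emeasure u Q) \<le> ennreal 1 * emeasure u P" by simp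
  from ennreal_cancel_le[OF this] show "(\<Sum>Q\<in>{Q\<in>S0. Q \<subseteq> P}. emeasure u Q) \<le> ennreal (A / \<gamma> powr ?s) * emeasure u P"
    using A1 gamma by simp
qed

definition "Ai = enn2real (Ainf_const D (\<lambda>x. ennreal (w x powr q)))"

lemma carleson_Ainf:
  assumes fin: "Ainf_const D (\<lambda>x. ennreal (w x powr q)) < top" and S0: "finite S0" "S0 \<subseteq> S" and P: "P \<in> S0"
  shows "(\<Sum>Q\<in>{Q\<in>S0. Q \<subseteq> P}. emeasure u Q) \<le> ennreal (Ai / \<gamma>) * emeasure u P"
proof -
  have S0D: "S0 \<subseteq> D" using S0 SD by blast
  interpret C: weight_on_cube w P p q A "measure lebesgue P" 
      by (rule cube_props(1)) (use P S0D in auto)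
  from sparse_sets obtain E where E': "(\<forall>Q\<in>S. E Q \<in> sets lebesgue \<and> E Q \<subseteq> Q \<and>
    ennreal \<gamma> * emeasure lebesgue Q \<le> emeasure lebesgue (E Q)) \<and> disjoint_family_on E S"
    by (rule exE)
    have E: "Q \<in> S \<Longrightarrow> E Q \<in> sets lebesgue \<and> E Q \<subseteq> Q \<and>
    ennreal \<gamma> * emeasure lebesgue Q \<le> emeasure lebesgue (E Q)" "disjoint_family_on E S" for Q
    using E' by auto
  have uQ: "emeasure u Q = (\<integral>\<^sup>+x\<in>Q. ennreal (w x powr q) \<partial>lebesgue)" if "Q \<in> S0" for Q
    using that S0D cube_props(2)[of Q] by (auto simp: emeasure_density)
  have "ennreal \<gamma> * (\<Sum>Q\<in>{Q\<in>S0. Q \<subseteq> P}. \<integral>\<^sup>+x\<in>Q. ennreal (w x powr q) \<partial>lebesgue)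
    \<le> Ainf_const D (\<lambda>x. ennreal (w x powr q)) * (\<integral>\<^sup>+x\<in>P. ennreal (w x powr q) \<partial>lebesgue)"
  proof (rule Ainf_packing[OF grid S0D S0(1) _ _ _ P])
    show "E Q \<in> sets lebesgue \<and> E Q \<subseteq> Q \<and> ennreal \<gamma> * emeasure lebesgue Q \<le> emeasure lebesgue (E Q)"
      if "Q \<in> S0" for Q using E(1) that S0 by auto
    show "disjoint_family_on E S0" using E(2) S0(2) by (rule disjoint_family_on_mono[rotated])
    show "(\<integral>\<^sup>+x\<in>P. ennreal (w x powr q) \<partial>lebesgue) \<noteq> 0" "(\<integral>\<^sup>+x\<in>P. ennreal (w x powr q) \<partial>lebesgue) \<noteq> top"
      using C.emeasure_u_eq C.U_pos uQ[OF P] by auto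
  qed measurable
  moreover have "Ainf_const D (\<lambda>x. ennreal (w x powr q)) = ennreal Ai" unfolding Ai_def using fin by simp
  moreover have "(\<Sum>Q\<in>{Q\<in>S0. Q \<subseteq> P}. \<integral>\<^sup>+x\<in>Q. ennreal (w x powr q) \<partial>lebesgue) = (\<Sum>Q\<in>{Q\<in>S0. Q \<subseteq> P}. emeasure u Q)"
    using uQ by (intro sum.cong) auto
  ultimately have "ennreal \<gamma> * (\<Sum>Q\<in>{Q\<in>S0. Q \<subseteq> P}. emeasure u Q) \<le> ennreal Ai * emeasure u P"
    using uQ[OF P] by simp
  then show ?thesis using gamma by (intro ennreal_cancel_le) (auto simp: Ai_def)
qed

text \<open>Only the threshold at p = \<nu> has to grow; with this factor,
  \<open>threshold_const \<gamma> * L\<close> serves all three cases.\<close>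

definition "L = (if p = \<nu> then 1 + max (ln Ai) 0 else 1)"

lemma L_ge_1: "L \<ge> 1" unfolding L_def by auto

text \<open>Since \<alpha>/d = 1/p - 1/q, the second entry of the maximum is 1/q + (1/\<nu> - 1/p),
  so the maximum switches at p = \<nu>.\<close>

lemma beta_eq: "q * \<beta> = (if p \<le> \<nu> then 1 else 1 + (q / \<nu> - q / p))"
proof -
  have ad: "\<alpha> / real CARD('d) = 1 / p - 1 / q" using exps by simp
  have b: "\<beta> = max (1 / q) (1 / \<nu> - 1 / p + 1 / q)" unfolding \<beta>_def ad by simp
  show ?thesis
  proof (cases "p \<le> \<nu>")
    case True
    then have "1 / \<nu> \<le> 1 / p" using p nu by (simp add: frac_le)
    then show ?thesis unfolding b using True basics(1) by (simp add: max_def)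
  next
    case False
    then have "1 / p \<le> 1 / \<nu>" using p nu by (simp add: frac_le)
    then have "\<beta> = 1 / \<nu> - 1 / p + 1 / q" unfolding b by simp
    then show ?thesis using False basics(1) by (simp add: field_simps)
  qed
qed

lemma threshold_ge:
  "threshold_const \<gamma> * L \<ge> 2"
  "p = \<nu> \<Longrightarrow> real (nat \<lceil>log 2 (max 1 (Ai / \<gamma>)) / \<nu>\<rceil> + 1) + 1 \<le> threshold_const \<gamma> * L"
proof -
  have g: "ln (1 / \<gamma>) \<ge> 0" "ln (2::real) > 0" using gamma by auto
  have "threshold_const \<gamma> \<ge> 3" unfolding threshold_const_def using g by simp
  then have "3 * 1 \<le> threshold_const \<gamma> * L" using L_ge_1 by (intro mult_mono) auto
  then show "threshold_const \<gamma> * L \<ge> 2" by simp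
  assume pn: "p = \<nu>"
  let ?\<Lambda> = "max 1 (Ai / \<gamma>)"
  have "ln ?\<Lambda> \<le> max (ln Ai) 0 + ln (1 / \<gamma>)"
  proof (cases "Ai / \<gamma> \<le> 1")
    case False
    then have "Ai > 0" using gamma by (auto simp: Ai_def zero_less_divide_iff not_le intro: ccontr)
    then have "ln (Ai / \<gamma>) = ln Ai + ln (1 / \<gamma>)" using gamma by (simp add: ln_div)
    then show ?thesis using False by (simp add: max_def)
  next
    case True
    then have "?\<Lambda> = 1" by simp
    then show ?thesis using g by simp
  qed
  then have "log 2 ?\<Lambda> \<le> (max (ln Ai) 0 + ln (1 / \<gamma>)) / ln 2"
    unfolding log_def using g by (intro divide_right_mono) auto
  moreover have "real (nat \<lceil>log 2 ?\<Lambda> / \<nu>\<rceil>) \<le> log 2 ?\<Lambda> + 1"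
    by (rule dyadic_exponent_bounds) (use nu in auto)
  ultimately have "real (nat \<lceil>log 2 ?\<Lambda> / \<nu>\<rceil> + 1) + 1 \<le> 3 + max (ln Ai) 0 / ln 2 + ln (1 / \<gamma>) / ln 2"
    by (simp add: add_divide_distrib)
  also have "\<dots> \<le> 3 * L + L / ln 2 + ln (1 / \<gamma>) / ln 2 * L"
  proof (intro add_mono)
    show "max (ln Ai) 0 / ln 2 \<le> L / ln 2" using pn g unfolding L_def by (intro divide_right_mono) auto
    show "ln (1 / \<gamma>) / ln 2 \<le> ln (1 / \<gamma>) / ln 2 * L"
      using g L_ge_1 mult_left_mono[OF L_ge_1, of "ln (1 / \<gamma>) / ln 2"] by simp
  qed (use L_ge_1 in auto)
  also have "\<dots> = threshold_const \<gamma> * L" unfolding threshold_const_def by (simp add: algebra_simps)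
  finally show "real (nat \<lceil>log 2 ?\<Lambda> / \<nu>\<rceil> + 1) + 1 \<le> threshold_const \<gamma> * L" .
qed

lemma finite_weak_bound:
  assumes S0: "finite S0" "S0 \<subseteq> S"
    and Ai: "p = \<nu> \<Longrightarrow> Ainf_const D (\<lambda>x. ennreal (w x powr q)) < top"
  shows "emeasure u {x. (\<Sum>Q\<in>S0. a Q powr \<nu> * indicator Q x) \<ge> threshold_const \<gamma> * L}
    \<le> ennreal (weak_const \<nu> \<tau> \<gamma> p q * A powr (q * \<beta>) * F powr r)"
proof (cases "S0 = {}")
  \<comment> \<open>The empty family is treated apart because \<open>A \<ge> 1\<close> will be
    derived from a cube of the family; here a positive threshold suffices.\<close>
  case True
  have "{x. (\<Sum>Q\<in>S0. a Q powr \<nu> * indicator Q x) \<ge> threshold_const \<gamma> * L} = {}"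
    using threshold_ge(1) True by auto
  then show ?thesis by (simp only: emeasure_empty zero_le)
next
  case False
  interpret X: sparse_setting lebesgue u mu lam S0 A r q \<tau> \<gamma> "sep_count \<tau> \<gamma>"
    by (rule sparse_setting_finite[OF S0])
  let ?W = "F powr r" and ?K = "lev_const \<tau> \<gamma> r q" and ?n = "nat \<lceil>q\<rceil> + 1"
  have W: "measure mu (space mu) powr r = ?W" using F_eq by simp
  have XB: "X.B = ?K * A * ?W" unfolding X.B_def W lev_const_def by simp
  have Xg: "X.g \<nu> x = (\<Sum>Q\<in>S0. a Q powr \<nu> * indicator Q x)" for x
    unfolding X.g_def X.a_def a_def by simp
  have n: "q < \<nu> * (r + real ?n)"
  proof -
    have "q < real ?n" by linarith
    also have "\<dots> \<le> 1 * (r + real ?n)" using basics by simp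
    also have "\<dots> \<le> \<nu> * (r + real ?n)" using nu basics by (intro mult_right_mono) auto
    finally show ?thesis .
  qed
  have mono: "emeasure u {x. (\<Sum>Q\<in>S0. a Q powr \<nu> * indicator Q x) \<ge> threshold_const \<gamma> * L}
     \<le> emeasure u {x \<in> space u. X.g \<nu> x \<ge> T}" if "T \<le> threshold_const \<gamma> * L" for T
  proof (rule emeasure_mono)
    show "{x \<in> space u. X.g \<nu> x \<ge> T} \<in> sets u"
      by (intro borel_measurable_le X.g_measurable borel_measurable_const)
  qed (use that Xg in auto)
  consider "p < \<nu>" | "p = \<nu>" | "p > \<nu>" by linarith
  then show ?thesis
  proof cases
    case 1
    have "q < \<nu> * r" unfolding r_def using 1 basics(1) p by (simp add: field_simps)
    then have "emeasure u {x \<in> space u. X.g \<nu> x \<ge> 2} \<le> ennreal (A * ?W + geom_const ((\<nu> * r - q) / r) r * X.B)"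
      using X.emeasure_g_subcritical_le[of \<nu>] nu unfolding W by simp
    also have "A * ?W + geom_const ((\<nu> * r - q) / r) r * X.B = weak_const \<nu> \<tau> \<gamma> p q * A powr (q * \<beta>) * F powr r"
      using 1 A_nonneg unfolding XB weak_const_def beta_eq r_def[symmetric] by (simp add: algebra_simps)
    finally show ?thesis using mono[OF threshold_ge(1)] by (rule order_trans[rotated])
  next
    case 2
    let ?\<Lambda> = "max 1 (Ai / \<gamma>)"
    \<comment> \<open>The added 1 keeps the number of head levels positive, as the equal weights
      require.\<close>
    let ?m = "nat \<lceil>log 2 ?\<Lambda> / \<nu>\<rceil> + 1"
    have "Ai / \<gamma> \<le> ?\<Lambda>" by simp
    also have "?\<Lambda> \<le> 2 powr (real (nat \<lceil>log 2 ?\<Lambda> / \<nu>\<rceil>) * \<nu>)"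
      by (rule dyadic_exponent_bounds) (use nu in auto)
    also have "\<dots> \<le> 2 powr (real ?m * \<nu>)" using nu by (intro powr_mono mult_right_mono) auto
    finally have Lam: "Ai / \<gamma> \<le> 2 powr (real ?m * \<nu>)" .
    have carl: "(\<Sum>Q\<in>{Q\<in>S0. Q \<subseteq> P}. emeasure u Q) \<le> ennreal (2 powr (real ?m * \<nu>)) * emeasure u P"
      if "P \<in> S0" for P
      using carleson_Ainf[OF Ai[OF 2] S0 that] by (rule order_trans) (intro mult_right_mono ennreal_leI Lam, simp)
    have crit: "\<nu> * r = q" unfolding r_def using 2 nu by simp
    have "emeasure u {x \<in> space u. X.g \<nu> x \<ge> real ?m + 1}
      \<le> ennreal (A * ?W + geom_const ((\<nu> * (r + real ?n) - q) / (r + real ?n)) (r + real ?n) * moment_const r ?n * X.B + X.B)"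
      unfolding W[symmetric] by (rule X.emeasure_g_critical_le[OF carl n crit]) auto
    also have "A * ?W + geom_const ((\<nu> * (r + real ?n) - q) / (r + real ?n)) (r + real ?n) * moment_const r ?n * X.B + X.B
      = weak_const \<nu> \<tau> \<gamma> p q * A powr (q * \<beta>) * F powr r"
      using 2 A_nonneg unfolding XB weak_const_def beta_eq r_def[symmetric] tail_const_def by (simp add: algebra_simps)
    finally show ?thesis using mono[OF threshold_ge(2)[OF 2]] by (rule order_trans[rotated])
  next
    case 3
    then have p1: "p > 1" using nu by simp
    let ?s = "1 + q * (1 - 1 / p)"
    let ?\<Lambda> = "A / \<gamma> powr ?s"
    let ?m = "nat \<lceil>log 2 ?\<Lambda> / \<nu>\<rceil>"
    have A1: "A \<ge> 1" using carleson_Apq(1)[OF p1 S0] False by blast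
    have s: "?s \<ge> 0" using p1 basics(1) by (intro add_nonneg_nonneg mult_nonneg_nonneg) auto
    have gs: "0 < \<gamma> powr ?s" "\<gamma> powr ?s \<le> 1" using gamma s by (auto intro: powr_le1)
    have Lam1: "?\<Lambda> \<ge> 1" using A1 gs by (simp add: field_simps)
    note m = dyadic_exponent_bounds[OF Lam1 nu]
    have carl: "(\<Sum>Q\<in>{Q\<in>S0. Q \<subseteq> P}. emeasure u Q) \<le> ennreal (2 powr (real ?m * \<nu>)) * emeasure u P"
      if "P \<in> S0" for P
      using carleson_Apq(2)[OF p1 S0 that] by (rule order_trans) (intro mult_right_mono ennreal_leI m(1), simp)
    have sup: "\<nu> * r < q" unfolding r_def using 3 basics(1) p by (simp add: field_simps)
    let ?e = "q / \<nu> - q / p"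
    have e: "?e > 0" using 3 nu basics(1) by (simp add: field_simps)
    let ?Z = "2 powr (real ?m * (q - \<nu> * r))"
    let ?T = "tail_const \<nu> r q ?n * ?K" and ?G = "geom_const ((q - \<nu> * r) / r) r * ?K"
    have TG: "?T \<ge> 0" "?G \<ge> 0"
      using lev_const_nonneg[OF basics(2)] tail_const_nonneg[OF basics(2)] by (auto simp: geom_const_def)
    have Z1: "1 \<le> ?Z" using sup by (intro ge_one_powr_ge_zero) auto
    have Ze: "?Z \<le> (2 powr \<nu> / \<gamma> powr ?s) powr ?e * A powr ?e"
    proof -
      have "q - \<nu> * r = \<nu> * ?e" unfolding r_def using nu by (simp add: field_simps)
      then have "?Z = (2 powr (real ?m * \<nu>)) powr ?e" by (simp add: powr_powr mult.assoc)
      also have "\<dots> \<le> (2 powr \<nu> * ?\<Lambda>) powr ?e" using m(2) e by (intro powr_mono2) auto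
      also have "2 powr \<nu> * ?\<Lambda> = (2 powr \<nu> / \<gamma> powr ?s) * A" by simp
      also have "\<dots> powr ?e = (2 powr \<nu> / \<gamma> powr ?s) powr ?e * A powr ?e" using A1 gs by (subst powr_mult) auto
      finally show ?thesis .
    qed
    have "emeasure u {x \<in> space u. X.g \<nu> x \<ge> 2}
      \<le> ennreal (A * ?W + geom_const ((\<nu> * (r + real ?n) - q) / (r + real ?n)) (r + real ?n) * moment_const r ?n * X.B
        * ?Z + geom_const ((q - \<nu> * r) / r) r * X.B * ?Z)"
      using nu unfolding W[symmetric] by (intro X.emeasure_g_supercritical_le[OF carl n sup]) auto
    also have "\<dots> \<le> ennreal (weak_const \<nu> \<tau> \<gamma> p q * A powr (q * \<beta>) * F powr r)"
    proof (rule ennreal_leI)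
      have "A * ?W + geom_const ((\<nu> * (r + real ?n) - q) / (r + real ?n)) (r + real ?n) * moment_const r ?n * X.B
          * ?Z + geom_const ((q - \<nu> * r) / r) r * X.B * ?Z
        = A * ?W * (1 + ?T * ?Z + ?G * ?Z)"
        unfolding XB tail_const_def by (simp add: algebra_simps)
      \<comment> \<open>\<open>?Z \<ge> 1\<close> lets the term of the large cubes be absorbed into
        the same power of A.\<close>
      also have "\<dots> \<le> A * ?W * ((1 + ?T + ?G) * ?Z)"
        using Z1 A1 by (intro mult_left_mono) (auto simp: algebra_simps)
      also have "\<dots> \<le> A * ?W * ((1 + ?T + ?G) * ((2 powr \<nu> / \<gamma> powr ?s) powr ?e * A powr ?e))"
        using Ze A1 TG by (intro mult_left_mono) auto
      also have "\<dots> = ((1 + ?T + ?G) * (2 powr \<nu> / \<gamma> powr ?s) powr ?e) * (A * A powr ?e) * ?W"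
        by (simp only: mult_ac)
      also have "A * A powr ?e = A powr (q * \<beta>)" using 3 A1 unfolding beta_eq by (simp add: powr_add)
      also have "(1 + ?T + ?G) * (2 powr \<nu> / \<gamma> powr ?s) powr ?e = weak_const \<nu> \<tau> \<gamma> p q"
        using 3 unfolding weak_const_def r_def by simp
      finally show "A * ?W + geom_const ((\<nu> * (r + real ?n) - q) / (r + real ?n)) (r + real ?n) * moment_const r ?n * X.B
          * ?Z + geom_const ((q - \<nu> * r) / r) r * X.B * ?Z
        \<le> weak_const \<nu> \<tau> \<gamma> p q * A powr (q * \<beta>) * F powr r" .
    qed
    finally show ?thesis using mono[OF threshold_ge(1)] by (rule order_trans[rotated])
  qed
qed

lemma frac_average_eq:
  assumes "Q \<in> S" shows "frac_average \<alpha> f Q = ennreal (a Q)"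
proof -
  have Q: "Q \<in> D" using assms SD by blast
  have "(\<integral>\<^sup>+x\<in>Q. ennreal (f x) \<partial>lebesgue) = emeasure lam Q"
    using cube_props(2)[OF Q] by (simp add: emeasure_density)
  also have "\<dots> = ennreal (measure lam Q)"
    using testing(2)[OF Q] by (intro emeasure_eq_ennreal_measure) auto
  finally have 1: "(\<integral>\<^sup>+x\<in>Q. ennreal (f x) \<partial>lebesgue) = ennreal (measure lam Q)" .
  have 2: "epowr (emeasure lebesgue Q) (1 - \<alpha> / real CARD('d)) = ennreal (measure lebesgue Q powr \<tau>)"
    unfolding cube_props(4)[OF Q] \<tau>_def by (rule epowr_ennreal) simp
  show ?thesis
    unfolding frac_average_def 1 2 a_def using cube_props(5)[OF Q] by (intro divide_ennreal) auto
qed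

end

lemma epowr_log1:
  assumes "x \<noteq> top"
  shows "epowr (log1 x) s = ennreal ((1 + max (ln (enn2real x)) 0) powr s)"
  unfolding log1_def if_not_P[OF assms] by (rule epowr_ennreal) simp

section \<open>Rescaling, infinite families and the weak norm\<close>

context weighted_sparse
begin

abbreviation "T \<equiv> threshold_const \<gamma> * L"

lemma a_nonneg: "a Q \<ge> 0"
  unfolding a_def by simp

text \<open>Homogeneity in \<open>f\<close>: the bound at the single threshold \<open>T\<close> is
  applied to k f, where k carries \<open>t powr \<nu>\<close> to \<open>T\<close>. The quantities
  \<open>A\<close>, \<open>L\<close> and the constants depend only on the weight, the grid and the
  parameters, and \<open>F powr r\<close> acquires the factor \<open>k powr q\<close>.\<close>

lemma finite_weak_bound_scaled:
  assumes S0: "finite S0" "S0 \<subseteq> S" and t: "t > 0"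
    and Ai: "p = \<nu> \<Longrightarrow> Ainf_const D (\<lambda>x. ennreal (w x powr q)) < top"
  shows "emeasure u {x. (\<Sum>Q\<in>S0. a Q powr \<nu> * indicator Q x) \<ge> t powr \<nu>}
    \<le> ennreal (weak_const \<nu> \<tau> \<gamma> p q * A powr (q * \<beta>) * F powr r * (T powr (1 / \<nu>) / t) powr q)"
proof -
  have T: "T > 0" using threshold_ge(1) by linarith
  define k where "k = T powr (1 / \<nu>) / t"
  have "T powr (1 / \<nu>) > 0" using T by (subst powr_gt_zero) linarith
  then have k: "k > 0" unfolding k_def using t by (rule divide_pos_pos)
  let ?f = "\<lambda>x. k * f x"
  have wkf: "ennreal (\<bar>w x * ?f x\<bar> powr p) = ennreal (k powr p) * ennreal (\<bar>w x * f x\<bar> powr p)" for x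
  proof -
    have "\<bar>w x * ?f x\<bar> = k * \<bar>w x * f x\<bar>" using k by (simp add: abs_mult)
    then have "\<bar>w x * ?f x\<bar> powr p = k powr p * \<bar>w x * f x\<bar> powr p" using k by (simp add: powr_mult)
    then show ?thesis by (simp add: ennreal_mult)
  qed
  have int: "(\<integral>\<^sup>+x. ennreal (\<bar>w x * ?f x\<bar> powr p) \<partial>lebesgue)
      = ennreal (k powr p) * (\<integral>\<^sup>+x. ennreal (\<bar>w x * f x\<bar> powr p) \<partial>lebesgue)"
    unfolding wkf by (rule nn_integral_cmult) measurable
  have fin: "(\<integral>\<^sup>+x. ennreal (\<bar>w x * ?f x\<bar> powr p) \<partial>lebesgue) < top"
    unfolding int using wf_fin by (simp add: ennreal_mult_less_top)
  interpret K: weighted_sparse \<nu> \<alpha> p q \<gamma> D S w ?f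
  proof (rule weighted_sparse.intro)
    show "0 \<le> k * f x" for x using k f_nonneg by simp
    show "(\<lambda>x. k * f x) \<in> borel_measurable lebesgue" by measurable
  qed (fact nu alpha p exps gamma grid SD sparse w Afin fin)+
  have KF: "K.F powr r = k powr q * F powr r"
  proof -
    have "K.F = k powr p * F" unfolding K.F_def F_def int by (simp add: enn2real_mult)
    then have "K.F powr r = (k powr p) powr r * F powr r" using F_eq by (simp add: powr_mult)
    also have "(k powr p) powr r = k powr q" using p by (simp add: powr_powr r_def)
    finally show ?thesis .
  qed
  have Ka: "K.a Q = k * a Q" if "Q \<in> S" for Q
  proof -
    have Q: "Q \<in> sets lebesgue" using cube_props(2) that SD by blast
    have "emeasure (density lebesgue (\<lambda>x. ennreal (k * f x))) Q = (\<integral>\<^sup>+x. ennreal k * (ennreal (f x) * indicator Q x) \<partial>lebesgue)"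
      using Q k f_nonneg by (simp add: emeasure_density ennreal_mult mult.assoc)
    also have "\<dots> = ennreal k * emeasure lam Q"
      using Q by (subst nn_integral_cmult) (auto simp: emeasure_density)
    finally have "measure (density lebesgue (\<lambda>x. ennreal (k * f x))) Q = k * measure lam Q"
      using k by (simp add: measure_def enn2real_mult)
    then show ?thesis unfolding K.a_def a_def K.\<tau>_def \<tau>_def by simp
  qed
  have "{x. (\<Sum>Q\<in>S0. a Q powr \<nu> * indicator Q x) \<ge> t powr \<nu>}
    = {x. (\<Sum>Q\<in>S0. K.a Q powr \<nu> * indicator Q x) \<ge> T}"
  proof (intro Collect_cong)
    fix x
    have "(\<Sum>Q\<in>S0. K.a Q powr \<nu> * indicator Q x) = k powr \<nu> * (\<Sum>Q\<in>S0. a Q powr \<nu> * indicator Q x)"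
      unfolding sum_distrib_left
      using S0(2) k Ka a_nonneg by (intro sum.cong refl) (auto simp: powr_mult subset_iff)
    moreover have "k powr \<nu> = T / t powr \<nu>"
      unfolding k_def using T t nu by (simp add: powr_divide powr_powr)
    ultimately have eq: "(\<Sum>Q\<in>S0. K.a Q powr \<nu> * indicator Q x)
      = T * ((\<Sum>Q\<in>S0. a Q powr \<nu> * indicator Q x) / t powr \<nu>)" by simp
    have cancel: "T \<le> T * y \<longleftrightarrow> 1 \<le> y" for y using mult_le_cancel_left_pos[OF T, of 1 y] by simp
    have "T \<le> (\<Sum>Q\<in>S0. K.a Q powr \<nu> * indicator Q x)
      \<longleftrightarrow> 1 \<le> (\<Sum>Q\<in>S0. a Q powr \<nu> * indicator Q x) / t powr \<nu>"
      unfolding eq by (rule cancel)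
    then show "t powr \<nu> \<le> (\<Sum>Q\<in>S0. a Q powr \<nu> * indicator Q x)
      \<longleftrightarrow> T \<le> (\<Sum>Q\<in>S0. K.a Q powr \<nu> * indicator Q x)"
      using t by (simp add: le_divide_eq)
  qed
  also have "emeasure u \<dots> \<le> ennreal (weak_const \<nu> \<tau> \<gamma> p q * A powr (q * \<beta>) * K.F powr r)"
    using K.finite_weak_bound[OF S0 Ai]
    unfolding K.A_def A_def K.\<beta>_def \<beta>_def K.\<tau>_def \<tau>_def K.r_def r_def K.L_def L_def K.Ai_def Ai_def by simp
  finally show ?thesis unfolding KF unfolding k_def by (simp only: mult_ac)
qed

definition "h x = (\<Sum>\<^sub>\<infinity>Q\<in>S. epowr (frac_average \<alpha> f Q) \<nu> * indicator Q x)"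

lemma epowr_frac_average: "Q \<in> S \<Longrightarrow> epowr (frac_average \<alpha> f Q) \<nu> = ennreal (a Q powr \<nu>)"
  using frac_average_eq a_nonneg by (simp add: epowr_ennreal)

lemma h_eq_SUP: "h x = (SUP S0\<in>{S0. finite S0 \<and> S0 \<subseteq> S}. ennreal (\<Sum>Q\<in>S0. a Q powr \<nu> * indicator Q x))"
proof -
  have "h x = (SUP S0\<in>{S0. finite S0 \<and> S0 \<subseteq> S}. (\<Sum>Q\<in>S0. epowr (frac_average \<alpha> f Q) \<nu> * indicator Q x))"
    unfolding h_def by (rule nonneg_infsum_complete) simp
  also have "\<dots> = (SUP S0\<in>{S0. finite S0 \<and> S0 \<subseteq> S}. ennreal (\<Sum>Q\<in>S0. a Q powr \<nu> * indicator Q x))"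
  proof (intro SUP_cong refl)
    fix S0 assume "S0 \<in> {S0. finite S0 \<and> S0 \<subseteq> S}"
    then have "(\<Sum>Q\<in>S0. epowr (frac_average \<alpha> f Q) \<nu> * indicator Q x) = (\<Sum>Q\<in>S0. ennreal (a Q powr \<nu> * indicator Q x))"
      by (intro sum.cong refl) (auto simp: epowr_frac_average ennreal_mult ennreal_indicator)
    then show "(\<Sum>Q\<in>S0. epowr (frac_average \<alpha> f Q) \<nu> * indicator Q x) = ennreal (\<Sum>Q\<in>S0. a Q powr \<nu> * indicator Q x)"
      by simp
  qed
  finally show ?thesis .
qed

text \<open>The strict inequality makes the superlevel set of a supremum the union of those of the
  partial sums. An enumeration of \<open>S\<close> replaces all finite subfamilies by an increasing
  sequence, so continuity from below applies.\<close>

lemma weak_bound: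
  assumes t: "t > 0" and Ai: "p = \<nu> \<Longrightarrow> Ainf_const D (\<lambda>x. ennreal (w x powr q)) < top"
  shows "{x. h x > ennreal (t powr \<nu>)} \<in> sets u"
    and "emeasure u {x. h x > ennreal (t powr \<nu>)}
    \<le> ennreal (weak_const \<nu> \<tau> \<gamma> p q * A powr (q * \<beta>) * F powr r * (T powr (1 / \<nu>) / t) powr q)"
proof -
  let ?B = "ennreal (weak_const \<nu> \<tau> \<gamma> p q * A powr (q * \<beta>) * F powr r * (T powr (1 / \<nu>) / t) powr q)"
  have cS: "countable S" using dyadic_grid_countable[OF grid] SD by (rule countable_subset[rotated])
  define Sn where "Sn n = {Q \<in> S. to_nat_on S Q < n}" for n
  have fin: "finite (Sn n)" for n
  proof (rule finite_imageD)
    show "finite (to_nat_on S ` Sn n)" by (rule finite_subset[of _ "{..<n}"]) (auto simp: Sn_def)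
    show "inj_on (to_nat_on S) (Sn n)"
      using inj_on_to_nat_on[OF cS] by (rule inj_on_subset) (auto simp: Sn_def)
  qed
  have sub: "Sn n \<subseteq> S" for n by (auto simp: Sn_def)
  define G where "G n x = (\<Sum>Q\<in>Sn n. a Q powr \<nu> * indicator Q x)" for n x
  have G_mono: "G n x \<le> G m x" if "n \<le> m" for n m x
    unfolding G_def by (rule sum_mono2) (use that fin in \<open>auto simp: Sn_def\<close>)
  have G_meas: "G n \<in> borel_measurable u" for n
    unfolding G_def
  proof (intro borel_measurable_sum borel_measurable_times borel_measurable_const borel_measurable_indicator)
    fix Q assume "Q \<in> Sn n"
    then have "Q \<in> D" using sub SD by blast
    then show "Q \<in> sets u" using cube_props(2) by simp
  qed
  let ?X = "\<lambda>n. {x. G n x > t powr \<nu>}"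
  have X_sets: "?X n \<in> sets u" for n
  proof -
    have "{x \<in> space u. G n x > t powr \<nu>} \<in> sets u"
      by (rule borel_measurable_less[OF borel_measurable_const G_meas])
    moreover have "space u = UNIV" by simp
    ultimately show ?thesis by (simp only: UNIV_I simp_thms)
  qed
  have Xh: "{x. h x > ennreal (t powr \<nu>)} = (\<Union>n. ?X n)"
  proof (intro equalityI subsetI)
    fix x assume "x \<in> {x. h x > ennreal (t powr \<nu>)}"
    then have "ennreal (t powr \<nu>) < h x" by simp
    then obtain S0 where "S0 \<in> {S0. finite S0 \<and> S0 \<subseteq> S}"
      and S0': "ennreal (t powr \<nu>) < ennreal (\<Sum>Q\<in>S0. a Q powr \<nu> * indicator Q x)"
      unfolding h_eq_SUP less_SUP_iff by (rule bexE)
    then have S0: "finite S0" "S0 \<subseteq> S" by simp_all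
    note S0 = S0 S0'
    \<comment> \<open>This index lies beyond the position of every cube of \<open>S0\<close> in the
      enumeration.\<close>
    define n where "n = Suc (\<Sum>Q\<in>S0. to_nat_on S Q)"
    have "S0 \<subseteq> Sn n"
    proof
      fix Q assume Q: "Q \<in> S0"
      then have "to_nat_on S Q \<le> (\<Sum>Q\<in>S0. to_nat_on S Q)" using S0(1) by (intro member_le_sum) auto
      then show "Q \<in> Sn n" using Q S0(2) by (auto simp: Sn_def n_def)
    qed
    then have "(\<Sum>Q\<in>S0. a Q powr \<nu> * indicator Q x) \<le> G n x"
      unfolding G_def using fin by (intro sum_mono2) auto
    moreover have "t powr \<nu> < (\<Sum>Q\<in>S0. a Q powr \<nu> * indicator Q x)"
      using S0(3) by (subst (asm) ennreal_less_iff) auto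
    ultimately have "t powr \<nu> < G n x" by linarith
    then show "x \<in> (\<Union>n. ?X n)" by blast
  next
    fix x assume "x \<in> (\<Union>n. ?X n)"
    then obtain n where "t powr \<nu> < G n x" by blast
    then have "ennreal (t powr \<nu>) < ennreal (G n x)" by (intro ennreal_lessI) (auto intro: le_less_trans[OF powr_ge_zero])
    also have "\<dots> \<le> h x" unfolding h_eq_SUP G_def using fin sub by (intro SUP_upper) auto
    finally show "x \<in> {x. h x > ennreal (t powr \<nu>)}" by simp
  qed
  have X_range: "range ?X \<subseteq> sets u" by (rule image_subsetI) (rule X_sets)
  have X_inc: "incseq ?X"
  proof (rule incseq_SucI, rule subsetI)
    fix n x assume "x \<in> ?X n"
    then show "x \<in> ?X (Suc n)" using G_mono[of n "Suc n" x] by simp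
  qed
  show "{x. h x > ennreal (t powr \<nu>)} \<in> sets u"
    unfolding Xh using X_range by (rule sets.countable_UN)
  note Xh
  also have "emeasure u (\<Union>n. ?X n) = (SUP n. emeasure u (?X n))"
    using X_range X_inc by (rule SUP_emeasure_incseq[symmetric])
  also have "\<dots> \<le> ?B"
  proof (rule SUP_least)
    fix n
    have "{x \<in> space u. G n x \<ge> t powr \<nu>} \<in> sets u"
      by (rule borel_measurable_le[OF borel_measurable_const G_meas])
    moreover have "space u = UNIV" by simp
    ultimately have "{x. G n x \<ge> t powr \<nu>} \<in> sets u" by (simp only: UNIV_I simp_thms)
    then have "emeasure u (?X n) \<le> emeasure u {x. G n x \<ge> t powr \<nu>}"
      by (rule emeasure_mono[rotated]) (rule Collect_mono, rule impI, rule less_imp_le)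
    also have "\<dots> \<le> ?B" unfolding G_def by (rule finite_weak_bound_scaled[OF fin sub t Ai])
    finally show "emeasure u (?X n) \<le> ?B" .
  qed
  finally show "emeasure u {x. h x > ennreal (t powr \<nu>)} \<le> ?B" .
qed

lemma sparse_op_eq: "sparse_op \<alpha> \<nu> S f x = epowr (h x) (1 / \<nu>)"
  unfolding sparse_op_def h_def ..

lemma weak_norm_le:
  assumes Ai: "p = \<nu> \<Longrightarrow> Ainf_const D (\<lambda>x. ennreal (w x powr q)) < top"
  shows "weak_Lq_norm u q (sparse_op \<alpha> \<nu> S f)
    \<le> ennreal (weak_const \<nu> \<tau> \<gamma> p q powr (1 / q) * threshold_const \<gamma> powr (1 / \<nu>)
        * A powr \<beta> * L powr (1 / \<nu>) * F powr (1 / p))"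
  unfolding weak_Lq_norm_def
proof (rule SUP_least)
  fix t :: real assume "t \<in> {0<..}"
  then have t: "t > 0" by simp
  let ?c = "weak_const \<nu> \<tau> \<gamma> p q"
  let ?b = "?c * A powr (q * \<beta>) * F powr r * (T powr (1 / \<nu>) / t) powr q"
  have c: "?c > 0" using p gamma by (intro weak_const_pos)
  have thr: "threshold_const \<gamma> \<ge> 0" "L \<ge> 0" "T \<ge> 0"
    using threshold_ge(1) L_ge_1 gamma by (auto simp: threshold_const_def)
  have "{x \<in> space u. sparse_op \<alpha> \<nu> S f x > ennreal t} \<subseteq> {x. h x > ennreal (t powr \<nu>)}"
  proof
    fix x assume x: "x \<in> {x \<in> space u. sparse_op \<alpha> \<nu> S f x > ennreal t}"
    show "x \<in> {x. h x > ennreal (t powr \<nu>)}"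
    proof (rule ccontr)
      assume "\<not> ?thesis"
      then have "epowr (h x) (1 / \<nu>) \<le> epowr (ennreal (t powr \<nu>)) (1 / \<nu>)"
        using nu by (intro epowr_mono) (auto simp: not_less)
      also have "\<dots> = ennreal t" using t nu by (simp add: epowr_ennreal powr_powr)
      finally show False using x unfolding sparse_op_eq by (auto simp: not_less[symmetric])
    qed
  qed
  then have "emeasure u {x \<in> space u. sparse_op \<alpha> \<nu> S f x > ennreal t} \<le> ennreal ?b"
    using weak_bound[OF t Ai] by (meson emeasure_mono order_trans)
  then have "epowr (emeasure u {x \<in> space u. sparse_op \<alpha> \<nu> S f x > ennreal t}) (1 / q) \<le> epowr (ennreal ?b) (1 / q)"
    using basics(1) by (intro epowr_mono) auto
  also have "\<dots> = ennreal (?b powr (1 / q))" using c by (intro epowr_ennreal) auto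
  finally have "ennreal t * epowr (emeasure u {x \<in> space u. sparse_op \<alpha> \<nu> S f x > ennreal t}) (1 / q)
    \<le> ennreal t * ennreal (?b powr (1 / q))" by (rule mult_left_mono) simp
  also have "\<dots> = ennreal (t * ?b powr (1 / q))" using t by (simp add: ennreal_mult)
  also have "?b powr (1 / q) = ?c powr (1 / q) * A powr \<beta> * F powr (1 / p) * (T powr (1 / \<nu>) / t)"
    using c basics(1) t by (simp add: powr_mult powr_powr r_def)
  also have "t * \<dots> = ?c powr (1 / q) * threshold_const \<gamma> powr (1 / \<nu>) * A powr \<beta> * L powr (1 / \<nu>) * F powr (1 / p)"
    using t thr by (simp add: powr_mult)
  finally show "ennreal t * epowr (emeasure u {x \<in> space u. sparse_op \<alpha> \<nu> S f x > ennreal t}) (1 / q)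
    \<le> ennreal (?c powr (1 / q) * threshold_const \<gamma> powr (1 / \<nu>) * A powr \<beta> * L powr (1 / \<nu>) * F powr (1 / p))" .
qed

text \<open>For p = \<nu> the upper limit \<nu> / (1 - \<nu> \<alpha> / d), when finite, is q
  itself, and \<nu> = p \<le> q.\<close>

lemma phi_critical:
  assumes "p = \<nu>"
  shows "phi (real CARD('d)) \<alpha> \<nu> q x = epowr (log1 x) (1 / \<nu>)"
proof -
  have "q \<le> \<nu> / (1 - \<nu> * \<alpha> / real CARD('d))" if "\<nu> * \<alpha> < real CARD('d)"
  proof -
    have "1 - \<nu> * \<alpha> / real CARD('d) > 0" using that by simp
    moreover have "q * (1 - \<nu> * \<alpha> / real CARD('d)) = \<nu>"
    proof -
      have "\<alpha> / real CARD('d) = 1 / \<nu> - 1 / q" using exps assms by simp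
      then have "\<nu> * \<alpha> / real CARD('d) = \<nu> * (1 / \<nu> - 1 / q)" by (simp only: times_divide_eq_right[symmetric])
      also have "\<dots> = 1 - \<nu> / q" using nu by (simp add: right_diff_distrib)
      finally show ?thesis using basics(1) by simp
    qed
    ultimately show ?thesis by (simp add: le_divide_eq)
  qed
  then show ?thesis unfolding phi_def using p assms by auto
qed

text \<open>If p = \<nu> and the constant in the logarithm is infinite, the right-hand side of the
  theorem is \<open>top\<close> except when another factor is 0, for \<open>0 * top = 0\<close>. In
  that exceptional case all averages of \<open>f\<close> over cubes of \<open>S\<close>
  vanish.\<close>

lemma weak_norm_eq_0:
  assumes "A = 0 \<or> F = 0"
  shows "weak_Lq_norm u q (sparse_op \<alpha> \<nu> S f) = 0"
proof -
  have aQ: "a Q = 0" if "Q \<in> S" for Q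
  proof -
    have Q: "Q \<in> D" using that SD by blast
    interpret C: weight_on_cube w Q p q A "measure lebesgue Q" by (rule cube_props(1)[OF Q])
    have "measure mu Q \<le> F"
      using finite_measure.bounded_measure[OF fin_mu, of Q] F_eq(2) by simp
    then have "A = 0 \<or> measure mu Q = 0" using assms measure_nonneg[of mu Q] by linarith
    then have zero: "A * measure mu Q powr r = 0" by auto
    have "C.U * a Q powr q \<le> A * measure mu Q powr r"
      unfolding a_def C.U_def by (rule testing(3)[OF Q C.Q_meas]) simp
    then have "C.U * a Q powr q \<le> 0" unfolding zero .
    then show "a Q = 0" using C.U_pos by (simp add: mult_le_0_iff not_le)
  qed
  have "h x = 0" for x
    unfolding h_eq_SUP using aQ by (intro antisym SUP_least) (auto simp: subset_iff)
  then have "sparse_op \<alpha> \<nu> S f x = 0" for x unfolding sparse_op_eq by (simp add: epowr_def)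
  then show ?thesis unfolding weak_Lq_norm_def by (simp add: epowr_def)
qed

end

theorem theorem4p3:
  fixes \<nu> \<alpha> p q \<gamma> :: real
  assumes "\<nu> \<ge> 1"
    and "0 \<le> \<alpha>" and "\<alpha> < real CARD('d::finite)"
    and "1 \<le> p" and "p \<le> q"
    and "1 / q + \<alpha> / real CARD('d) = 1 / p"
    and "0 < \<gamma>" and "\<gamma> < 1"
  shows "\<exists>C::real. C > 0 \<and>
    (\<forall>(D :: (real ^ 'd) set set) S (w :: real ^ 'd \<Rightarrow> real) (f :: real ^ 'd \<Rightarrow> real).
       dyadic_grid D \<longrightarrow> S \<subseteq> D \<longrightarrow> sparse_family \<gamma> S \<longrightarrow>
       weight w \<longrightarrow> Apq_const D p q w < top \<longrightarrow>
       f \<in> borel_measurable lebesgue \<longrightarrow> (\<forall>x. f x \<ge> 0) \<longrightarrow>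
       Lp_norm p (\<lambda>x. w x * f x) < top \<longrightarrow>
       weak_Lq_norm (density lebesgue (\<lambda>x. ennreal (w x powr q))) q (sparse_op \<alpha> \<nu> S f)
         \<le> ennreal C
            * epowr (Apq_const D p q w) (max (1 / q) (1 / \<nu> - \<alpha> / real CARD('d)))
            * phi (real CARD('d)) \<alpha> \<nu> q (Ainf_const D (\<lambda>x. ennreal (w x powr q)))
            * Lp_norm p (\<lambda>x. w x * f x))"
proof -
  let ?\<tau> = "1 - \<alpha> / real CARD('d)"
  let ?C = "weak_const \<nu> ?\<tau> \<gamma> p q powr (1 / q) * threshold_const \<gamma> powr (1 / \<nu>)"
  have "weak_const \<nu> ?\<tau> \<gamma> p q > 0" using assms by (intro weak_const_pos) auto
  moreover have "threshold_const \<gamma> > 0"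
    unfolding threshold_const_def using assms by (auto intro!: add_pos_nonneg)
  ultimately have C: "?C > 0" by simp
  show ?thesis
  proof (intro exI[of _ ?C] conjI C allI impI)
    fix D :: "(real ^ 'd) set set" and S and w f :: "real ^ 'd \<Rightarrow> real"
    assume hyps: "dyadic_grid D" "S \<subseteq> D" "sparse_family \<gamma> S" "weight w" "Apq_const D p q w < top"
      "f \<in> borel_measurable lebesgue" "\<forall>x. f x \<ge> 0" "Lp_norm p (\<lambda>x. w x * f x) < top"
    have fin: "(\<integral>\<^sup>+x. ennreal (\<bar>w x * f x\<bar> powr p) \<partial>lebesgue) < top"
      using hyps(8) unfolding Lp_norm_def by (simp add: less_top[symmetric] epowr_eq_top_iff)
    interpret weighted_sparse \<nu> \<alpha> p q \<gamma> D S w f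
      by (rule weighted_sparse.intro) (fact assms hyps(1-6) fin hyps(7)[rule_format])+
    let ?P = "phi (real CARD('d)) \<alpha> \<nu> q (Ainf_const D (\<lambda>x. ennreal (w x powr q)))"
    have norm: "Lp_norm p (\<lambda>x. w x * f x) = ennreal (F powr (1 / p))"
    proof -
      have "(\<integral>\<^sup>+x. ennreal (\<bar>w x * f x\<bar> powr p) \<partial>lebesgue) = ennreal F" unfolding F_def using fin by simp
      then show ?thesis unfolding Lp_norm_def by (simp add: epowr_ennreal F_eq(3))
    qed
    have Apq: "epowr (Apq_const D p q w) (max (1 / q) (1 / \<nu> - \<alpha> / real CARD('d))) = ennreal (A powr \<beta>)"
      unfolding A_eq \<beta>_def using A_nonneg by (rule epowr_ennreal)
    have log1_ge: "1 \<le> epowr (log1 x) (1 / \<nu>)" for x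
    proof (cases "x = top")
      case False
      have "1 \<le> (1 + max (ln (enn2real x)) 0) powr (1 / \<nu>)"
        using assms(1) by (intro ge_one_powr_ge_zero) auto
      then show ?thesis unfolding epowr_log1[OF False] by simp
    qed (simp add: log1_def)
    show "weak_Lq_norm u q (sparse_op \<alpha> \<nu> S f)
      \<le> ennreal ?C * epowr (Apq_const D p q w) (max (1 / q) (1 / \<nu> - \<alpha> / real CARD('d))) * ?P
        * Lp_norm p (\<lambda>x. w x * f x)"
      unfolding norm Apq
    proof (cases "p = \<nu> \<and> Ainf_const D (\<lambda>x. ennreal (w x powr q)) = top")
      case False
      have P: "ennreal (L powr (1 / \<nu>)) \<le> ?P"
      proof (cases "p = \<nu>")
        case True
        then have "Ainf_const D (\<lambda>x. ennreal (w x powr q)) \<noteq> top" using False by simp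
        then have "epowr (log1 (Ainf_const D (\<lambda>x. ennreal (w x powr q)))) (1 / \<nu>) = ennreal (L powr (1 / \<nu>))"
          unfolding L_def Ai_def using True by (simp add: epowr_log1)
        then show ?thesis unfolding phi_critical[OF True] by simp
      next
        case False
        \<comment> \<open>Away from p = \<nu> no logarithm arises, and \<open>phi\<close> is at
          least 1 in either of its branches.\<close>
        then have "ennreal (L powr (1 / \<nu>)) = 1" by (simp add: L_def)
        then show ?thesis unfolding phi_def using log1_ge by simp
      qed
      have "weak_Lq_norm u q (sparse_op \<alpha> \<nu> S f) \<le> ennreal (?C * A powr \<beta> * L powr (1 / \<nu>) * F powr (1 / p))"
        using weak_norm_le False unfolding \<tau>_def by (auto simp: less_top)
      also have "\<dots> = ennreal ?C * ennreal (A powr \<beta>) * ennreal (L powr (1 / \<nu>)) * ennreal (F powr (1 / p))"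
        using C by (simp add: ennreal_mult)
      also have "\<dots> \<le> ennreal ?C * ennreal (A powr \<beta>) * ?P * ennreal (F powr (1 / p))"
        by (intro mult_right_mono mult_left_mono P) auto
      finally show "weak_Lq_norm u q (sparse_op \<alpha> \<nu> S f)
        \<le> ennreal ?C * ennreal (A powr \<beta>) * ?P * ennreal (F powr (1 / p))" .
    next
      case True
      then have P: "?P = top" using phi_critical by (simp add: log1_def)
      show "weak_Lq_norm u q (sparse_op \<alpha> \<nu> S f)
        \<le> ennreal ?C * ennreal (A powr \<beta>) * ?P * ennreal (F powr (1 / p))"
      proof (cases "A = 0 \<or> F = 0")
        case True
        then show ?thesis using weak_norm_eq_0 by simp
      next
        case False
        then have "ennreal ?C * ennreal (A powr \<beta>) \<noteq> 0" "ennreal (F powr (1 / p)) \<noteq> 0"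
          using C by (simp_all add: ennreal_eq_0_iff not_le)
        then show ?thesis unfolding P by (simp add: ennreal_mult_top ennreal_top_mult)
      qed
    qed
  qed
qed

end
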